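(* Let $E^I$ be a frame of the solution $(A_1,F)$ of the $G_{m,n}$-system I, and $(\tilde A_1,\tilde F,\tilde E^I)=g_{s,\pi}\cdot(A_1,F,E^I)$ (defined in the context). Write $$E^I(x,1)=(X(x),e_{n+2}(x),\dots,e_{n+m}(x),e_1(x),\dots,e_n(x)),$$ $$\tilde E^I(x,1)=(\tilde X(x),\tilde e_{n+2}(x),\dots,\tilde e_{n+m}(x),\tilde e_1(x),\dots,\tilde e_n(x)).$$ Then: (1) Both $X$ and $\tilde X$ are immersions of flat $n$-dimensional submanifolds of $S^{n+m-1}$ with flat, non-degenerate normal bundle, $x_1,\dots,x_n$ are line of curvature coordinates, and $\{e_\alpha\}_{\alpha=n+2}^{n+m}$ and $\{\tilde e_\alpha\}_{\alpha=n+2}^{n+m}$ are parallel normal frames for $X$ and $\tilde X$ respectively. (2) $(A_1,F)$ and $(\tilde A_1,\tilde F)$ are the solutions of the $G_{m,n}$-system I corresponding to $X$ and $\tilde X$ respectively. (3) The bundle morphism $P:\nu(M)\to\nu(\tilde M)$ (normal bundles of the submanifolds $M,\tilde M$ given by $X,\tilde X$) defined by $P(e_\alpha(x))=\tilde e_\alpha(x)$ for $n+2\le\alpha\le n+m$ is a Ribaucour transformation covering the map $X(x)\mapsto\tilde X(x)$.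
   Context: Throughout $m\ge n$. $\mathcal M_{p\times q}$: real $p\times q$ matrices; $gl_*(n)$: real $n\times n$ matrices with zero diagonal; $C_i$: the $n\times n$ matrix whose only non-zero entry is a $1$ at $(i,i)$; $D_i=\begin{pmatrix}C_i\\0\end{pmatrix}\in\mathcal M_{m\times n}$; $I_{m,n}=\mathrm{diag}(I_m,-I_n)$. Flat means $d\theta+\theta\wedge\theta=0$. $G_{m,n}$-reality condition: $\overline{E(x,\bar\lambda)}=E(x,\lambda)$, $I_{m,n}E(x,\lambda)I_{m,n}^{-1}=E(x,-\lambda)$, $EE^t=I$. $G_{m,n}$-system: $\xi:\mathbb R^n\to\mathcal M_{m\times n}$ with $\xi_{ii}=0$ is a solution if $\theta_\lambda=\sum_i\left\{\lambda\begin{pmatrix}0&-D_i\\ D_i^t&0\end{pmatrix}+\begin{pmatrix}D_i\xi^t-\xi D_i^t&0\\0&-\xi^tD_i+D_i^t\xi\end{pmatrix}\right\}dx_i$ is flat for all $\lambda\in\mathbb C$. $G_{m,n}$-system I: $(A_1,F)$ with $A_1\in\mathcal M_{m\times n}$, $A_1^tA_1=I$, $F\in gl_*(n)$ is a solution if $\theta^I_\lambda=\sum_i\begin{pmatrix}0&-A_1C_i\lambda\\ C_iA_1^t\lambda&-F^tC_i+C_iF\end{pmatrix}dx_i$ is flat for all $\lambda\in\mathbb C$. A frame of a solution is a trivialization of its Lax connection ($E^{-1}dE=\theta_\lambda$, resp. $(E^I)^{-1}dE^I=\theta^I_\lambda$) satisfying the $G_{m,n}$-reality condition. The action: let $0\ne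 s\in\mathbb R$, $W\in\mathbb R^m$, $Z\in\mathbb R^n$ unit vectors, $\pi$ the Hermitian projection of $\mathbb C^{m+n}$ onto $\mathbb C\binom W{iZ}$, and $g_{s,\pi}(\lambda)=\left(\pi+\frac{\lambda-is}{\lambda+is}(I-\pi)\right)\left(\bar\pi+\frac{\lambda+is}{\lambda-is}(I-\bar\pi)\right)$. There exist $A=(A_1,A_2)$ with values in $O(m)$ and $G$ with values in $\mathcal M_{(m-n)\times n}$ such that $\xi=\binom FG$ is a solution of the $G_{m,n}$-system with frame $E=E^I\begin{pmatrix}A&0\\0&I_n\end{pmatrix}$; $E(x,\lambda)$ is taken holomorphic for $\lambda\in\mathbb C$. Put $\binom{\tilde W}{i\tilde Z}(x)=E(x,-is)^{-1}\binom W{iZ}$ ($\tilde W,\tilde Z$ are real, of equal norm), $\hat W=\tilde W/\|\tilde W\|$, $\hat Z=\tilde Z/\|\tilde Z\|$. Then $\tilde F$ has zero diagonal and entries $\tilde f_{ij}=f_{ij}-2s\hat w_i\hat z_j$ ($i\ne j$), $\tilde A_1$ consists of the first $n$ columns of $\tilde A=A(I-2\hat W\hat W^t)$, and $$\tilde E^I(x,\lambda)=E^I(x,\lambda)\left(I-\frac2{\lambda^2+s^2}\begin{pmatrix}\lambda A\hat W\\ s\hat Z\end{pmatrix}\begin{pmatrix}\lambda\hat W^tA^t&s\hat Z^t\end{pmatrix}\right).$$ A solution $(A_1,F)=((a_{ij}),(f_{ij}))$ corresponds to $X$, with parallel normal frame $e_{n+2},\dots,e_{n+m}$, if $I=\sum_ia_{1i}^2dx_i^2$,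 $II=\sum_{i=1}^n\sum_{j=2}^ma_{1i}a_{ji}dx_i^2e_{n+j}$ and $f_{ij}=(a_{1i})_{x_j}/a_{1j}$ for $i\ne j$. Here $I=\sum\omega_i^2$, $II=\sum\omega_{i\alpha}\omega_ie_\alpha$ with $\omega_i=\langle dX,e_i\rangle$, $\omega_{i\alpha}=\langle e_i,de_\alpha\rangle$. The normal bundle of an $n$-dimensional submanifold is non-degenerate if at each point the space of shape operators $\{A_v:v\text{ normal}\}$ has dimension $n$. Line of curvature coordinates: $I$ and $II$ are diagonal in $dx_1,\dots,dx_n$. Ribaucour transformation: for $n$-dimensional submanifolds $M,\tilde M$ of a space form, let $\gamma_{x,v}(t)=\exp_x(tv)$. A sphere congruence is a vector bundle isomorphism $P:\nu(M)\to\nu(\tilde M)$ covering a diffeomorphism $\ell:M\to\tilde M$ such that (a) if $\zeta$ is a parallel normal field of $M$, then $P\circ\zeta\circ\ell^{-1}$ is a parallel normal field of $\tilde M$; (b) for any non-zero $\zeta\in\nu_x(M)$, the geodesics $\gamma_{x,\zeta}$ and $\gamma_{\ell(x),P(\zeta)}$ intersect at a point equidistant from $x$ and $\ell(x)$ (the distance depends on $x$). It is a Ribaucour transformation if in addition (c) if $e$ is an eigenvector of the shape operator $A_\zeta$ of $M$, then $\ell_*(e)$ is an eigenvector of the shape operator $A_{P(\zeta)}$ of $\tilde M$; (d) the geodesics $\gamma_{x,e}$ and $\gamma_{\ell(x),\ell_*(e)}$ intersect at a point equidistant from $x$ and $\ell(x)$.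
   Formalization: Claims for X, X̃ are made on open sets where no a_{1i}, resp. ã_{1i}, vanishes (else no immersion), (3) on the overlap; in (c),(d) e is a common eigenvector of all A_ζ (repeated eigenvalues break the literal form); non-degeneracy uses normals in R^{n+m} (inside the sphere impossible if m=n). *)

theory Defs
  imports "HOL-Analysis.Analysis"
begin

text \<open>
  Conventions. The index sets \<open>{1..n}\<close> and \<open>{1..m}\<close> are finite types \<open>'n\<close> and \<open>'m\<close>, together with
  an injection \<open>emb\<close> from \<open>'n\<close> to \<open>'m\<close> (so \<open>m \<ge> n\<close>) that singles out the "first \<open>n\<close>" indices
  among \<open>{1..m}\<close>, and an element \<open>k0\<close> of \<open>'m\<close> that plays the role of the row index 1 of \<open>A\<^sub>1\<close>.
  Matrices of size \<open>m + n\<close> are indexed by \<open>'m + 'n\<close>. A normal vector \<open>e\<close> with index \<open>n + j\<close>,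
  \<open>2 \<le> j \<le> m\<close>, is indexed by an element \<open>j\<close> of \<open>- {k0}\<close>.
\<close>

section \<open>Calculus and matrices\<close>

definition pd :: "'n \<Rightarrow> (real^'n \<Rightarrow> 'b) \<Rightarrow> real^'n \<Rightarrow> 'b::real_normed_vector" where
  "pd i f x = frechet_derivative f (at x) (axis i 1)"

primrec Ck_on :: "nat \<Rightarrow> (real^'n) set \<Rightarrow> (real^'n \<Rightarrow> 'b::real_normed_vector) \<Rightarrow> bool" where
  "Ck_on 0 U f \<longleftrightarrow> continuous_on U f"
| "Ck_on (Suc k) U f \<longleftrightarrow> (\<forall>x\<in>U. f differentiable (at x)) \<and> (\<forall>i. Ck_on k U (pd i f))"

text \<open>Only used for open \<open>U\<close>.\<close>

definition smooth_on :: "(real^'n) set \<Rightarrow> (real^'n \<Rightarrow> 'b::real_normed_vector) \<Rightarrow> bool" where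
  "smooth_on U f \<longleftrightarrow> (\<forall>k. Ck_on k U f)"

definition block :: "'a^'m^'m \<Rightarrow> 'a^'n^'m \<Rightarrow> 'a^'m^'n \<Rightarrow> 'a^'n^'n \<Rightarrow> 'a^('m::finite + 'n::finite)^('m + 'n)" where
  "block P Q R S = (\<chi> a b. case a of
       Inl i \<Rightarrow> (case b of Inl j \<Rightarrow> P $ i $ j | Inr j \<Rightarrow> Q $ i $ j)
     | Inr i \<Rightarrow> (case b of Inl j \<Rightarrow> R $ i $ j | Inr j \<Rightarrow> S $ i $ j))"

definition join :: "'a^'m \<Rightarrow> 'a^'n \<Rightarrow> 'a^('m::finite + 'n::finite)" where
  "join u v = (\<chi> a. case a of Inl j \<Rightarrow> u $ j | Inr i \<Rightarrow> v $ i)"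

definition outer :: "'a::times^'k \<Rightarrow> 'a^'l \<Rightarrow> 'a^'l^'k" where
  "outer u v = (\<chi> a b. u $ a * v $ b)"

abbreviation cmat :: "real^'k^'l \<Rightarrow> complex^'k^'l" where
  "cmat \<equiv> map_matrix complex_of_real"

abbreviation cscale :: "complex \<Rightarrow> complex^'k^'l \<Rightarrow> complex^'k^'l" where
  "cscale c \<equiv> map_matrix ((*) c)"

section \<open>The two systems, their Lax connections and frames\<close>

definition C_mat :: "'n \<Rightarrow> real^'n^'n" where
  "C_mat i = (\<chi> k l. if k = i \<and> l = i then 1 else 0)"

definition D_mat :: "('n \<Rightarrow> 'm) \<Rightarrow> 'n \<Rightarrow> real^'n^'m" where
  "D_mat emb i = (\<chi> k l. if k = emb i \<and> l = i then 1 else 0)"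

text \<open>A matrix-valued 1-form \<open>\<Sum>\<^sub>i \<theta>\<^sub>i dx\<^sub>i\<close> is given by its coefficients \<open>\<theta> i\<close>; the equation
  below is the coefficient of \<open>dx\<^sub>i \<and> dx\<^sub>j\<close> in \<open>d\<theta> + \<theta> \<and> \<theta> = 0\<close>.\<close>

definition flat_connection :: "('n \<Rightarrow> real^'n \<Rightarrow> complex^'a^'a) \<Rightarrow> bool" where
  "flat_connection \<theta> \<longleftrightarrow> (\<forall>x i j.
     pd i (\<theta> j) x - pd j (\<theta> i) x + (\<theta> i x ** \<theta> j x - \<theta> j x ** \<theta> i x) = 0)"

definition lax :: "('n \<Rightarrow> 'm) \<Rightarrow> (real^'n \<Rightarrow> real^'n^'m) \<Rightarrow> complex \<Rightarrow> 'n \<Rightarrow> real^'n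
    \<Rightarrow> complex^('m::finite + 'n::finite)^('m + 'n)" where
  "lax emb \<xi> l i x = (let D = D_mat emb i in
     cscale l (cmat (block 0 (- D) (transpose D) 0))
     + cmat (block (D ** transpose (\<xi> x) - \<xi> x ** transpose D) 0
                   0 (- (transpose (\<xi> x) ** D) + transpose D ** \<xi> x)))"

definition gsystem_solution :: "('n \<Rightarrow> 'm) \<Rightarrow> (real^'n \<Rightarrow> real^'n^'m) \<Rightarrow> bool" where
  "gsystem_solution emb \<xi> \<longleftrightarrow> smooth_on UNIV \<xi> \<and> (\<forall>x i. \<xi> x $ emb i $ i = 0)
     \<and> (\<forall>l. flat_connection (lax emb \<xi> l))"

definition laxI :: "(real^'n \<Rightarrow> real^'n^'m) \<Rightarrow> (real^'n \<Rightarrow> real^'n^'n) \<Rightarrow> complex \<Rightarrow> 'n \<Rightarrow> real^'n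
    \<Rightarrow> complex^('m::finite + 'n::finite)^('m + 'n)" where
  "laxI A1 F l i x = (let C = C_mat i in
     block 0 (cscale l (cmat (- (A1 x ** C))))
           (cscale l (cmat (C ** transpose (A1 x)))) (cmat (- (transpose (F x) ** C) + C ** F x)))"

definition gsystemI_solution :: "(real^'n \<Rightarrow> real^'n^'m) \<Rightarrow> (real^'n \<Rightarrow> real^'n^'n) \<Rightarrow> bool" where
  "gsystemI_solution A1 F \<longleftrightarrow> smooth_on UNIV A1 \<and> smooth_on UNIV F
     \<and> (\<forall>x. transpose (A1 x) ** A1 x = mat 1) \<and> (\<forall>x i. F x $ i $ i = 0)
     \<and> (\<forall>l. flat_connection (laxI A1 F l))"

definition I_mn :: "complex^('m::finite + 'n::finite)^('m + 'n)" where
  "I_mn = block (mat 1) 0 0 (- mat 1)"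

definition reality_condition :: "(real^'n \<Rightarrow> complex \<Rightarrow> complex^('m::finite + 'n::finite)^('m + 'n)) \<Rightarrow> bool" where
  "reality_condition E \<longleftrightarrow> (\<forall>x l.
       map_matrix cnj (E x (cnj l)) = E x l
     \<and> I_mn ** E x l ** matrix_inv I_mn = E x (- l)
     \<and> E x l ** transpose (E x l) = mat 1)"

definition trivialization :: "(complex \<Rightarrow> 'n \<Rightarrow> real^'n \<Rightarrow> complex^'a^'a)
    \<Rightarrow> (real^'n \<Rightarrow> complex \<Rightarrow> complex^'a^'a) \<Rightarrow> bool" where
  "trivialization \<theta> E \<longleftrightarrow> (\<forall>l. smooth_on UNIV (\<lambda>x. E x l)
     \<and> (\<forall>x. invertible (E x l) \<and> (\<forall>i. matrix_inv (E x l) ** pd i (\<lambda>y. E y l) x = \<theta> l i x)))"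

definition gsystem_frame :: "('n \<Rightarrow> 'm) \<Rightarrow> (real^'n \<Rightarrow> real^'n^'m)
    \<Rightarrow> (real^'n \<Rightarrow> complex \<Rightarrow> complex^('m::finite + 'n::finite)^('m + 'n)) \<Rightarrow> bool" where
  "gsystem_frame emb \<xi> E \<longleftrightarrow> trivialization (lax emb \<xi>) E \<and> reality_condition E"

definition gsystemI_frame :: "(real^'n \<Rightarrow> real^'n^'m) \<Rightarrow> (real^'n \<Rightarrow> real^'n^'n)
    \<Rightarrow> (real^'n \<Rightarrow> complex \<Rightarrow> complex^('m::finite + 'n::finite)^('m + 'n)) \<Rightarrow> bool" where
  "gsystemI_frame A1 F E \<longleftrightarrow> trivialization (laxI A1 F) E \<and> reality_condition E"

section \<open>The action\<close>

definition gauge :: "(real^'n \<Rightarrow> complex \<Rightarrow> complex^('m::finite + 'n::finite)^('m + 'n)) \<Rightarrow> (real^'n \<Rightarrow> real^'m^'m)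
    \<Rightarrow> real^'n \<Rightarrow> complex \<Rightarrow> complex^('m::finite + 'n::finite)^('m + 'n)" where
  "gauge EI A x l = EI x l ** cmat (block (A x) 0 0 (mat 1))"

text \<open>\<open>A = (A\<^sub>1, A\<^sub>2)\<close> is orthogonal, and \<open>\<xi>\<close> has \<open>F\<close> as its upper block and solves the
  \<open>G\<^sub>m\<^sub>,\<^sub>n\<close>-system with frame \<open>E\<^sup>I diag(A, I)\<close>, holomorphic in the spectral parameter.\<close>

definition gsystem_lift :: "('n \<Rightarrow> 'm) \<Rightarrow> (real^'n \<Rightarrow> real^'n^'m) \<Rightarrow> (real^'n \<Rightarrow> real^'n^'n)
    \<Rightarrow> (real^'n \<Rightarrow> complex \<Rightarrow> complex^('m::finite + 'n::finite)^('m + 'n)) \<Rightarrow> (real^'n \<Rightarrow> real^'m^'m)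
    \<Rightarrow> (real^'n \<Rightarrow> real^'n^'m) \<Rightarrow> bool" where
  "gsystem_lift emb A1 F EI A \<xi> \<longleftrightarrow>
       smooth_on UNIV A \<and> (\<forall>x. orthogonal_matrix (A x))
     \<and> (\<forall>x j i. A x $ j $ emb i = A1 x $ j $ i)
     \<and> (\<forall>x i j. \<xi> x $ emb i $ j = F x $ i $ j)
     \<and> gsystem_solution emb \<xi> \<and> gsystem_frame emb \<xi> (gauge EI A)
     \<and> (\<forall>x a b. (\<lambda>l. gauge EI A x l $ a $ b) holomorphic_on UNIV)"

text \<open>The vector \<open>E(x, - i s)\<^sup>-\<^sup>1 (W; i Z)\<close>. By the reality condition its upper part is real and its
  lower part is purely imaginary, so it equals \<open>(W\<^sub>t; i Z\<^sub>t)\<close> for the \<open>W\<^sub>t\<close>, \<open>Z\<^sub>t\<close> below.\<close>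

definition moved_vector :: "(real^'n \<Rightarrow> complex \<Rightarrow> complex^('m::finite + 'n::finite)^('m + 'n)) \<Rightarrow> real
    \<Rightarrow> real^'m \<Rightarrow> real^'n \<Rightarrow> real^'n \<Rightarrow> complex^('m::finite + 'n::finite)" where
  "moved_vector E s W Z x =
     matrix_inv (E x (- \<i> * complex_of_real s)) *v
       join (\<chi> j. complex_of_real (W $ j)) (\<chi> i. \<i> * complex_of_real (Z $ i))"

definition W_tilde :: "(real^'n \<Rightarrow> complex \<Rightarrow> complex^('m::finite + 'n::finite)^('m + 'n)) \<Rightarrow> real
    \<Rightarrow> real^'m \<Rightarrow> real^'n \<Rightarrow> real^'n \<Rightarrow> real^'m" where
  "W_tilde E s W Z x = (\<chi> j. Re (moved_vector E s W Z x $ Inl j))"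

definition Z_tilde :: "(real^'n \<Rightarrow> complex \<Rightarrow> complex^('m::finite + 'n::finite)^('m + 'n)) \<Rightarrow> real
    \<Rightarrow> real^'m \<Rightarrow> real^'n \<Rightarrow> real^'n \<Rightarrow> real^'n" where
  "Z_tilde E s W Z x = (\<chi> i. Im (moved_vector E s W Z x $ Inr i))"

definition W_hat :: "(real^'n \<Rightarrow> complex \<Rightarrow> complex^('m::finite + 'n::finite)^('m + 'n)) \<Rightarrow> real
    \<Rightarrow> real^'m \<Rightarrow> real^'n \<Rightarrow> real^'n \<Rightarrow> real^'m" where
  "W_hat E s W Z x = W_tilde E s W Z x /\<^sub>R norm (W_tilde E s W Z x)"

definition Z_hat :: "(real^'n \<Rightarrow> complex \<Rightarrow> complex^('m::finite + 'n::finite)^('m + 'n)) \<Rightarrow> real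
    \<Rightarrow> real^'m \<Rightarrow> real^'n \<Rightarrow> real^'n \<Rightarrow> real^'n" where
  "Z_hat E s W Z x = Z_tilde E s W Z x /\<^sub>R norm (Z_tilde E s W Z x)"

text \<open>The triple \<open>g\<^sub>s\<^sub>,\<^sub>\<pi> \<cdot> (A\<^sub>1, F, E\<^sup>I)\<close>, where \<open>\<pi>\<close> is the Hermitian projection onto the line
  spanned by \<open>(W; i Z)\<close>; \<open>A\<close> is the orthogonal matrix of a lift as above.\<close>

definition g_action :: "('n \<Rightarrow> 'm) \<Rightarrow> real \<Rightarrow> real^'m \<Rightarrow> real^'n \<Rightarrow> (real^'n \<Rightarrow> real^'m^'m)
    \<Rightarrow> (real^'n \<Rightarrow> real^'n^'n) \<Rightarrow> (real^'n \<Rightarrow> complex \<Rightarrow> complex^('m::finite + 'n::finite)^('m + 'n))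
    \<Rightarrow> (real^'n \<Rightarrow> real^'n^'m) \<times> (real^'n \<Rightarrow> real^'n^'n)
       \<times> (real^'n \<Rightarrow> complex \<Rightarrow> complex^('m::finite + 'n::finite)^('m + 'n))" where
  "g_action emb s W Z A F EI =
     (let w = W_hat (gauge EI A) s W Z;
          z = Z_hat (gauge EI A) s W Z;
          At = (\<lambda>x. A x ** (mat 1 - 2 *\<^sub>R outer (w x) (w x)));
          p = (\<lambda>x l. join (\<chi> j. l * complex_of_real ((A x *v w x) $ j))
                           (\<chi> i. complex_of_real (s * z x $ i)))
      in (\<lambda>x. \<chi> j i. At x $ j $ emb i,
          \<lambda>x. \<chi> i j. if i = j then 0 else F x $ i $ j - 2 * s * w x $ emb i * z x $ j,
          \<lambda>x l. EI x l **
             (mat 1 - cscale (2 / (l\<^sup>2 + (complex_of_real s)\<^sup>2)) (outer (p x l) (p x l)))))"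

definition real_column :: "(real^'n \<Rightarrow> complex \<Rightarrow> complex^'a^'a) \<Rightarrow> 'a \<Rightarrow> real^'n \<Rightarrow> real^'a" where
  "real_column E b x = (\<chi> a. Re (E x 1 $ a $ b))"

section \<open>Submanifolds of the unit sphere\<close>

text \<open>A submanifold of the unit sphere of a Euclidean space is given by an immersion \<open>X\<close> of an
  open set \<open>U\<close> of parameters. Tangent vectors at the point with parameter \<open>x\<close> are represented by
  \<open>u\<close> in \<open>real^'n\<close>, standing for \<open>dX\<^sub>x(u)\<close>; bundles over the submanifold are bundles over \<open>U\<close>.\<close>

abbreviation dmap :: "(real^'n \<Rightarrow> 'b::real_normed_vector) \<Rightarrow> real^'n \<Rightarrow> real^'n \<Rightarrow> 'b" where
  "dmap X x \<equiv> frechet_derivative X (at x)"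

definition sphere_immersion :: "(real^'n) set \<Rightarrow> (real^'n \<Rightarrow> 'a::euclidean_space) \<Rightarrow> bool" where
  "sphere_immersion U X \<longleftrightarrow> open U \<and> smooth_on U X
     \<and> (\<forall>x\<in>U. X x \<in> sphere 0 1 \<and> inj (dmap X x))"

definition tangent_space :: "(real^'n \<Rightarrow> 'a::euclidean_space) \<Rightarrow> real^'n \<Rightarrow> 'a set" where
  "tangent_space X x = range (dmap X x)"

text \<open>The normal space inside the sphere, and the one inside the ambient Euclidean space
  (which also contains the position vector).\<close>

definition sphere_normal_space :: "(real^'n \<Rightarrow> 'a::euclidean_space) \<Rightarrow> real^'n \<Rightarrow> 'a set" where
  "sphere_normal_space X x = {v. v \<bullet> X x = 0 \<and> (\<forall>t\<in>tangent_space X x. v \<bullet> t = 0)}"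

definition euclidean_normal_space :: "(real^'n \<Rightarrow> 'a::euclidean_space) \<Rightarrow> real^'n \<Rightarrow> 'a set" where
  "euclidean_normal_space X x = {v. \<forall>t\<in>tangent_space X x. v \<bullet> t = 0}"

definition orth_proj :: "'a::euclidean_space set \<Rightarrow> 'a \<Rightarrow> 'a" where
  "orth_proj V v = (THE p. p \<in> V \<and> (\<forall>w\<in>V. (v - p) \<bullet> w = 0))"

text \<open>The connection induced on a subbundle \<open>V\<close> of the trivial bundle. For the tangent spaces this
  is the Levi-Civita connection of the induced metric, for the normal spaces the normal connection.\<close>

definition cov_deriv :: "(real^'n \<Rightarrow> 'a::euclidean_space set) \<Rightarrow> 'n \<Rightarrow> (real^'n \<Rightarrow> 'a) \<Rightarrow> real^'n \<Rightarrow> 'a"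
  where "cov_deriv V i \<zeta> x = orth_proj (V x) (pd i \<zeta> x)"

definition smooth_section :: "(real^'n) set \<Rightarrow> (real^'n \<Rightarrow> 'a::euclidean_space set) \<Rightarrow> (real^'n \<Rightarrow> 'a) \<Rightarrow> bool"
  where "smooth_section U V \<zeta> \<longleftrightarrow> smooth_on U \<zeta> \<and> (\<forall>x\<in>U. \<zeta> x \<in> V x)"

text \<open>Vanishing of the curvature \<open>R(\<partial>\<^sub>i, \<partial>\<^sub>j) \<zeta>\<close> for all sections \<open>\<zeta>\<close>.\<close>

definition flat_bundle :: "(real^'n) set \<Rightarrow> (real^'n \<Rightarrow> 'a::euclidean_space set) \<Rightarrow> bool" where
  "flat_bundle U V \<longleftrightarrow> (\<forall>\<zeta>. smooth_section U V \<zeta> \<longrightarrow> (\<forall>x\<in>U. \<forall>i j.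
     cov_deriv V i (cov_deriv V j \<zeta>) x = cov_deriv V j (cov_deriv V i \<zeta>) x))"

definition flat_submanifold :: "(real^'n) set \<Rightarrow> (real^'n \<Rightarrow> 'a::euclidean_space) \<Rightarrow> bool" where
  "flat_submanifold U X \<longleftrightarrow> flat_bundle U (tangent_space X)"

definition flat_normal_bundle :: "(real^'n) set \<Rightarrow> (real^'n \<Rightarrow> 'a::euclidean_space) \<Rightarrow> bool" where
  "flat_normal_bundle U X \<longleftrightarrow> flat_bundle U (sphere_normal_space X)"

text \<open>The matrix, in the basis of coordinate vector fields, of the shape operator: it is
  characterized by \<open>\<langle>A\<^sub>v a, b\<rangle> = \<langle>h(a, b), v\<rangle>\<close>, where \<open>h(\<partial>\<^sub>i, \<partial>\<^sub>j)\<close> is the normal part of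
  \<open>\<partial>\<^sub>i \<partial>\<^sub>j X\<close>. The overall sign of \<open>A\<^sub>v\<close> plays no role below.\<close>

definition shape_operator :: "(real^'n \<Rightarrow> 'a::euclidean_space) \<Rightarrow> real^'n \<Rightarrow> 'a \<Rightarrow> real^'n^'n" where
  "shape_operator X x v =
     matrix_inv (\<chi> i j. pd i X x \<bullet> pd j X x) ** (\<chi> i j. pd i (pd j X) x \<bullet> v)"

text \<open>Normal vectors in the ambient Euclidean space are used here: inside the sphere the normal
  spaces have dimension \<open>m - 1\<close>, which is less than \<open>n\<close> when \<open>m = n\<close>.\<close>

definition nondegenerate_normal_bundle :: "(real^'n) set \<Rightarrow> (real^'n \<Rightarrow> 'a::euclidean_space) \<Rightarrow> bool"
  where "nondegenerate_normal_bundle U X \<longleftrightarrow>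
     (\<forall>x\<in>U. dim (shape_operator X x ` euclidean_normal_space X x) = CARD('n))"

definition parallel_normal_field :: "(real^'n) set \<Rightarrow> (real^'n \<Rightarrow> 'a::euclidean_space) \<Rightarrow> (real^'n \<Rightarrow> 'a) \<Rightarrow> bool"
  where "parallel_normal_field U X \<zeta> \<longleftrightarrow> smooth_section U (sphere_normal_space X) \<zeta>
     \<and> (\<forall>x\<in>U. \<forall>i. cov_deriv (sphere_normal_space X) i \<zeta> x = 0)"

definition orthonormal_frame :: "(real^'n) set \<Rightarrow> (real^'n \<Rightarrow> 'a::euclidean_space set) \<Rightarrow> 'k set
    \<Rightarrow> ('k \<Rightarrow> real^'n \<Rightarrow> 'a) \<Rightarrow> bool" where
  "orthonormal_frame U V J e \<longleftrightarrow> (\<forall>k\<in>J. smooth_section U V (e k))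
     \<and> (\<forall>x\<in>U. (\<forall>k\<in>J. \<forall>l\<in>J. e k x \<bullet> e l x = (if k = l then 1 else 0))
              \<and> span ((\<lambda>k. e k x) ` J) = V x)"

definition parallel_normal_frame :: "(real^'n) set \<Rightarrow> (real^'n \<Rightarrow> 'a::euclidean_space) \<Rightarrow> 'k set
    \<Rightarrow> ('k \<Rightarrow> real^'n \<Rightarrow> 'a) \<Rightarrow> bool" where
  "parallel_normal_frame U X J eN \<longleftrightarrow> orthonormal_frame U (sphere_normal_space X) J eN
     \<and> (\<forall>k\<in>J. parallel_normal_field U X (eN k))"

text \<open>Fundamental forms in terms of an orthonormal tangent frame \<open>eT\<close> and a normal frame \<open>eN\<close>
  indexed by \<open>J\<close>: \<open>\<omega>\<^sub>i = \<langle>dX, e\<^sub>i\<rangle>\<close>, \<open>\<omega>\<^sub>i\<^sub>\<alpha> = \<langle>e\<^sub>i, de\<^sub>\<alpha>\<rangle>\<close>, \<open>I = \<Sum> \<omega>\<^sub>i\<^sup>2\<close> and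
  \<open>II = \<Sum> \<omega>\<^sub>i\<^sub>\<alpha> \<omega>\<^sub>i e\<^sub>\<alpha>\<close>, as bilinear forms in the coordinate tangent vectors \<open>u\<close>, \<open>v\<close>.\<close>

definition first_ff :: "(real^'n \<Rightarrow> 'a::euclidean_space) \<Rightarrow> ('n \<Rightarrow> real^'n \<Rightarrow> 'a) \<Rightarrow> real^'n
    \<Rightarrow> real^'n \<Rightarrow> real^'n \<Rightarrow> real" where
  "first_ff X eT x u v = (\<Sum>i\<in>UNIV. (dmap X x u \<bullet> eT i x) * (dmap X x v \<bullet> eT i x))"

definition second_ff :: "(real^'n \<Rightarrow> 'a::euclidean_space) \<Rightarrow> ('n \<Rightarrow> real^'n \<Rightarrow> 'a) \<Rightarrow> 'k set
    \<Rightarrow> ('k \<Rightarrow> real^'n \<Rightarrow> 'a) \<Rightarrow> real^'n \<Rightarrow> real^'n \<Rightarrow> real^'n \<Rightarrow> 'a" where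
  "second_ff X eT J eN x u v =
     (\<Sum>k\<in>J. \<Sum>i\<in>UNIV. ((eT i x \<bullet> dmap (eN k) x u) * (dmap X x v \<bullet> eT i x)) *\<^sub>R eN k x)"

definition line_of_curvature_coordinates :: "(real^'n) set \<Rightarrow> (real^'n \<Rightarrow> 'a::euclidean_space)
    \<Rightarrow> ('n \<Rightarrow> real^'n \<Rightarrow> 'a) \<Rightarrow> 'k set \<Rightarrow> ('k \<Rightarrow> real^'n \<Rightarrow> 'a) \<Rightarrow> bool" where
  "line_of_curvature_coordinates U X eT J eN \<longleftrightarrow> (\<forall>x\<in>U. \<forall>i j. i \<noteq> j \<longrightarrow>
       first_ff X eT x (axis i 1) (axis j 1) = 0
     \<and> second_ff X eT J eN x (axis i 1) (axis j 1) = 0)"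

definition corresponds :: "'m \<Rightarrow> (real^'n) set \<Rightarrow> (real^'n \<Rightarrow> real^'n^'m) \<Rightarrow> (real^'n \<Rightarrow> real^'n^'n)
    \<Rightarrow> (real^'n \<Rightarrow> 'a::euclidean_space) \<Rightarrow> ('n \<Rightarrow> real^'n \<Rightarrow> 'a) \<Rightarrow> ('m \<Rightarrow> real^'n \<Rightarrow> 'a) \<Rightarrow> bool" where
  "corresponds k0 U A1 F X eT eN \<longleftrightarrow> (\<forall>x\<in>U.
       (\<forall>u v. first_ff X eT x u v = (\<Sum>i\<in>UNIV. (A1 x $ k0 $ i)\<^sup>2 * (u $ i * v $ i)))
     \<and> (\<forall>u v. second_ff X eT (- {k0}) eN x u v =
          (\<Sum>i\<in>UNIV. \<Sum>j\<in>- {k0}. (A1 x $ k0 $ i * A1 x $ j $ i * (u $ i * v $ i)) *\<^sub>R eN j x))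
     \<and> (\<forall>i j. i \<noteq> j \<longrightarrow> F x $ i $ j = pd j (\<lambda>y. A1 y $ k0 $ i) x / A1 x $ k0 $ j))"

section \<open>Ribaucour transformations\<close>

definition sphere_exp :: "'a::euclidean_space \<Rightarrow> 'a \<Rightarrow> 'a" where
  "sphere_exp p v = (if v = 0 then p else cos (norm v) *\<^sub>R p + (sin (norm v) / norm v) *\<^sub>R v)"

definition sphere_dist :: "'a::euclidean_space \<Rightarrow> 'a \<Rightarrow> real" where
  "sphere_dist p q = arccos (p \<bullet> q)"

text \<open>The geodesics through \<open>p\<close> and \<open>q\<close> with initial velocities \<open>v\<close> and \<open>w\<close> intersect at a point
  equidistant from \<open>p\<close> and \<open>q\<close>.\<close>

definition geodesics_meet :: "'a::euclidean_space \<Rightarrow> 'a \<Rightarrow> 'a \<Rightarrow> 'a \<Rightarrow> bool" where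
  "geodesics_meet p v q w \<longleftrightarrow> (\<exists>t t'. sphere_exp p (t *\<^sub>R v) = sphere_exp q (t' *\<^sub>R w)
     \<and> sphere_dist p (sphere_exp p (t *\<^sub>R v)) = sphere_dist q (sphere_exp p (t *\<^sub>R v)))"

definition linear_between :: "'a::real_vector set \<Rightarrow> ('a \<Rightarrow> 'b::real_vector) \<Rightarrow> bool" where
  "linear_between N f \<longleftrightarrow> (\<forall>a\<in>N. \<forall>b\<in>N. \<forall>c d. f (c *\<^sub>R a + d *\<^sub>R b) = c *\<^sub>R f a + d *\<^sub>R f b)"

definition diffeomorphism_between :: "(real^'n) set \<Rightarrow> (real^'n) set \<Rightarrow> (real^'n \<Rightarrow> real^'n) \<Rightarrow> bool" where
  "diffeomorphism_between U V \<phi> \<longleftrightarrow> bij_betw \<phi> U V \<and> smooth_on U \<phi> \<and> smooth_on V (inv_into U \<phi>)"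

definition push_field :: "(real^'n) set \<Rightarrow> (real^'n \<Rightarrow> real^'n) \<Rightarrow> (real^'n \<Rightarrow> 'a \<Rightarrow> 'a) \<Rightarrow> (real^'n \<Rightarrow> 'a)
    \<Rightarrow> real^'n \<Rightarrow> 'a" where
  "push_field U \<phi> P \<zeta> y = P (inv_into U \<phi> y) (\<zeta> (inv_into U \<phi> y))"

definition normal_bundle_iso :: "(real^'n) set \<Rightarrow> (real^'n \<Rightarrow> 'a::euclidean_space) \<Rightarrow> (real^'n) set
    \<Rightarrow> (real^'n \<Rightarrow> 'a) \<Rightarrow> (real^'n \<Rightarrow> real^'n) \<Rightarrow> (real^'n \<Rightarrow> 'a \<Rightarrow> 'a) \<Rightarrow> bool" where
  "normal_bundle_iso U X V Y \<phi> P \<longleftrightarrow> diffeomorphism_between U V \<phi>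
     \<and> (\<forall>x\<in>U. linear_between (sphere_normal_space X x) (P x)
              \<and> bij_betw (P x) (sphere_normal_space X x) (sphere_normal_space Y (\<phi> x)))
     \<and> (\<forall>S \<zeta>. open S \<and> S \<subseteq> U \<and> smooth_section S (sphere_normal_space X) \<zeta> \<longrightarrow>
            smooth_section (\<phi> ` S) (sphere_normal_space Y) (push_field U \<phi> P \<zeta>))"

definition sphere_congruence :: "(real^'n) set \<Rightarrow> (real^'n \<Rightarrow> 'a::euclidean_space) \<Rightarrow> (real^'n) set
    \<Rightarrow> (real^'n \<Rightarrow> 'a) \<Rightarrow> (real^'n \<Rightarrow> real^'n) \<Rightarrow> (real^'n \<Rightarrow> 'a \<Rightarrow> 'a) \<Rightarrow> bool" where
  "sphere_congruence U X V Y \<phi> P \<longleftrightarrow> normal_bundle_iso U X V Y \<phi> P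
     \<and> (\<forall>S \<zeta>. open S \<and> S \<subseteq> U \<and> parallel_normal_field S X \<zeta> \<longrightarrow>
            parallel_normal_field (\<phi> ` S) Y (push_field U \<phi> P \<zeta>))
     \<and> (\<forall>x\<in>U. \<forall>\<zeta>\<in>sphere_normal_space X x. \<zeta> \<noteq> 0 \<longrightarrow> geodesics_meet (X x) \<zeta> (Y (\<phi> x)) (P x \<zeta>))"

definition eigenvector :: "real^'n^'n \<Rightarrow> real^'n \<Rightarrow> bool" where
  "eigenvector M u \<longleftrightarrow> u \<noteq> 0 \<and> (\<exists>c. M *v u = c *\<^sub>R u)"

definition principal_direction :: "(real^'n \<Rightarrow> 'a::euclidean_space) \<Rightarrow> real^'n \<Rightarrow> real^'n \<Rightarrow> bool" where
  "principal_direction X x u \<longleftrightarrow> (\<forall>\<zeta>\<in>sphere_normal_space X x. eigenvector (shape_operator X x \<zeta>) u)"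

text \<open>The eigenvectors in conditions (c) and (d) are the principal directions, that is, the common
  eigenvectors of all shape operators \<open>A\<^sub>\<zeta>\<close>. For a special \<open>\<zeta>\<close> the operator \<open>A\<^sub>\<zeta>\<close> may have
  multiple eigenvalues, and then has further eigenvectors,
  which are not preserved in general.\<close>

definition ribaucour_transformation :: "(real^'n) set \<Rightarrow> (real^'n \<Rightarrow> 'a::euclidean_space) \<Rightarrow> (real^'n) set
    \<Rightarrow> (real^'n \<Rightarrow> 'a) \<Rightarrow> (real^'n \<Rightarrow> real^'n) \<Rightarrow> (real^'n \<Rightarrow> 'a \<Rightarrow> 'a) \<Rightarrow> bool" where
  "ribaucour_transformation U X V Y \<phi> P \<longleftrightarrow> sphere_congruence U X V Y \<phi> P
     \<and> (\<forall>x\<in>U. \<forall>u. principal_direction X x u \<longrightarrow>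
            (\<forall>\<zeta>\<in>sphere_normal_space X x. eigenvector (shape_operator Y (\<phi> x) (P x \<zeta>)) (dmap \<phi> x u))
          \<and> geodesics_meet (X x) (dmap X x u) (Y (\<phi> x)) (dmap Y (\<phi> x) (dmap \<phi> x u)))"

end

theory Submission
  imports Defs
begin

text \<open>
  At a real spectral value \<open>l\<close> the columns \<open>e\<^sub>b\<close> of \<open>E\<^sup>I(x, l)\<close> form a real orthonormal frame. For
  \<open>l = 1\<close> its structure equations \<open>\<partial>\<^sub>i e\<^sub>j = a\<^sub>j\<^sub>i e\<^sub>i\<close> (\<open>j\<close> a normal index, \<open>i\<close> a tangential one) show
  that the \<open>e\<^sub>j\<close> are parallel normal fields along \<open>X\<close> and that the coordinates are lines of
  curvature, and the frame at \<open>l = 0\<close> supplies parallel tangential fields.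

  The new frame is \<open>e'\<^sub>b = e\<^sub>b - 2 p\<^sub>b q / (l\<^sup>2 + s\<^sup>2)\<close> with \<open>p = (l u; s z)\<close> and \<open>q = \<Sum> p\<^sub>b e\<^sub>b\<close>, where \<open>u\<close>,
  \<open>z\<close> are obtained by normalizing \<open>E\<^sup>I(x, -is)\<^sup>-\<^sup>1 (W; iZ)\<close>. The linear equation of this vector gives
  \<open>\<partial>\<^sub>i q = (l\<^sup>2 + s\<^sup>2) \<beta>\<^sub>i e\<^sub>i - s \<beta>\<^sub>i z\<^sub>i q\<close>, \<open>\<beta>\<^sub>i = \<langle>a\<^sub>i, u\<rangle>\<close>, from which \<open>e'\<close> satisfies the structure
  equations of \<open>(A\<^sub>1', F')\<close>. Since all \<open>e'\<^sub>b - e\<^sub>b\<close> are multiples of the single vector \<open>q\<close>, corresponding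
  geodesics of \<open>X\<close> and \<open>X'\<close> meet. A common eigenvector of all shape operators of \<open>X\<close> is a multiple
  of a coordinate vector, hence an eigenvector for \<open>X'\<close> too.
\<close>

section \<open>Smooth functions\<close>

text \<open>All geometry is derived from real orthonormal frames at the spectral values 0 and 1, so
  one locale serves both immersions. For real \<open>l\<close> the factor
  \<open>2 / (l\<^sup>2 + s\<^sup>2)\<close> has no pole, and \<open>p\<close> has squared norm
  \<open>l\<^sup>2 + s\<^sup>2\<close>; hence the new frame is the Householder reflection of the old
  one in the hyperplane orthogonal to \<open>q\<close>. The obstacle is that the new pair must solve
  the system for every complex spectral value: this is recovered from the real dressed frames,
  because the curvature is a polynomial in the spectral parameter. Genuinely complex values enter
  only at \<open>- \<i> s\<close>, where conjugating the parameter is the same as changing its sign,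
  so that the two reality conditions combine. At the value 0 the normal and tangential indices
  decouple, which is why a frame there sees just the Levi-Civita connection. The differential of
  \<open>X\<close> scales the i-th coordinate direction by the entry of \<open>A1\<close> in row
  \<open>k0\<close>; the patches \<open>U\<close>, \<open>U'\<close> keep these entries away from 0,
  and the two immersions are compared on \<open>U \<inter> U'\<close>.\<close>

lemma pdI: "(f has_derivative f') (at x) \<Longrightarrow> pd i f x = f' (axis i 1)"
  unfolding pd_def by (metis frechet_derivative_at)

lemma has_derivative_frechet:
  "f differentiable at x \<Longrightarrow> (f has_derivative frechet_derivative f (at x)) (at x)"
  using frechet_derivative_works by blast

lemma frechet_derivative_eq_sum_pd:
  assumes "f differentiable at x"
  shows "frechet_derivative f (at x) u = (\<Sum>i\<in>UNIV. u $ i *\<^sub>R pd i f x)"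
proof -
  have lin: "linear (frechet_derivative f (at x))"
    using assms by (rule linear_frechet_derivative)
  have "u = (\<Sum>i\<in>UNIV. u $ i *\<^sub>R axis i 1)"
    by (simp add: vec_eq_iff axis_def if_distrib cong: if_cong)
  then have "frechet_derivative f (at x) u
      = frechet_derivative f (at x) (\<Sum>i\<in>UNIV. u $ i *\<^sub>R axis i 1)" by simp
  also have "\<dots> = (\<Sum>i\<in>UNIV. u $ i *\<^sub>R pd i f x)"
    unfolding pd_def linear_sum[OF lin] using lin by (simp add: linear_cmul)
  finally show ?thesis .
qed

lemma pd_bounded_linear:
  assumes "bounded_linear T" "f differentiable at x"
  shows "pd i (\<lambda>x. T (f x)) x = T (pd i f x)"
  by (rule trans[OF pdI[OF bounded_linear.has_derivative[OF assms(1) has_derivative_frechet[OF assms(2)]]]])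
     (simp add: pd_def)

lemma pd_bounded_bilinear:
  assumes "bounded_bilinear B" "f differentiable at x" "g differentiable at x"
  shows "pd i (\<lambda>x. B (f x) (g x)) x = B (f x) (pd i g x) + B (pd i f x) (g x)"
  by (rule trans[OF pdI[OF bounded_bilinear.FDERIV[OF assms(1)
        has_derivative_frechet[OF assms(2)] has_derivative_frechet[OF assms(3)]]]])
     (simp add: pd_def)

lemma pd_const [simp]: "pd i (\<lambda>x. c) x = 0"
  by (rule trans[OF pdI[OF has_derivative_const]]) simp

lemma pd_add:
  assumes "f differentiable at x" "g differentiable at x"
  shows "pd i (\<lambda>x. f x + g x) x = pd i f x + pd i g x"
  by (rule trans[OF pdI[OF has_derivative_add[OF assms[THEN has_derivative_frechet]]]])
     (simp add: pd_def)

lemma pd_diff: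
  assumes "f differentiable at x" "g differentiable at x"
  shows "pd i (\<lambda>x. f x - g x) x = pd i f x - pd i g x"
  by (rule trans[OF pdI[OF has_derivative_diff[OF assms[THEN has_derivative_frechet]]]])
     (simp add: pd_def)

lemma pd_sum:
  assumes "\<And>k. k \<in> I \<Longrightarrow> f k differentiable at x"
  shows "pd i (\<lambda>x. \<Sum>k\<in>I. f k x) x = (\<Sum>k\<in>I. pd i (f k) x)"
  by (rule trans[OF pdI[OF has_derivative_sum[OF has_derivative_frechet[OF assms]]]])
     (simp_all add: pd_def)

lemmas pd_mult = pd_bounded_bilinear[OF bounded_bilinear_mult]
lemmas pd_scaleR = pd_bounded_bilinear[OF bounded_bilinear_scaleR]
lemmas pd_inner = pd_bounded_bilinear[OF bounded_bilinear_inner]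
lemmas pd_vec_nth = pd_bounded_linear[OF bounded_linear_vec_nth]

lemma pd_real_compose:
  assumes "f differentiable at x" "(h has_real_derivative d) (at (f x))"
  shows "pd i (\<lambda>x. h (f x)) x = d * pd i f x"
  by (rule trans[OF pdI[OF has_derivative_compose[OF has_derivative_frechet[OF assms(1)]
        assms(2)[unfolded has_field_derivative_def]]]])
     (simp add: pd_def)

lemma differentiable_bounded_linear:
  "bounded_linear T \<Longrightarrow> f differentiable at x \<Longrightarrow> (\<lambda>x. T (f x)) differentiable at x"
  using bounded_linear.has_derivative unfolding differentiable_def by blast

lemma differentiable_bounded_bilinear:
  "bounded_bilinear B \<Longrightarrow> f differentiable at x \<Longrightarrow> g differentiable at x
    \<Longrightarrow> (\<lambda>x. B (f x) (g x)) differentiable at x"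
  using bounded_bilinear.FDERIV unfolding differentiable_def by blast

lemma differentiable_transform_open:
  assumes "open U" "x \<in> U" "\<And>y. y \<in> U \<Longrightarrow> f y = g y" "f differentiable at x"
  shows "g differentiable at x"
  using assms has_derivative_transform_within_open unfolding differentiable_def by blast

text \<open>\<open>frechet_derivative\<close> is a choice among derivatives. Functions that agree
  near \<open>x\<close> have the same derivatives there, so the choices coincide, also where no
  derivative exists.\<close>

lemma pd_cong:
  assumes "open U" "x \<in> U" "\<And>y. y \<in> U \<Longrightarrow> f y = g y"
  shows "pd i f x = pd i g x"
proof -
  have "(f has_derivative D) (at x) \<longleftrightarrow> (g has_derivative D) (at x)" for D
    using assms has_derivative_transform_within_open[of f D x UNIV U g]
      has_derivative_transform_within_open[of g D x UNIV U f] by auto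
  then show ?thesis
    unfolding pd_def frechet_derivative_def by simp
qed

text \<open>In the inductions below a formula for \<open>pd i f\<close> is known on \<open>U\<close>
  only; this lets it replace the derivative.\<close>

lemma Ck_on_cong:
  assumes "open U" "\<And>y. y \<in> U \<Longrightarrow> f y = g y"
  shows "Ck_on k U f \<longleftrightarrow> Ck_on k U g"
  using assms(2)
proof (induction k arbitrary: f g)
  case 0
  then show ?case by (auto cong: continuous_on_cong)
next
  case (Suc k)
  have "f differentiable at x \<longleftrightarrow> g differentiable at x" if "x \<in> U" for x
    using differentiable_transform_open[OF assms(1) that] Suc.prems by metis
  moreover have "Ck_on k U (pd i f) \<longleftrightarrow> Ck_on k U (pd i g)" for i
    by (rule Suc.IH) (rule pd_cong[OF assms(1) _ Suc.prems])
  ultimately show ?case by simp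
qed

lemma smooth_on_cong:
  "open U \<Longrightarrow> (\<And>y. y \<in> U \<Longrightarrow> f y = g y) \<Longrightarrow> smooth_on U f \<longleftrightarrow> smooth_on U g"
  unfolding smooth_on_def using Ck_on_cong by blast

lemma Ck_on_Suc_imp: "Ck_on (Suc k) U f \<Longrightarrow> Ck_on k U f"
proof (induction k arbitrary: f)
  case 0
  then show ?case
    by (auto intro!: differentiable_imp_continuous_on simp: differentiable_on_def
        differentiable_at_withinI)
qed auto

lemma smooth_on_differentiable: "smooth_on U f \<Longrightarrow> x \<in> U \<Longrightarrow> f differentiable at x"
  unfolding smooth_on_def by (metis Ck_on.simps(2))

lemma smooth_on_pd: "smooth_on U f \<Longrightarrow> smooth_on U (pd i f)"
  unfolding smooth_on_def by (metis Ck_on.simps(2))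

lemma smooth_on_continuous: "smooth_on U f \<Longrightarrow> continuous_on U f"
  unfolding smooth_on_def by (metis Ck_on.simps(1))

lemma Ck_on_subset: "Ck_on k U f \<Longrightarrow> V \<subseteq> U \<Longrightarrow> Ck_on k V f"
  by (induction k arbitrary: f) (auto intro: continuous_on_subset)

lemma smooth_on_subset: "smooth_on U f \<Longrightarrow> V \<subseteq> U \<Longrightarrow> smooth_on V f"
  unfolding smooth_on_def using Ck_on_subset by blast

lemma Ck_on_const: "Ck_on k (U :: (real^'n) set) (\<lambda>x. c :: 'b::real_normed_vector)"
proof (induction k arbitrary: c)
  case (Suc k)
  have "pd i (\<lambda>x::real^'n. c) = (\<lambda>x. 0)" for i by (simp add: fun_eq_iff)
  with Suc show ?case by simp
qed simp

lemma Ck_on_ident: "Ck_on k U (\<lambda>x :: real^'n. x)"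
proof (cases k)
  case (Suc k')
  have "pd i (\<lambda>x :: real^'n. x) = (\<lambda>x. axis i 1)" for i
    by (simp add: pd_def fun_eq_iff)
  then show ?thesis using Suc by (simp add: Ck_on_const)
qed simp

lemma Ck_on_add:
  assumes "open U" "Ck_on k U f" "Ck_on k U g"
  shows "Ck_on k U (\<lambda>x. f x + g x)"
  using assms(2,3)
proof (induction k arbitrary: f g)
  case (Suc k)
  have "Ck_on k U (pd i (\<lambda>x. f x + g x))" for i
  proof -
    have "Ck_on k U (\<lambda>x. pd i f x + pd i g x)" using Suc by auto
    then show ?thesis
      using Suc.prems by (subst Ck_on_cong[OF assms(1), where g = "\<lambda>x. pd i f x + pd i g x"])
        (auto intro: pd_add)
  qed
  then show ?case using Suc.prems by (auto intro: differentiable_add)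
qed (auto intro: continuous_on_add)

lemma Ck_on_bounded_linear:
  assumes "open U" "bounded_linear T" "Ck_on k U f"
  shows "Ck_on k U (\<lambda>x. T (f x))"
  using assms(3)
proof (induction k arbitrary: f)
  case (Suc k)
  have "Ck_on k U (pd i (\<lambda>x. T (f x)))" for i
  proof -
    have "Ck_on k U (\<lambda>x. T (pd i f x))" using Suc by auto
    then show ?thesis
      using Suc.prems by (subst Ck_on_cong[OF assms(1), where g = "\<lambda>x. T (pd i f x)"])
        (auto intro: pd_bounded_linear[OF assms(2)])
  qed
  then show ?case using Suc.prems
    by (auto intro!: differentiable_bounded_linear[OF assms(2)])
qed (use bounded_linear.continuous_on[OF assms(2)] in auto)

text \<open>The product rule returns \<open>f\<close> and \<open>g\<close> undifferentiated next to
  their derivatives, so the induction step also uses them at the lower order, by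
  \<open>Ck_on_Suc_imp\<close>.\<close>

lemma Ck_on_bounded_bilinear:
  assumes "open U" "bounded_bilinear B" "Ck_on k U f" "Ck_on k U g"
  shows "Ck_on k U (\<lambda>x. B (f x) (g x))"
  using assms(3,4)
proof (induction k arbitrary: f g)
  case (Suc k)
  have "Ck_on k U (pd i (\<lambda>x. B (f x) (g x)))" for i
  proof -
    have "Ck_on k U (\<lambda>x. B (f x) (pd i g x) + B (pd i f x) (g x))"
      using Suc.prems Suc.prems[THEN Ck_on_Suc_imp]
      by (intro Ck_on_add assms(1) Suc.IH) simp_all
    then show ?thesis
      using Suc.prems by (subst Ck_on_cong[OF assms(1)])
        (auto intro!: pd_bounded_bilinear[OF assms(2)])
  qed
  then show ?case using Suc.prems
    by (auto intro!: differentiable_bounded_bilinear[OF assms(2)])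
qed (use bounded_bilinear.continuous_on[OF assms(2)] in auto)

text \<open>The derivative of \<open>1 / f\<close> is a polynomial in \<open>1 / f\<close> and the
  derivative of \<open>f\<close>, so the induction hypothesis covers it. The same scheme, combined
  with this lemma, handles the square root.\<close>

lemma Ck_on_inverse:
  fixes f :: "real^'n \<Rightarrow> real"
  assumes "open U" "Ck_on k U f" "\<And>x. x \<in> U \<Longrightarrow> f x \<noteq> 0"
  shows "Ck_on k U (\<lambda>x. inverse (f x))"
  using assms(2)
proof (induction k)
  case (Suc k)
  have d: "pd i (\<lambda>x. inverse (f x)) x = - (inverse (f x) * inverse (f x)) * pd i f x"
    if "x \<in> U" for x i
    using Suc.prems that assms(3)
    by (intro pd_real_compose) (auto intro!: derivative_eq_intros simp: power2_eq_square)
  have "Ck_on k U (\<lambda>x. (-1) *\<^sub>R (inverse (f x) * inverse (f x)) * pd i f x)" for i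
    using Suc Ck_on_Suc_imp[of k U f]
    by (intro Ck_on_bounded_bilinear[OF assms(1) bounded_bilinear_mult]
        Ck_on_bounded_linear[OF assms(1) bounded_linear_scaleR_right]) auto
  then have "Ck_on k U (pd i (\<lambda>x. inverse (f x)))" for i
    using d by (subst Ck_on_cong[OF assms(1)]) auto
  then show ?case using Suc.prems assms(3)
    by (auto intro!: differentiable_inverse)
qed (use assms(3) in \<open>auto intro: continuous_on_inverse\<close>)

lemma Ck_on_sqrt:
  fixes f :: "real^'n \<Rightarrow> real"
  assumes "open U" "Ck_on k U f" "\<And>x. x \<in> U \<Longrightarrow> f x > 0"
  shows "Ck_on k U (\<lambda>x. sqrt (f x))"
  using assms(2)
proof (induction k)
  case (Suc k)
  have d: "pd i (\<lambda>x. sqrt (f x)) x = (inverse (sqrt (f x)) / 2) * pd i f x" if "x \<in> U" for x i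
    using Suc.prems that assms(3)
    by (intro pd_real_compose DERIV_real_sqrt) auto
  have nz: "sqrt (f x) \<noteq> 0" if "x \<in> U" for x using assms(3)[OF that] by simp
  have "Ck_on k U (\<lambda>x. (1/2) *\<^sub>R (inverse (sqrt (f x))) * pd i f x)" for i
    using Suc Ck_on_Suc_imp[of k U f] nz
    by (intro Ck_on_bounded_bilinear[OF assms(1) bounded_bilinear_mult] Ck_on_inverse[OF assms(1)]
        Ck_on_bounded_linear[OF assms(1) bounded_linear_scaleR_right]) auto
  then have "Ck_on k U (pd i (\<lambda>x. sqrt (f x)))" for i
    by (subst Ck_on_cong[OF assms(1) d]) simp_all
  moreover have "(\<lambda>x. sqrt (f x)) differentiable at x" if "x \<in> U" for x
  proof -
    have "(f has_derivative frechet_derivative f (at x)) (at x)"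
      using Suc.prems that by (auto intro: has_derivative_frechet)
    from has_derivative_real_sqrt[OF _ this] assms(3)[OF that] show ?thesis
      by (auto simp: differentiable_def)
  qed
  ultimately show ?case by auto
qed (auto intro: continuous_on_real_sqrt)

section \<open>Closure properties of smooth functions on an open set\<close>

context
  fixes U :: "(real^'n) set"
  assumes U: "open U"
begin

lemma smooth_on_const [simp]: "smooth_on U (\<lambda>x. c)"
  by (simp add: smooth_on_def Ck_on_const)

lemma smooth_on_ident [simp]: "smooth_on U (\<lambda>x. x)"
  by (simp add: smooth_on_def Ck_on_ident)

lemma smooth_on_bounded_linear: "bounded_linear T \<Longrightarrow> smooth_on U f \<Longrightarrow> smooth_on U (\<lambda>x. T (f x))"
  using U by (simp add: smooth_on_def Ck_on_bounded_linear)

lemma smooth_on_bounded_bilinear: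
  "bounded_bilinear B \<Longrightarrow> smooth_on U f \<Longrightarrow> smooth_on U g \<Longrightarrow> smooth_on U (\<lambda>x. B (f x) (g x))"
  using U by (simp add: smooth_on_def Ck_on_bounded_bilinear)

lemma smooth_on_add: "smooth_on U f \<Longrightarrow> smooth_on U g \<Longrightarrow> smooth_on U (\<lambda>x. f x + g x)"
  using U by (simp add: smooth_on_def Ck_on_add)

lemma smooth_on_minus: "smooth_on U f \<Longrightarrow> smooth_on U (\<lambda>x. - f x)"
  by (rule smooth_on_bounded_linear[OF bounded_linear_minus[OF bounded_linear_ident]])

lemma smooth_on_diff: "smooth_on U f \<Longrightarrow> smooth_on U g \<Longrightarrow> smooth_on U (\<lambda>x. f x - g x)"
  using smooth_on_add[of f "\<lambda>x. - g x"] smooth_on_minus[of g] by simp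

lemma smooth_on_sum:
  "(\<And>k. k \<in> I \<Longrightarrow> smooth_on U (f k)) \<Longrightarrow> smooth_on U (\<lambda>x. \<Sum>k\<in>I. f k x)"
  by (induction I rule: infinite_finite_induct) (auto intro: smooth_on_add)

lemmas smooth_on_scaleR = smooth_on_bounded_bilinear[OF bounded_bilinear_scaleR]
lemmas smooth_on_mult = smooth_on_bounded_bilinear[OF bounded_bilinear_mult]
lemmas smooth_on_inner = smooth_on_bounded_bilinear[OF bounded_bilinear_inner]
lemmas smooth_on_vec_nth = smooth_on_bounded_linear[OF bounded_linear_vec_nth]

lemma smooth_on_divide:
  fixes f g :: "real^'n \<Rightarrow> real"
  assumes "smooth_on U f" "smooth_on U g" "\<And>x. x \<in> U \<Longrightarrow> g x \<noteq> 0"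
  shows "smooth_on U (\<lambda>x. f x / g x)"
proof -
  have "smooth_on U (\<lambda>x. inverse (g x))"
    using assms U by (simp add: smooth_on_def Ck_on_inverse)
  then show ?thesis
    unfolding divide_inverse by (intro smooth_on_mult assms)
qed

lemma smooth_on_sqrt:
  fixes f :: "real^'n \<Rightarrow> real"
  shows "smooth_on U f \<Longrightarrow> (\<And>x. x \<in> U \<Longrightarrow> f x > 0) \<Longrightarrow> smooth_on U (\<lambda>x. sqrt (f x))"
  using U by (simp add: smooth_on_def Ck_on_sqrt)

lemma smooth_on_vec:
  assumes "\<And>b. smooth_on U (\<lambda>x. f x $ b)"
  shows "smooth_on U (f :: _ \<Rightarrow> 'a::real_normed_vector ^ 'k)"
proof -
  have bl: "bounded_linear (\<lambda>v :: 'a. axis b v :: 'a^'k)" for b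
    by (rule bounded_linear_intro[where K = 1]) (auto simp: vec_eq_iff axis_def norm_vec_def L2_set_def if_distrib[of norm] if_distribR
        if_distrib[of "\<lambda>x. x ^ 2"] cong: if_cong)
  have "f = (\<lambda>x. \<Sum>b\<in>UNIV. axis b (f x $ b))"
    by (simp add: fun_eq_iff vec_eq_iff axis_def)
  then show ?thesis
    using smooth_on_sum[of UNIV "\<lambda>b x. axis b (f x $ b)"] smooth_on_bounded_linear[OF bl assms]
    by simp
qed

lemmas smooth_intros = smooth_on_const smooth_on_add smooth_on_minus smooth_on_diff smooth_on_sum
  smooth_on_scaleR smooth_on_mult smooth_on_inner smooth_on_vec_nth

end

text \<open>The mean value theorem is applied twice: in direction \<open>i\<close> to the increment
  of \<open>f\<close> over \<open>h\<close> in direction \<open>j\<close>, then in direction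
  \<open>j\<close> to \<open>pd i f\<close>.\<close>

lemma second_difference_mvt:
  fixes f :: "real^'n \<Rightarrow> real"
  assumes "\<And>s t. 0 \<le> s \<Longrightarrow> s \<le> h \<Longrightarrow> 0 \<le> t \<Longrightarrow> t \<le> h \<Longrightarrow> f differentiable at (x + s *\<^sub>R axis i 1 + t *\<^sub>R axis j 1)"
    and "\<And>s t. 0 \<le> s \<Longrightarrow> s \<le> h \<Longrightarrow> 0 \<le> t \<Longrightarrow> t \<le> h \<Longrightarrow> pd i f differentiable at (x + s *\<^sub>R axis i 1 + t *\<^sub>R axis j 1)"
    and "0 < h"
  obtains s t where "0 < s" "s < h" "0 < t" "t < h"
    "f (x + h *\<^sub>R axis i 1 + h *\<^sub>R axis j 1) - f (x + h *\<^sub>R axis i 1) - f (x + h *\<^sub>R axis j 1) + f x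
      = h * h * pd j (pd i f) (x + s *\<^sub>R axis i 1 + t *\<^sub>R axis j 1)"
proof -
  define p where "p s t = x + s *\<^sub>R axis i 1 + t *\<^sub>R axis j 1" for s t
  have d1: "((\<lambda>s. f (p s t)) has_real_derivative pd i f (p s t)) (at s)"
    if "0 \<le> s" "s \<le> h" "0 \<le> t" "t \<le> h" for s t
  proof -
    have "((\<lambda>s. p s t) has_derivative (\<lambda>r. r *\<^sub>R axis i 1)) (at s)"
      unfolding p_def by (auto intro!: derivative_eq_intros)
    from has_derivative_compose[OF this has_derivative_frechet[of f "p s t"]] assms(1)[OF that]
      linear_cmul[OF linear_frechet_derivative[of f "at (p s t)"]]
    show ?thesis
      by (simp add: has_field_derivative_def p_def pd_def mult.commute mult_commute_abs)
  qed
  have d2: "((\<lambda>t. pd i f (p s t)) has_real_derivative pd j (pd i f) (p s t)) (at t)"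
    if "0 \<le> s" "s \<le> h" "0 \<le> t" "t \<le> h" for s t
  proof -
    have "((\<lambda>t. p s t) has_derivative (\<lambda>r. r *\<^sub>R axis j 1)) (at t)"
      unfolding p_def by (auto intro!: derivative_eq_intros)
    from has_derivative_compose[OF this has_derivative_frechet[of "pd i f" "p s t"]] assms(2)[OF that]
      linear_cmul[OF linear_frechet_derivative[of "pd i f" "at (p s t)"]]
    show ?thesis
      by (simp add: has_field_derivative_def p_def pd_def[of j] mult.commute mult_commute_abs)
  qed
  have "\<exists>s. 0 < s \<and> s < h \<and> (f (p h h) - f (p h 0)) - (f (p 0 h) - f (p 0 0))
      = (h - 0) * (pd i f (p s h) - pd i f (p s 0))"
    by (rule MVT2[OF assms(3)]) (use d1 assms(3) in \<open>auto intro!: DERIV_diff\<close>)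
  then obtain s where s: "0 < s" "s < h" "(f (p h h) - f (p h 0)) - (f (p 0 h) - f (p 0 0))
      = h * (pd i f (p s h) - pd i f (p s 0))" by auto
  have "\<exists>t. 0 < t \<and> t < h \<and> pd i f (p s h) - pd i f (p s 0) = (h - 0) * pd j (pd i f) (p s t)"
    by (rule MVT2[OF assms(3)]) (use d2 s assms(3) in auto)
  then obtain t where t: "0 < t" "t < h" "pd i f (p s h) - pd i f (p s 0) = h * pd j (pd i f) (p s t)"
    by auto
  show ?thesis
    by (rule that[OF s(1,2) t(1,2)]) (use s(3) t(3) in \<open>simp add: p_def algebra_simps\<close>)
qed

text \<open>The second difference of \<open>second_difference_mvt\<close> is symmetric in \<open>i\<close> and \<open>j\<close>.\<close>

lemma pd_commute_real:
  fixes f :: "real^'n \<Rightarrow> real"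
  assumes "open U" "smooth_on U f" "x \<in> U"
  shows "pd i (pd j f) x = pd j (pd i f) x"
proof (rule ccontr)
  assume ne: "pd i (pd j f) x \<noteq> pd j (pd i f) x"
  define e where "e = \<bar>pd i (pd j f) x - pd j (pd i f) x\<bar> / 2"
  have e: "e > 0" using ne by (simp add: e_def)
  have cont: "continuous_on U (pd a (pd b f))" for a b
    using assms(2) by (intro smooth_on_continuous smooth_on_pd)
  have "\<exists>d>0. \<forall>y. dist y x < d \<longrightarrow> dist (pd a (pd b f) y) (pd a (pd b f) x) < e" for a b
  proof -
    have "isCont (pd a (pd b f)) x"
      using continuous_on_eq_continuous_at[OF assms(1)] cont assms(3) by blast
    then show ?thesis using e unfolding continuous_at_eps_delta by blast
  qed
  then obtain d1 d2 where d: "d1 > 0" "d2 > 0"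
      "\<And>y. dist y x < d1 \<Longrightarrow> dist (pd i (pd j f) y) (pd i (pd j f) x) < e"
      "\<And>y. dist y x < d2 \<Longrightarrow> dist (pd j (pd i f) y) (pd j (pd i f) x) < e"
    by blast
  obtain d3 where d3: "d3 > 0" "ball x d3 \<subseteq> U" using assms(1,3) openE by blast
  \<comment> \<open>All points used below lie within \<open>2 * h\<close> of \<open>x\<close>; the
    division by 3 puts \<open>2 * h\<close> below all three radii.\<close>
  define h where "h = min (min d1 d2) d3 / 3"
  have h: "0 < h" "2 * h < d1" "2 * h < d2" "2 * h < d3"
    unfolding h_def using d d3 by auto
  have near: "dist (x + s *\<^sub>R axis a 1 + t *\<^sub>R axis b 1) x \<le> 2 * h"
    if "0 \<le> s" "s \<le> h" "0 \<le> t" "t \<le> h" for s t :: real and a b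
  proof -
    have "norm (s *\<^sub>R axis a 1 + t *\<^sub>R axis b (1::real)) \<le> s + t"
      using norm_triangle_ineq[of "s *\<^sub>R axis a 1" "t *\<^sub>R axis b (1::real)"] that
      by simp
    then show ?thesis using that by (simp add: dist_norm add.assoc)
  qed
  have inU: "x + s *\<^sub>R axis a 1 + t *\<^sub>R axis b 1 \<in> U"
    if "0 \<le> s" "s \<le> h" "0 \<le> t" "t \<le> h" for s t :: real and a b
    using near[OF that, of a b] h(4) d3(2) by (auto simp: dist_commute subset_iff)
  obtain s t where st: "0 < s" "s < h" "0 < t" "t < h"
    "f (x + h *\<^sub>R axis i 1 + h *\<^sub>R axis j 1) - f (x + h *\<^sub>R axis i 1) - f (x + h *\<^sub>R axis j 1) + f x
      = h * h * pd j (pd i f) (x + s *\<^sub>R axis i 1 + t *\<^sub>R axis j 1)"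
    by (rule second_difference_mvt[of h f x i j])
      (use inU h(1) assms(2) in \<open>auto intro: smooth_on_differentiable smooth_on_pd\<close>)
  obtain s' t' where st': "0 < s'" "s' < h" "0 < t'" "t' < h"
    "f (x + h *\<^sub>R axis j 1 + h *\<^sub>R axis i 1) - f (x + h *\<^sub>R axis j 1) - f (x + h *\<^sub>R axis i 1) + f x
      = h * h * pd i (pd j f) (x + s' *\<^sub>R axis j 1 + t' *\<^sub>R axis i 1)"
    by (rule second_difference_mvt[of h f x j i])
      (use inU h(1) assms(2) in \<open>auto intro: smooth_on_differentiable smooth_on_pd\<close>)
  have "h * h * pd j (pd i f) (x + s *\<^sub>R axis i 1 + t *\<^sub>R axis j 1)
      = h * h * pd i (pd j f) (x + s' *\<^sub>R axis j 1 + t' *\<^sub>R axis i 1)"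
    using st(5) st'(5) by (simp add: algebra_simps)
  then have eq: "pd j (pd i f) (x + s *\<^sub>R axis i 1 + t *\<^sub>R axis j 1)
      = pd i (pd j f) (x + s' *\<^sub>R axis j 1 + t' *\<^sub>R axis i 1)" using h(1) by simp
  have "dist (pd j (pd i f) (x + s *\<^sub>R axis i 1 + t *\<^sub>R axis j 1)) (pd j (pd i f) x) < e"
    using near[of s t i j] st h by (intro d(4)) auto
  moreover have "dist (pd i (pd j f) (x + s' *\<^sub>R axis j 1 + t' *\<^sub>R axis i 1)) (pd i (pd j f) x) < e"
    using near[of s' t' j i] st' h by (intro d(3)) auto
  ultimately show False unfolding eq e_def dist_real_def
    by (smt (verit) field_sum_of_halves)
qed

lemma pd_commute:
  fixes f :: "real^'n \<Rightarrow> 'a::euclidean_space"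
  assumes "open U" "smooth_on U f" "x \<in> U"
  shows "pd i (pd j f) x = pd j (pd i f) x"
proof (rule euclidean_eqI)
  fix b :: 'a assume "b \<in> Basis"
  have c: "pd k (pd l f) x \<bullet> b = pd k (pd l (\<lambda>y. f y \<bullet> b)) x" for k l
  proof -
    have "pd k (pd l f) x \<bullet> b = pd k (\<lambda>y. pd l f y \<bullet> b) x"
      using assms by (intro pd_bounded_linear[symmetric] bounded_linear_inner_left)
        (auto intro: smooth_on_differentiable smooth_on_pd)
    also have "\<dots> = pd k (pd l (\<lambda>y. f y \<bullet> b)) x"
      using assms by (intro pd_cong[OF assms(1,3)] pd_bounded_linear[symmetric] bounded_linear_inner_left)
        (auto intro: smooth_on_differentiable)
    finally show ?thesis .
  qed
  show "pd i (pd j f) x \<bullet> b = pd j (pd i f) x \<bullet> b"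
    unfolding c by (intro pd_commute_real[OF assms(1) _ assms(3)]
        smooth_on_bounded_linear[OF assms(1) bounded_linear_inner_left assms(2)])
qed

section \<open>Projections and flat bundles\<close>

text \<open>\<open>orth_proj\<close> is a definite description, so uniqueness is needed: the
  difference of two candidates lies in \<open>V\<close> and is orthogonal to itself.\<close>

lemma orth_projI:
  assumes "subspace V" "p \<in> V" "\<And>w. w \<in> V \<Longrightarrow> (v - p) \<bullet> w = 0"
  shows "orth_proj V v = p"
  unfolding orth_proj_def
proof (rule the_equality)
  fix p' assume p': "p' \<in> V \<and> (\<forall>w\<in>V. (v - p') \<bullet> w = 0)"
  then have "p' - p \<in> V" using assms subspace_diff by blast
  then have "(p' - p) \<bullet> (p' - p) = (v - p) \<bullet> (p' - p) - (v - p') \<bullet> (p' - p)"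
    by (simp add: inner_diff_left)
  also have "\<dots> = 0" using p' \<open>p' - p \<in> V\<close> assms(3) by simp
  finally show "p' = p" by simp
qed (use assms in auto)

text \<open>The terms of the Leibniz rule that differentiate \<open>g k\<close> are orthogonal to
  the fibre, so the induced connection differentiates only the coefficients. Applied twice, this
  reduces curvature to the commutator of partial derivatives.\<close>

lemma orth_proj_pd_parallel_combination:
  fixes g :: "'k \<Rightarrow> real^'n \<Rightarrow> 'a::euclidean_space"
  assumes "subspace (V x)" and "\<And>k. k \<in> J \<Longrightarrow> g k x \<in> V x"
    and "\<And>k w. k \<in> J \<Longrightarrow> w \<in> V x \<Longrightarrow> pd i (g k) x \<bullet> w = 0"
    and "\<And>k. k \<in> J \<Longrightarrow> g k differentiable at x" "\<And>k. k \<in> J \<Longrightarrow> \<phi> k differentiable at x"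
  shows "orth_proj (V x) (pd i (\<lambda>y. \<Sum>k\<in>J. \<phi> k y *\<^sub>R g k y) x) = (\<Sum>k\<in>J. pd i (\<phi> k) x *\<^sub>R g k x)"
proof (rule orth_projI[OF assms(1)])
  show "(\<Sum>k\<in>J. pd i (\<phi> k) x *\<^sub>R g k x) \<in> V x"
    using assms(1,2) by (intro subspace_sum subspace_scale) auto
  fix w assume w: "w \<in> V x"
  have "pd i (\<lambda>y. \<Sum>k\<in>J. \<phi> k y *\<^sub>R g k y) x = (\<Sum>k\<in>J. pd i (\<lambda>y. \<phi> k y *\<^sub>R g k y) x)"
    using assms(4,5) by (intro pd_sum differentiable_bounded_bilinear[OF bounded_bilinear_scaleR])
  also have "\<dots> = (\<Sum>k\<in>J. \<phi> k x *\<^sub>R pd i (g k) x + pd i (\<phi> k) x *\<^sub>R g k x)"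
    using assms(4,5) by (intro sum.cong refl pd_scaleR)
  finally have "pd i (\<lambda>y. \<Sum>k\<in>J. \<phi> k y *\<^sub>R g k y) x - (\<Sum>k\<in>J. pd i (\<phi> k) x *\<^sub>R g k x)
      = (\<Sum>k\<in>J. \<phi> k x *\<^sub>R pd i (g k) x)" by (simp add: sum.distrib)
  then show "(pd i (\<lambda>y. \<Sum>k\<in>J. \<phi> k y *\<^sub>R g k y) x - (\<Sum>k\<in>J. pd i (\<phi> k) x *\<^sub>R g k x)) \<bullet> w = 0"
    using assms(3) w by (simp add: inner_sum_left)
qed

text \<open>\<open>g\<close> is a Parseval frame of each fibre: its members need not be linearly independent.\<close>

lemma flat_bundle_if_parallel_frame:
  fixes g :: "'k \<Rightarrow> real^'n \<Rightarrow> 'a::euclidean_space"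
  assumes U: "open U" and V: "\<And>x. x \<in> U \<Longrightarrow> subspace (V x)"
    and g: "\<And>k. k \<in> J \<Longrightarrow> smooth_section U V (g k)"
    and par: "\<And>k i x w. k \<in> J \<Longrightarrow> x \<in> U \<Longrightarrow> w \<in> V x \<Longrightarrow> pd i (g k) x \<bullet> w = 0"
    and rep: "\<And>x v. x \<in> U \<Longrightarrow> v \<in> V x \<Longrightarrow> v = (\<Sum>k\<in>J. (v \<bullet> g k x) *\<^sub>R g k x)"
  shows "flat_bundle U V"
  unfolding flat_bundle_def
proof (intro allI impI ballI)
  fix \<zeta> x i j assume z: "smooth_section U V \<zeta>" and x: "x \<in> U"
  define h where "h k = (\<lambda>y. \<zeta> y \<bullet> g k y)" for k
  have gs: "smooth_on U (g k)" if "k \<in> J" for k using g[OF that] by (simp add: smooth_section_def)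
  have hs: "smooth_on U (h k)" if "k \<in> J" for k
    unfolding h_def using z gs[OF that] by (intro smooth_on_inner U) (auto simp: smooth_section_def)
  have hd: "h k differentiable at y" "pd a (h k) differentiable at y" if "k \<in> J" "y \<in> U" for k y a
    using hs[OF that(1)] that(2) by (auto intro: smooth_on_differentiable smooth_on_pd)
  have gd: "g k differentiable at y" "g k y \<in> V y" if "k \<in> J" "y \<in> U" for k y
    using gs g that by (auto intro: smooth_on_differentiable simp: smooth_section_def)
  have first: "cov_deriv V a \<zeta> y = (\<Sum>k\<in>J. pd a (h k) y *\<^sub>R g k y)" if y: "y \<in> U" for a y
  proof -
    have "pd a \<zeta> y = pd a (\<lambda>y. \<Sum>k\<in>J. h k y *\<^sub>R g k y) y"
      unfolding h_def using z by (intro pd_cong[OF U y] rep) (auto simp: smooth_section_def)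
    then show ?thesis
      unfolding cov_deriv_def using y by (simp add: orth_proj_pd_parallel_combination V par gd hd)
  qed
  have second: "cov_deriv V a (cov_deriv V b \<zeta>) x = (\<Sum>k\<in>J. pd a (pd b (h k)) x *\<^sub>R g k x)" for a b
  proof -
    have "pd a (cov_deriv V b \<zeta>) x = pd a (\<lambda>y. \<Sum>k\<in>J. pd b (h k) y *\<^sub>R g k y) x"
      by (intro pd_cong[OF U x] first)
    then show ?thesis
      unfolding cov_deriv_def[of V a "cov_deriv V b \<zeta>"] using x
      by (simp only:) (rule orth_proj_pd_parallel_combination, auto intro: V par gd hd)
  qed
  show "cov_deriv V i (cov_deriv V j \<zeta>) x = cov_deriv V j (cov_deriv V i \<zeta>) x"
    unfolding second by (intro sum.cong refl arg_cong2[where f = scaleR] pd_commute_real[OF U hs x])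
qed

section \<open>Diagonal and orthogonal matrices\<close>

lemma scaleR_delta: "(if b then c else 0) *\<^sub>R v = (if b then c *\<^sub>R v else (0::'a::real_vector))"
  by simp

definition diagm :: "('n \<Rightarrow> 'a::zero) \<Rightarrow> 'a^'n^'n" where
  "diagm d = (\<chi> i j. if i = j then d i else 0)"

lemma diagm_mult: "diagm c ** diagm d = (diagm (\<lambda>i. c i * d i) :: real^'n^'n)"
  by (simp add: diagm_def matrix_matrix_mult_def vec_eq_iff mult_delta_left mult_delta_right scaleR_delta)

lemma matrix_inv_eqI:
  fixes A :: "'a::semiring_1^'n^'n"
  assumes "A ** B = mat 1" "B ** A = mat 1"
  shows "matrix_inv A = B"
proof -
  have "A ** matrix_inv A = mat 1 \<and> matrix_inv A ** A = mat 1"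
    unfolding matrix_inv_def by (rule someI[of _ B]) (use assms in auto)
  then have "matrix_inv A = (B ** A) ** matrix_inv A" using assms by simp
  also have "\<dots> = B" using \<open>_ \<and> _\<close> by (metis matrix_mul_assoc matrix_mul_rid)
  finally show ?thesis .
qed

lemma matrix_inv_diagm:
  assumes "\<And>i. d i \<noteq> 0"
  shows "matrix_inv (diagm d) = (diagm (\<lambda>i. inverse (d i)) :: real^'n^'n)"
proof -
  have "diagm (\<lambda>i. 1) = (mat 1 :: real^'n^'n)" by (simp add: diagm_def mat_def)
  then show ?thesis using assms by (intro matrix_inv_eqI) (simp_all add: diagm_mult)
qed

lemma diagm_mult_vec: "diagm d *v u = (\<chi> i. d i * (u::real^'n) $ i)"
  by (simp add: diagm_def matrix_vector_mult_def vec_eq_iff mult_delta_left mult_delta_right scaleR_delta)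

lemma eigenvector_diagm_axis: "t \<noteq> 0 \<Longrightarrow> eigenvector (diagm d) (t *\<^sub>R axis i 1)"
  unfolding eigenvector_def
  by (auto simp: diagm_mult_vec vec_eq_iff axis_def intro!: exI[of _ "d i"])

lemma sum_columns_orthogonal:
  fixes M :: "'a::comm_semiring_1^'n^'m"
  assumes "transpose M ** M = mat 1"
  shows "(\<Sum>a\<in>UNIV. M $ a $ b * M $ a $ c) = (if b = c then 1 else 0)"
  using arg_cong[OF assms, of "\<lambda>M. M $ b $ c"]
  by (simp add: matrix_matrix_mult_def transpose_def mat_def)

section \<open>Meeting geodesics of the sphere\<close>

lemma sphere_exp_unit:
  assumes "norm e = 1"
  shows "sphere_exp p (\<theta> *\<^sub>R e) = cos \<theta> *\<^sub>R p + sin \<theta> *\<^sub>R e"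
proof (cases "\<theta> = 0")
  case False
  then have "e \<noteq> 0" using assms by auto
  with False assms show ?thesis
    by (cases "\<theta> > 0") (auto simp: sphere_exp_def)
qed (simp add: sphere_exp_def)

text \<open>The great circles \<open>cos \<theta> p + sin \<theta> e\<close> and \<open>cos \<theta> p' + sin \<theta> e'\<close> agree at every \<open>\<theta>\<close>
  with \<open>a cos \<theta> + b sin \<theta> = 0\<close>.\<close>

lemma geodesics_meet_if_parallel_differences:
  fixes p :: "'a::euclidean_space"
  assumes n: "norm p = 1" "norm p' = 1" "norm e = 1" "norm e' = 1"
    and o: "p \<bullet> e = 0" "p' \<bullet> e' = 0"
    and d: "p' = p - a *\<^sub>R q" "e' = e - b *\<^sub>R q"
    and r: "r \<noteq> 0" "r' \<noteq> 0"
  shows "geodesics_meet p (r *\<^sub>R e) p' (r' *\<^sub>R e')"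
proof -
  obtain \<theta> where th: "a * cos \<theta> + b * sin \<theta> = 0"
  proof (cases "a = 0 \<and> b = 0")
    case True
    then show ?thesis using that by simp
  next
    case False
    \<comment> \<open>The pair of cosine and sine is to be the unit vector
      \<open>(b, - a) / \<rho>\<close>, which is orthogonal to \<open>(a, b)\<close>.\<close>
    define \<rho> where "\<rho> = sqrt (a\<^sup>2 + b\<^sup>2)"
    have "\<rho>\<^sup>2 = a\<^sup>2 + b\<^sup>2" "\<rho> \<noteq> 0" using False by (auto simp: \<rho>_def)
    then have "(b / \<rho>)\<^sup>2 + (- a / \<rho>)\<^sup>2 = 1"
      using False by (simp add: power_divide add_divide_distrib[symmetric] add.commute sum_power2_eq_zero_iff)
    then obtain \<theta> where "b / \<rho> = cos \<theta>" "- a / \<rho> = sin \<theta>" by (rule sincos_total_2pi)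
    then show ?thesis
      by (intro that[of \<theta>]) (metis (no_types) add.commute add.right_inverse add_divide_distrib
          div_0 minus_mult_left mult.commute times_divide_eq_right)
  qed
  have m: "cos \<theta> *\<^sub>R p + sin \<theta> *\<^sub>R e = cos \<theta> *\<^sub>R p' + sin \<theta> *\<^sub>R e'"
  proof -
    have "cos \<theta> *\<^sub>R p' + sin \<theta> *\<^sub>R e' = cos \<theta> *\<^sub>R p + sin \<theta> *\<^sub>R e - (a * cos \<theta> + b * sin \<theta>) *\<^sub>R q"
      unfolding d by (simp add: algebra_simps)
    then show ?thesis using th by simp
  qed
  \<comment> \<open>Both distances are \<open>arccos (cos \<theta>)\<close>, whatever the size of
    \<theta>. The parameters \<open>\<theta> / r\<close> and \<open>\<theta> / r'\<close> below
    absorb the lengths and signs of the initial velocities.\<close>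
  have "p \<bullet> (cos \<theta> *\<^sub>R p + sin \<theta> *\<^sub>R e) = cos \<theta>" "p' \<bullet> (cos \<theta> *\<^sub>R p' + sin \<theta> *\<^sub>R e') = cos \<theta>"
    using n o by (simp_all add: inner_add_right dot_square_norm)
  then show ?thesis
    unfolding geodesics_meet_def
    by (intro exI[of _ "\<theta> / r"] exI[of _ "\<theta> / r'"])
       (simp add: r sphere_exp_unit n m sphere_dist_def)
qed

section \<open>Moving frames of the real Lax connection\<close>

text \<open>\<open>e\<close> lists the columns of a real orthogonal frame with Lax connection \<open>\<theta>\<^sup>I\<^sub>l\<close>, \<open>l\<close> real.\<close>

definition moving_frame :: "(real^'n \<Rightarrow> real^'n^'m) \<Rightarrow> (real^'n \<Rightarrow> real^'n^'n) \<Rightarrow> real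
    \<Rightarrow> ('m + 'n \<Rightarrow> real^'n \<Rightarrow> real^('m::finite + 'n::finite)) \<Rightarrow> bool" where
  "moving_frame A1 F l e \<longleftrightarrow> (\<forall>b. smooth_on UNIV (e b))
     \<and> (\<forall>x a b. e a x \<bullet> e b x = (if a = b then 1 else 0))
     \<and> (\<forall>x i j. pd i (e (Inl j)) x = (l * A1 x $ j $ i) *\<^sub>R e (Inr i) x)
     \<and> (\<forall>x i k. pd i (e (Inr k)) x = F x $ i $ k *\<^sub>R e (Inr i) x
          - (if i = k then (\<Sum>j\<in>UNIV. (l * A1 x $ j $ i) *\<^sub>R e (Inl j) x)
               + (\<Sum>k\<in>UNIV. F x $ i $ k *\<^sub>R e (Inr k) x) else 0))"

lemma sum_UNIV_Plus:
  "(\<Sum>b\<in>UNIV. f (b :: 'm::finite + 'n::finite)) = (\<Sum>j\<in>UNIV. f (Inl j)) + (\<Sum>k\<in>UNIV. f (Inr k))"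
  by (simp only: UNIV_Plus_UNIV[symmetric] sum.Plus finite_class.finite_UNIV o_def)

text \<open>Orthonormality says that the square matrix \<open>M\<close> of columns has a left
  inverse \<open>transpose M\<close>; the expansion is the statement that it is also a right
  inverse.\<close>

lemma moving_frame_expansion:
  assumes "moving_frame A1 F l e"
  shows "v = (\<Sum>b\<in>UNIV. (v \<bullet> e b x) *\<^sub>R e b x)"
proof -
  define M where "M = (\<chi> a b. e b x $ a)"
  have "transpose M ** M = mat 1"
    using assms unfolding moving_frame_def
    by (auto simp: M_def vec_eq_iff matrix_matrix_mult_def transpose_def mat_def inner_vec_def)
  then have M: "M ** transpose M = mat 1" by (simp add: matrix_left_right_inverse)
  have "(\<Sum>b\<in>UNIV. (v \<bullet> e b x) *\<^sub>R e b x) = (M ** transpose M) *v v"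
    unfolding matrix_vector_mul_assoc[symmetric]
    by (simp add: vec_eq_iff M_def matrix_vector_mult_def transpose_def inner_vec_def mult.commute
        sum_distrib_left)
  then show ?thesis by (simp add: M)
qed

text \<open>Two frames of the same pair \<open>(A1, F)\<close>: \<open>e\<close> at spectral value 1
  carries the immersion and its normals, \<open>e0\<close> at value 0 supplies coefficients for
  parallel tangent fields.\<close>

locale lax_frame =
  fixes A1 :: "real^'n::finite \<Rightarrow> real^'n^'m::finite" and F :: "real^'n \<Rightarrow> real^'n^'n"
    and e e0 :: "'m + 'n \<Rightarrow> real^'n \<Rightarrow> real^('m + 'n)"
  assumes A1_smooth: "smooth_on UNIV A1"
    and A1_orth: "transpose (A1 x) ** A1 x = mat 1"
    and e: "moving_frame A1 F 1 e"
    and e0: "moving_frame A1 F 0 e0"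
begin

lemma e_smooth: "smooth_on U (e b)"
  using e smooth_on_subset unfolding moving_frame_def by blast

lemma e_diff [simp]: "e b differentiable at x"
  using smooth_on_differentiable[OF e_smooth] by blast

lemma A1_entry_smooth: "smooth_on U (\<lambda>x. A1 x $ j $ i)"
  by (rule smooth_on_subset[of UNIV]) (auto intro!: smooth_on_vec_nth A1_smooth)

lemma A1_entry_diff [simp]: "(\<lambda>x. A1 x $ j $ i) differentiable at x"
  using smooth_on_differentiable[OF A1_entry_smooth] by blast

lemma e_orthonormal [simp]: "e a x \<bullet> e b x = (if a = b then 1 else 0)"
  using e unfolding moving_frame_def by blast

lemma norm_e [simp]: "norm (e a x) = 1"
  by (simp add: norm_eq_sqrt_inner)

lemma pd_e_Inl: "pd i (e (Inl j)) x = A1 x $ j $ i *\<^sub>R e (Inr i) x"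
  using e unfolding moving_frame_def by simp

lemma pd_e_Inr: "pd i (e (Inr k)) x = F x $ i $ k *\<^sub>R e (Inr i) x
    - (if i = k then (\<Sum>j\<in>UNIV. A1 x $ j $ i *\<^sub>R e (Inl j) x)
         + (\<Sum>k\<in>UNIV. F x $ i $ k *\<^sub>R e (Inr k) x) else 0)"
  using e unfolding moving_frame_def by simp

lemma A1_columns: "(\<Sum>j\<in>UNIV. A1 x $ j $ i * A1 x $ j $ k) = (if i = k then 1 else 0)"
  by (rule sum_columns_orthogonal[OF A1_orth])

lemma expansion: "v = (\<Sum>j\<in>UNIV. (v \<bullet> e (Inl j) x) *\<^sub>R e (Inl j) x)
    + (\<Sum>k\<in>UNIV. (v \<bullet> e (Inr k) x) *\<^sub>R e (Inr k) x)"
  using moving_frame_expansion[OF e, of v x] by (simp add: sum_UNIV_Plus)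

lemma inner_sum_Inr [simp]:
  "(\<Sum>k\<in>UNIV. c k *\<^sub>R e (Inr k) x) \<bullet> e (Inr i) x = c i"
  "(\<Sum>k\<in>UNIV. c k *\<^sub>R e (Inr k) x) \<bullet> e (Inl j) x = 0"
  by (simp_all add: inner_sum_left mult_delta_left mult_delta_right scaleR_delta)

lemma inner_sum_Inl [simp]:
  "(\<Sum>k\<in>UNIV. c k *\<^sub>R e (Inl k) x) \<bullet> e (Inl j) x = c j"
  "(\<Sum>k\<in>J. c k *\<^sub>R e (Inl k) x) \<bullet> e (Inr i) x = 0"
  by (simp_all add: inner_sum_left mult_delta_left mult_delta_right scaleR_delta)

lemma dmap_e_Inl: "dmap (e (Inl j)) x u = (\<Sum>i\<in>UNIV. (u $ i * A1 x $ j $ i) *\<^sub>R e (Inr i) x)"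
  by (simp add: frechet_derivative_eq_sum_pd pd_e_Inl)

text \<open>Integrability condition: the mixed partial derivatives of \<open>e (Inl j)\<close> in
  directions \<open>i\<close> and \<open>k\<close> commute, and the \<open>e (Inr i)\<close>
  component of this identity is the claim. Row \<open>j = k0\<close> gives the formula for
  \<open>F\<close> required by \<open>corresponds\<close>.\<close>

lemma A1_pd:
  assumes "i \<noteq> k"
  shows "pd k (\<lambda>y. A1 y $ j $ i) x = F x $ i $ k * A1 x $ j $ k"
proof -
  have mixed: "pd a (pd b (e (Inl j))) x
      = A1 x $ j $ b *\<^sub>R pd a (e (Inr b)) x + pd a (\<lambda>y. A1 y $ j $ b) x *\<^sub>R e (Inr b) x" for a b
  proof -
    have "pd b (e (Inl j)) = (\<lambda>y. A1 y $ j $ b *\<^sub>R e (Inr b) y)"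
      by (simp add: fun_eq_iff pd_e_Inl)
    then show ?thesis by (simp add: pd_scaleR)
  qed
  have "pd k (pd i (e (Inl j))) x = pd i (pd k (e (Inl j))) x"
    by (rule pd_commute[OF open_UNIV e_smooth UNIV_I])
  then have "pd k (pd i (e (Inl j))) x \<bullet> e (Inr i) x = pd i (pd k (e (Inl j))) x \<bullet> e (Inr i) x"
    by simp
  then show ?thesis
    unfolding mixed pd_e_Inr using assms by (auto simp: inner_add_left mult.commute)
qed

end

locale lax_frame_patch = lax_frame A1 F e e0
  for A1 :: "real^'n::finite \<Rightarrow> real^'n^'m::finite" and F :: "real^'n \<Rightarrow> real^'n^'n"
    and e e0 :: "'m + 'n \<Rightarrow> real^'n \<Rightarrow> real^('m + 'n)" +
  fixes k0 :: 'm and U :: "(real^'n) set"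
  assumes U: "open U" and A1_nz: "x \<in> U \<Longrightarrow> A1 x $ k0 $ i \<noteq> 0"
begin

abbreviation "X \<equiv> e (Inl k0)"

text \<open>The differential of \<open>X\<close> sends the i-th coordinate vector to
  \<open>A1 x $ k0 $ i\<close> times \<open>e (Inr i) x\<close>. On \<open>U\<close> these factors
  can be divided out, so the range is the whole span of the tangential frame vectors.\<close>

lemma tangent_space_iff:
  assumes "x \<in> U"
  shows "v \<in> tangent_space X x \<longleftrightarrow> (\<forall>j. v \<bullet> e (Inl j) x = 0)"
proof
  assume R: "\<forall>j. v \<bullet> e (Inl j) x = 0"
  then have "v = (\<Sum>k\<in>UNIV. (v \<bullet> e (Inr k) x) *\<^sub>R e (Inr k) x)"
    using expansion[of v x] by simp
  also have "\<dots> = dmap X x (\<chi> i. (v \<bullet> e (Inr i) x) / A1 x $ k0 $ i)"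
    using A1_nz[OF assms] by (simp add: dmap_e_Inl)
  finally show "v \<in> tangent_space X x" unfolding tangent_space_def by blast
qed (auto simp: tangent_space_def dmap_e_Inl)

lemma e_Inr_tangent: "x \<in> U \<Longrightarrow> e (Inr i) x \<in> tangent_space X x"
  by (simp add: tangent_space_iff)

lemma tangent_expansion:
  assumes "x \<in> U" "v \<in> tangent_space X x"
  shows "v = (\<Sum>k\<in>UNIV. (v \<bullet> e (Inr k) x) *\<^sub>R e (Inr k) x)"
  using expansion[of v x] assms by (simp add: tangent_space_iff)

lemma euclidean_normal_space_iff:
  assumes "x \<in> U"
  shows "v \<in> euclidean_normal_space X x \<longleftrightarrow> (\<forall>i. v \<bullet> e (Inr i) x = 0)"
proof
  assume R: "\<forall>i. v \<bullet> e (Inr i) x = 0"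
  have "v \<bullet> t = 0" if "t \<in> tangent_space X x" for t
    by (subst tangent_expansion[OF assms that]) (simp add: inner_sum_right R)
  then show "v \<in> euclidean_normal_space X x" by (simp add: euclidean_normal_space_def)
qed (use e_Inr_tangent[OF assms] in \<open>auto simp: euclidean_normal_space_def\<close>)

lemma sphere_normal_space_iff:
  "x \<in> U \<Longrightarrow> v \<in> sphere_normal_space X x \<longleftrightarrow> v \<bullet> X x = 0 \<and> (\<forall>i. v \<bullet> e (Inr i) x = 0)"
  using euclidean_normal_space_iff[of x v]
  by (auto simp: euclidean_normal_space_def sphere_normal_space_def)

lemma normal_expansion:
  assumes "x \<in> U" "v \<in> sphere_normal_space X x"
  shows "v = (\<Sum>j\<in>- {k0}. (v \<bullet> e (Inl j) x) *\<^sub>R e (Inl j) x)"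
proof -
  have "v = (\<Sum>j\<in>UNIV. (v \<bullet> e (Inl j) x) *\<^sub>R e (Inl j) x)"
    using expansion[of v x] assms by (simp add: sphere_normal_space_iff)
  also have "\<dots> = (\<Sum>j\<in>- {k0}. (v \<bullet> e (Inl j) x) *\<^sub>R e (Inl j) x)"
    using assms by (intro sum.mono_neutral_right) (auto simp: sphere_normal_space_iff)
  finally show ?thesis .
qed

lemma e_Inl_normal: "x \<in> U \<Longrightarrow> j \<noteq> k0 \<Longrightarrow> e (Inl j) x \<in> sphere_normal_space X x"
  by (simp add: sphere_normal_space_iff)

lemma subspace_tangent: "x \<in> U \<Longrightarrow> subspace (tangent_space X x)"
  by (auto simp: subspace_def tangent_space_iff inner_add_left)

lemma subspace_normal: "x \<in> U \<Longrightarrow> subspace (sphere_normal_space X x)"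
  by (auto simp: subspace_def sphere_normal_space_iff inner_add_left)

lemma immersion: "sphere_immersion U X"
proof -
  have "inj (dmap X x)" if "x \<in> U" for x
  proof (rule injI)
    fix u v assume "dmap X x u = dmap X x v"
    then have "dmap X x u \<bullet> e (Inr i) x = dmap X x v \<bullet> e (Inr i) x" for i by simp
    then show "u = v" using A1_nz[OF that] by (simp add: dmap_e_Inl vec_eq_iff)
  qed
  then show ?thesis using U e_smooth by (simp add: sphere_immersion_def)
qed

lemma flat_tangent: "flat_submanifold U X"
proof -
  \<comment> \<open>On tangential indices \<open>e0\<close> and \<open>e\<close> have the same connection matrix, so the coefficients
    taken from \<open>e0\<close> cancel the connection of \<open>e\<close>.\<close>
  define g where "g b = (\<lambda>x. \<Sum>k\<in>UNIV. e0 (Inr k) x $ b *\<^sub>R e (Inr k) x)" for b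
  have e0s: "smooth_on UNIV (e0 b)" for b using e0 by (simp add: moving_frame_def)
  have e0cs: "smooth_on U (\<lambda>x. e0 c x $ b)" for b c
    by (rule smooth_on_subset[of UNIV]) (auto intro!: smooth_on_vec_nth e0s)
  then have e0d [simp]: "(\<lambda>x. e0 c x $ b) differentiable at x" if "x \<in> U" for x b c
    using smooth_on_differentiable that by blast
  show ?thesis
    unfolding flat_submanifold_def
  proof (rule flat_bundle_if_parallel_frame[where J = UNIV and g = g, OF U subspace_tangent])
    fix b
    show "smooth_section U (tangent_space X) (g b)"
      unfolding smooth_section_def g_def
      by (auto intro!: smooth_on_sum smooth_on_scaleR U e0cs e_smooth simp: tangent_space_iff)
  next
    fix b i x w assume x: "x \<in> U" and w: "w \<in> tangent_space X x"
    define c where "c k = w \<bullet> e (Inr k) x" for k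
    \<comment> \<open>At spectral value 0 the \<open>Inl\<close> terms drop out of the frame
      equation, so the tangential vectors of \<open>e0\<close> satisfy a closed system in which only
      \<open>F\<close> occurs.\<close>
    have pe0: "pd i (\<lambda>x. e0 (Inr k) x $ b) x = F x $ i $ k * e0 (Inr i) x $ b
        - (if i = k then \<Sum>k\<in>UNIV. F x $ i $ k * e0 (Inr k) x $ b else 0)" for k
    proof -
      have "pd i (\<lambda>x. e0 (Inr k) x $ b) x = pd i (e0 (Inr k)) x $ b"
        by (intro pd_vec_nth smooth_on_differentiable[OF e0s]) simp
      then show ?thesis using e0 by (simp add: moving_frame_def)
    qed
    have pe: "pd i (e (Inr k)) x \<bullet> w = F x $ i $ k * c i
        - (if i = k then \<Sum>k\<in>UNIV. F x $ i $ k * c k else 0)" for k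
      using w x by (simp add: pd_e_Inr inner_diff_right inner_add_right inner_sum_right
          inner_commute[of _ w] c_def tangent_space_iff)
    have "pd i (g b) x = (\<Sum>k\<in>UNIV. pd i (\<lambda>x. e0 (Inr k) x $ b *\<^sub>R e (Inr k) x) x)"
      unfolding g_def using x
      by (intro pd_sum differentiable_bounded_bilinear[OF bounded_bilinear_scaleR]) auto
    also have "\<dots> = (\<Sum>k\<in>UNIV. e0 (Inr k) x $ b *\<^sub>R pd i (e (Inr k)) x
        + pd i (\<lambda>x. e0 (Inr k) x $ b) x *\<^sub>R e (Inr k) x)"
      using x by (intro sum.cong refl pd_scaleR) auto
    finally have "pd i (g b) x \<bullet> w = (\<Sum>k\<in>UNIV. e0 (Inr k) x $ b * (pd i (e (Inr k)) x \<bullet> w)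
        + pd i (\<lambda>x. e0 (Inr k) x $ b) x * c k)"
      by (simp add: inner_sum_right inner_add_right c_def inner_commute[of _ w])
    also have "\<dots> = 0"
      unfolding pe pe0
      by (simp add: algebra_simps sum.distrib sum_subtractf sum_distrib_left mult_delta_left mult_delta_right scaleR_delta)
    finally show "pd i (g b) x \<bullet> w = 0" .
  next
    fix x v assume x: "x \<in> U" and v: "v \<in> tangent_space X x"
    \<comment> \<open>Summing over the ambient coordinate \<open>b\<close> gives inner products of
      the vectors of \<open>e0\<close>. This makes the fields \<open>g b\<close>, more numerous than
      the dimension of the tangent space, a Parseval frame.\<close>
    have on: "(\<Sum>b\<in>UNIV. e0 (Inr k) x $ b * e0 (Inr l) x $ b) = (if k = l then 1 else 0)" for k l
      using e0 by (simp add: moving_frame_def inner_vec_def)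
    have "(\<Sum>b\<in>UNIV. (v \<bullet> g b x) *\<^sub>R g b x)
        = (\<Sum>b\<in>UNIV. \<Sum>k\<in>UNIV. \<Sum>l\<in>UNIV.
            ((v \<bullet> e (Inr l) x) * (e0 (Inr k) x $ b * e0 (Inr l) x $ b)) *\<^sub>R e (Inr k) x)"
      by (simp add: g_def inner_sum_right scaleR_sum_right scaleR_sum_left sum_distrib_left
          sum_distrib_right ac_simps)
    also have "\<dots> = (\<Sum>k\<in>UNIV. \<Sum>l\<in>UNIV. \<Sum>b\<in>UNIV.
            ((v \<bullet> e (Inr l) x) * (e0 (Inr k) x $ b * e0 (Inr l) x $ b)) *\<^sub>R e (Inr k) x)"
      by (subst sum.swap, rule sum.cong[OF refl], rule sum.swap)
    also have "\<dots> = (\<Sum>k\<in>UNIV. \<Sum>l\<in>UNIV. ((v \<bullet> e (Inr l) x) * (if k = l then 1 else 0)) *\<^sub>R e (Inr k) x)"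
      by (simp only: on[symmetric] sum_distrib_left scaleR_sum_left)
    also have "\<dots> = v"
      using tangent_expansion[OF x v] by (simp add: mult_delta_left mult_delta_right scaleR_delta)
    finally show "v = (\<Sum>b\<in>UNIV. (v \<bullet> g b x) *\<^sub>R g b x)" by simp
  qed
qed

lemma e_Inl_section: "j \<noteq> k0 \<Longrightarrow> smooth_section U (sphere_normal_space X) (e (Inl j))"
  using e_smooth e_Inl_normal by (simp add: smooth_section_def)

lemma pd_e_Inl_normal:
  "x \<in> U \<Longrightarrow> w \<in> sphere_normal_space X x \<Longrightarrow> pd i (e (Inl j)) x \<bullet> w = 0"
  by (simp add: pd_e_Inl sphere_normal_space_iff inner_commute[of _ w])

lemma flat_normal: "flat_normal_bundle U X"
  unfolding flat_normal_bundle_def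
  by (rule flat_bundle_if_parallel_frame[where J = "- {k0}" and g = "\<lambda>j. e (Inl j)"])
     (use U subspace_normal e_Inl_section pd_e_Inl_normal normal_expansion in auto)

lemma orthonormal_tangent: "orthonormal_frame U (tangent_space X) UNIV (\<lambda>i. e (Inr i))"
proof -
  have "span ((\<lambda>k. e (Inr k) x) ` UNIV) = tangent_space X x" if x: "x \<in> U" for x
  proof (rule antisym)
    show "span ((\<lambda>k. e (Inr k) x) ` UNIV) \<subseteq> tangent_space X x"
      by (intro span_minimal subspace_tangent x) (use e_Inr_tangent[OF x] in auto)
    show "tangent_space X x \<subseteq> span ((\<lambda>k. e (Inr k) x) ` UNIV)"
    proof
      fix v assume "v \<in> tangent_space X x"
      show "v \<in> span ((\<lambda>k. e (Inr k) x) ` UNIV)"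
        by (subst tangent_expansion[OF x \<open>v \<in> _\<close>]) (intro span_sum span_scale span_base imageI)
    qed
  qed
  then show ?thesis
    unfolding orthonormal_frame_def smooth_section_def using e_smooth e_Inr_tangent by simp
qed

lemma parallel_normal: "parallel_normal_frame U X (- {k0}) (\<lambda>j. e (Inl j))"
proof -
  have "span ((\<lambda>k. e (Inl k) x) ` (- {k0})) = sphere_normal_space X x" if x: "x \<in> U" for x
  proof (rule antisym)
    show "span ((\<lambda>k. e (Inl k) x) ` (- {k0})) \<subseteq> sphere_normal_space X x"
      by (intro span_minimal subspace_normal x) (use e_Inl_normal[OF x] in auto)
    show "sphere_normal_space X x \<subseteq> span ((\<lambda>k. e (Inl k) x) ` (- {k0}))"
    proof
      fix v assume "v \<in> sphere_normal_space X x"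
      show "v \<in> span ((\<lambda>k. e (Inl k) x) ` (- {k0}))"
        by (subst normal_expansion[OF x \<open>v \<in> _\<close>]) (intro span_sum span_scale span_base imageI)
    qed
  qed
  moreover have "cov_deriv (sphere_normal_space X) i (e (Inl j)) x = 0" if "x \<in> U" for i j x
    unfolding cov_deriv_def using that pd_e_Inl_normal subspace_normal
    by (intro orth_projI) (auto intro: subspace_0)
  ultimately show ?thesis
    unfolding parallel_normal_frame_def orthonormal_frame_def parallel_normal_field_def
    using e_Inl_section by simp
qed

text \<open>The metric is diagonal, and for distinct \<open>i\<close> and \<open>j\<close> the mixed
  derivative of \<open>X\<close> is tangential, so both matrices are diagonal. The sum includes
  \<open>j = k0\<close>: an ambient normal \<open>v\<close> may have a component along
  \<open>X\<close>, which contributes a multiple of the identity.\<close>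

lemma shape_operator_eq:
  assumes "x \<in> U" "\<And>i. v \<bullet> e (Inr i) x = 0"
  shows "shape_operator X x v
    = diagm (\<lambda>i. - (\<Sum>j\<in>UNIV. A1 x $ j $ i * (v \<bullet> e (Inl j) x)) / A1 x $ k0 $ i)"
proof -
  have pp: "pd i (pd j X) x \<bullet> v
      = (if i = j then - A1 x $ k0 $ i * (\<Sum>r\<in>UNIV. A1 x $ r $ i * (v \<bullet> e (Inl r) x)) else 0)" for i j
  proof -
    have "pd j X = (\<lambda>y. A1 y $ k0 $ j *\<^sub>R e (Inr j) y)" by (simp add: fun_eq_iff pd_e_Inl)
    then have "pd i (pd j X) x
        = A1 x $ k0 $ j *\<^sub>R pd i (e (Inr j)) x + pd i (\<lambda>y. A1 y $ k0 $ j) x *\<^sub>R e (Inr j) x"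
      by (simp add: pd_scaleR)
    then show ?thesis
      by (simp add: pd_e_Inr inner_add_right inner_diff_right inner_sum_right inner_commute[of _ v]
          assms(2))
  qed
  have g: "(\<chi> i j. pd i X x \<bullet> pd j X x) = diagm (\<lambda>i. A1 x $ k0 $ i * A1 x $ k0 $ i)"
    by (simp add: vec_eq_iff pd_e_Inl diagm_def)
  have h: "(\<chi> i j. pd i (pd j X) x \<bullet> v)
      = diagm (\<lambda>i. - A1 x $ k0 $ i * (\<Sum>r\<in>UNIV. A1 x $ r $ i * (v \<bullet> e (Inl r) x)))"
    by (simp add: vec_eq_iff pp diagm_def)
  show ?thesis
    unfolding shape_operator_def g h using A1_nz[OF assms(1)]
    by (subst matrix_inv_diagm) (simp_all add: diagm_mult field_simps)
qed

text \<open>The shape operators of the ambient normal vectors are exactly the diagonal matrices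
  \<open>T c\<close>.\<close>

lemma nondegenerate: "nondegenerate_normal_bundle U X"
  unfolding nondegenerate_normal_bundle_def
proof
  fix x assume x: "x \<in> U"
  define T :: "real^'n \<Rightarrow> real^'n^'n" where "T c = diagm (\<lambda>i. c $ i)" for c
  have lin: "linear T"
    by (rule linearI) (simp_all add: T_def diagm_def vec_eq_iff)
  have "T c \<in> shape_operator X x ` euclidean_normal_space X x" for c
  proof -
    \<comment> \<open>The required inner products with the columns of \<open>A1\<close> are
      prescribed. Since these columns are orthonormal, the combination of them with the prescribed
      numbers as coefficients has the right inner products.\<close>
    define v where "v = (\<Sum>r\<in>UNIV. (- (\<Sum>i\<in>UNIV. A1 x $ r $ i * (A1 x $ k0 $ i * c $ i))) *\<^sub>R e (Inl r) x)"
    have "(\<Sum>j\<in>UNIV. A1 x $ j $ k * (v \<bullet> e (Inl j) x)) = - (A1 x $ k0 $ k * c $ k)" for k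
    proof -
      have "(\<Sum>j\<in>UNIV. A1 x $ j $ k * (v \<bullet> e (Inl j) x))
          = - (\<Sum>j\<in>UNIV. \<Sum>i\<in>UNIV. (A1 x $ j $ k * A1 x $ j $ i) * (A1 x $ k0 $ i * c $ i))"
        unfolding v_def inner_sum_Inl by (simp add: sum_distrib_left sum_negf mult.assoc)
      also have "\<dots> = - (\<Sum>i\<in>UNIV. (\<Sum>j\<in>UNIV. A1 x $ j $ k * A1 x $ j $ i) * (A1 x $ k0 $ i * c $ i))"
        by (subst sum.swap) (simp add: sum_distrib_right)
      finally show ?thesis by (simp add: A1_columns mult_delta_left mult_delta_right scaleR_delta)
    qed
    moreover have vn: "v \<bullet> e (Inr i) x = 0" for i unfolding v_def by (rule inner_sum_Inl)
    ultimately have "shape_operator X x v = T c"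
      using A1_nz[OF x] by (simp add: shape_operator_eq[OF x] T_def)
    then show ?thesis using vn euclidean_normal_space_iff[OF x] by (intro image_eqI[of _ _ v]) auto
  qed
  moreover have "shape_operator X x v \<in> range T" if "v \<in> euclidean_normal_space X x" for v
  proof -
    have "shape_operator X x v
        = T (\<chi> i. - (\<Sum>j\<in>UNIV. A1 x $ j $ i * (v \<bullet> e (Inl j) x)) / A1 x $ k0 $ i)"
      unfolding T_def vec_lambda_beta using that
      by (intro shape_operator_eq[OF x]) (simp add: euclidean_normal_space_iff[OF x])
    then show ?thesis by blast
  qed
  ultimately have "shape_operator X x ` euclidean_normal_space X x = range T" by blast
  moreover have "inj T" by (auto simp: inj_def T_def diagm_def vec_eq_iff)
  then have "dim (range T) = dim (UNIV :: (real^'n) set)" by (intro dim_image_eq lin) auto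
  ultimately show "dim (shape_operator X x ` euclidean_normal_space X x) = CARD('n)" by simp
qed

lemma corresponding: "corresponds k0 U A1 F X (\<lambda>i. e (Inr i)) (\<lambda>j. e (Inl j))"
proof -
  have "first_ff X (\<lambda>i. e (Inr i)) x u v = (\<Sum>i\<in>UNIV. (A1 x $ k0 $ i)\<^sup>2 * (u $ i * v $ i))" for x u v
    by (simp add: first_ff_def dmap_e_Inl power2_eq_square ac_simps)
  moreover have "second_ff X (\<lambda>i. e (Inr i)) (- {k0}) (\<lambda>j. e (Inl j)) x u v
      = (\<Sum>i\<in>UNIV. \<Sum>j\<in>- {k0}. (A1 x $ k0 $ i * A1 x $ j $ i * (u $ i * v $ i)) *\<^sub>R e (Inl j) x)"
    for x u v
  proof -
    have "second_ff X (\<lambda>i. e (Inr i)) (- {k0}) (\<lambda>j. e (Inl j)) x u v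
        = (\<Sum>j\<in>- {k0}. \<Sum>i\<in>UNIV. (A1 x $ k0 $ i * A1 x $ j $ i * (u $ i * v $ i)) *\<^sub>R e (Inl j) x)"
      unfolding second_ff_def dmap_e_Inl inner_commute[of "e (Inr _) x"] inner_sum_Inr
      by (simp add: ac_simps)
    then show ?thesis by (subst sum.swap)
  qed
  moreover have "F x $ i $ j = pd j (\<lambda>y. A1 y $ k0 $ i) x / A1 x $ k0 $ j"
    if "i \<noteq> j" "x \<in> U" for x i j
    using A1_pd[OF that(1)] A1_nz[OF that(2)] by simp
  ultimately show ?thesis unfolding corresponds_def by simp
qed

lemma curvature_lines:
  "line_of_curvature_coordinates U X (\<lambda>i. e (Inr i)) (- {k0}) (\<lambda>j. e (Inl j))"
proof -
  have z: "axis i (1::real) $ k * axis j 1 $ k = 0" if "i \<noteq> j" for i j k :: 'n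
    using that by (simp add: axis_def)
  then show ?thesis
    using corresponding unfolding line_of_curvature_coordinates_def corresponds_def by (simp add: z del: mult_eq_0_iff)
qed

text \<open>All shape operators have equal eigenvalues for two coordinate directions only if the
  corresponding columns of \<open>A1\<close> are proportional, which contradicts their orthogonality.\<close>

lemma principal_direction_axis:
  assumes x: "x \<in> U" and pr: "principal_direction X x u"
  obtains t i where "t \<noteq> 0" "u = t *\<^sub>R axis i 1"
proof -
  \<comment> \<open>The zero vector is a normal vector, so the quantifier in
    \<open>principal_direction\<close> is never vacuous.\<close>
  have u: "u \<noteq> 0"
    using pr subspace_0[OF subspace_normal[OF x]]
    unfolding principal_direction_def eigenvector_def by blast
  then obtain p where p: "u $ p \<noteq> 0" by (auto simp: vec_eq_iff)
  have "u $ q = 0" if "q \<noteq> p" for q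
  proof (rule ccontr)
    assume q: "u $ q \<noteq> 0"
    have ratio: "A1 x $ j $ p / A1 x $ k0 $ p = A1 x $ j $ q / A1 x $ k0 $ q" for j
    proof (cases "j = k0")
      case True
      then show ?thesis using A1_nz[OF x] by simp
    next
      case False
      from pr e_Inl_normal[OF x False] obtain c
        where "shape_operator X x (e (Inl j) x) *v u = c *\<^sub>R u"
        unfolding principal_direction_def eigenvector_def by blast
      then have "- A1 x $ j $ i / A1 x $ k0 $ i * u $ i = c * u $ i" for i
        using x by (simp add: shape_operator_eq diagm_mult_vec vec_eq_iff mult_delta_left mult_delta_right scaleR_delta)
      then have "- A1 x $ j $ i / A1 x $ k0 $ i = c" if "u $ i \<noteq> 0" for i
        using that mult_right_cancel by blast
      from this[OF p] this[OF q] show ?thesis by simp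
    qed
    define r where "r = A1 x $ k0 $ q / A1 x $ k0 $ p"
    have "A1 x $ j $ q = r * A1 x $ j $ p" for j
      using ratio[of j] A1_nz[OF x] by (simp add: r_def field_simps)
    then have "(\<Sum>j\<in>UNIV. A1 x $ j $ p * A1 x $ j $ q) = r * (\<Sum>j\<in>UNIV. A1 x $ j $ p * A1 x $ j $ p)"
      by (simp add: sum_distrib_left mult.left_commute)
    then have "r = 0" using \<open>q \<noteq> p\<close> by (simp add: A1_columns)
    then show False using A1_nz[OF x] by (simp add: r_def)
  qed
  then have "u = u $ p *\<^sub>R axis p 1" by (auto simp: vec_eq_iff axis_def)
  then show ?thesis using that p by blast
qed

end

section \<open>Ribaucour transformations between submanifolds with reflected frames\<close>

text \<open>Linearity is known for arguments in \<open>N\<close> only, so the induction keeps the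
  partial sums inside this subspace.\<close>

lemma linear_between_sum:
  assumes "subspace N" "linear_between N f" "finite J" "\<And>j. j \<in> J \<Longrightarrow> g j \<in> N"
  shows "f (\<Sum>j\<in>J. c j *\<^sub>R g j) = (\<Sum>j\<in>J. c j *\<^sub>R f (g j))"
  using assms(3,4)
proof (induction J rule: finite_induct)
  case empty
  have "f (0 *\<^sub>R 0 + 0 *\<^sub>R 0) = 0 *\<^sub>R f 0 + 0 *\<^sub>R f 0"
    using assms(1,2) subspace_0 unfolding linear_between_def by blast
  then show ?case by simp
next
  case (insert j J)
  have "(\<Sum>j\<in>J. c j *\<^sub>R g j) \<in> N"
    using insert assms(1) by (intro subspace_sum subspace_scale) auto
  then have "f (c j *\<^sub>R g j + 1 *\<^sub>R (\<Sum>j\<in>J. c j *\<^sub>R g j))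
      = c j *\<^sub>R f (g j) + 1 *\<^sub>R f (\<Sum>j\<in>J. c j *\<^sub>R g j)"
    using insert assms(2) unfolding linear_between_def by blast
  then show ?case using insert by simp
qed

text \<open>\<open>reflected\<close> is a pointwise condition, with \<open>q\<close> and \<mu>
  chosen at each \<open>x\<close>: the meeting of geodesics is a pointwise statement.\<close>

locale lax_frame_pair =
  M: lax_frame_patch A1 F e e0 k0 U + N: lax_frame_patch A1' F' e' e0' k0 U
  for A1 A1' :: "real^'n::finite \<Rightarrow> real^'n^'m::finite" and F F' :: "real^'n \<Rightarrow> real^'n^'n"
    and e e0 e' e0' :: "'m + 'n \<Rightarrow> real^'n \<Rightarrow> real^('m + 'n)"
    and k0 :: 'm and U :: "(real^'n) set" +
  assumes reflected: "\<exists>q \<mu>. \<forall>b. e' b x = e b x - \<mu> b *\<^sub>R q"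
begin

context
  fixes P
  assumes P_linear: "x \<in> U \<Longrightarrow> linear_between (sphere_normal_space M.X x) (P x)"
    and P_frame: "x \<in> U \<Longrightarrow> j \<noteq> k0 \<Longrightarrow> P x (e (Inl j) x) = e' (Inl j) x"
begin

lemma P_eq:
  assumes "x \<in> U" "v \<in> sphere_normal_space M.X x"
  shows "P x v = (\<Sum>j\<in>- {k0}. (v \<bullet> e (Inl j) x) *\<^sub>R e' (Inl j) x)"
proof -
  have "P x v = P x (\<Sum>j\<in>- {k0}. (v \<bullet> e (Inl j) x) *\<^sub>R e (Inl j) x)"
    using M.normal_expansion[OF assms] by simp
  also have "\<dots> = (\<Sum>j\<in>- {k0}. (v \<bullet> e (Inl j) x) *\<^sub>R P x (e (Inl j) x))"
    using assms(1) M.e_Inl_normal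
    by (intro linear_between_sum[OF M.subspace_normal[OF assms(1)] P_linear[OF assms(1)]]) auto
  finally show ?thesis using P_frame[OF assms(1)] by simp
qed

lemma normal_combination:
  "x \<in> U \<Longrightarrow> (\<Sum>j\<in>- {k0}. c j *\<^sub>R e (Inl j) x) \<in> sphere_normal_space M.X x"
  "x \<in> U \<Longrightarrow> (\<Sum>j\<in>- {k0}. c j *\<^sub>R e' (Inl j) x) \<in> sphere_normal_space N.X x"
  by (intro subspace_sum subspace_scale M.subspace_normal N.subspace_normal M.e_Inl_normal
      N.e_Inl_normal; simp)+

lemma P_coordinates:
  assumes "x \<in> U" "v \<in> sphere_normal_space M.X x" "j \<noteq> k0"
  shows "P x v \<bullet> e' (Inl j) x = v \<bullet> e (Inl j) x"
  unfolding P_eq[OF assms(1,2)] using assms(3)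
  by (simp add: inner_sum_left mult_delta_left mult_delta_right)

lemma P_norm:
  assumes "x \<in> U" "v \<in> sphere_normal_space M.X x"
  shows "norm (P x v) = norm v"
proof -
  have "P x v \<bullet> P x v = (\<Sum>j\<in>- {k0}. (v \<bullet> e (Inl j) x) * (e' (Inl j) x \<bullet> P x v))"
    by (subst (1) P_eq[OF assms]) (simp add: inner_sum_left)
  also have "\<dots> = (\<Sum>j\<in>- {k0}. (v \<bullet> e (Inl j) x) * (e (Inl j) x \<bullet> v))"
    by (intro sum.cong refl) (use P_coordinates[OF assms] in \<open>auto simp: inner_commute\<close>)
  also have "\<dots> = v \<bullet> v"
    by (subst (3) M.normal_expansion[OF assms]) (simp add: inner_sum_left)
  finally show ?thesis by (simp add: norm_eq_sqrt_inner)
qed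

lemma P_bij:
  assumes "x \<in> U"
  shows "bij_betw (P x) (sphere_normal_space M.X x) (sphere_normal_space N.X x)"
proof (rule bij_betw_byWitness[where f' = "\<lambda>w. \<Sum>j\<in>- {k0}. (w \<bullet> e' (Inl j) x) *\<^sub>R e (Inl j) x"])
  show "\<forall>v\<in>sphere_normal_space M.X x. (\<Sum>j\<in>- {k0}. (P x v \<bullet> e' (Inl j) x) *\<^sub>R e (Inl j) x) = v"
  proof
    fix v assume v: "v \<in> sphere_normal_space M.X x"
    have "(\<Sum>j\<in>- {k0}. (P x v \<bullet> e' (Inl j) x) *\<^sub>R e (Inl j) x)
        = (\<Sum>j\<in>- {k0}. (v \<bullet> e (Inl j) x) *\<^sub>R e (Inl j) x)"
      using P_coordinates[OF assms v] by (intro sum.cong) auto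
    then show "(\<Sum>j\<in>- {k0}. (P x v \<bullet> e' (Inl j) x) *\<^sub>R e (Inl j) x) = v"
      using M.normal_expansion[OF assms v] by simp
  qed
  show "\<forall>w\<in>sphere_normal_space N.X x. P x (\<Sum>j\<in>- {k0}. (w \<bullet> e' (Inl j) x) *\<^sub>R e (Inl j) x) = w"
  proof
    fix w assume w: "w \<in> sphere_normal_space N.X x"
    have "P x (\<Sum>j\<in>- {k0}. (w \<bullet> e' (Inl j) x) *\<^sub>R e (Inl j) x)
        = (\<Sum>j\<in>- {k0}. (w \<bullet> e' (Inl j) x) *\<^sub>R P x (e (Inl j) x))"
      using assms M.e_Inl_normal
      by (intro linear_between_sum[OF M.subspace_normal[OF assms] P_linear[OF assms]]) auto
    then show "P x (\<Sum>j\<in>- {k0}. (w \<bullet> e' (Inl j) x) *\<^sub>R e (Inl j) x) = w"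
      using N.normal_expansion[OF assms w] P_frame[OF assms] by simp
  qed
  show "P x ` sphere_normal_space M.X x \<subseteq> sphere_normal_space N.X x"
    using P_eq[OF assms] normal_combination(2)[OF assms] by auto
  show "(\<lambda>w. \<Sum>j\<in>- {k0}. (w \<bullet> e' (Inl j) x) *\<^sub>R e (Inl j) x) ` sphere_normal_space N.X x
      \<subseteq> sphere_normal_space M.X x"
    using normal_combination(1)[OF assms] by auto
qed

lemma push_field_eq:
  assumes "S \<subseteq> U" "smooth_section S (sphere_normal_space M.X) \<zeta>" "x \<in> S"
  shows "push_field U (\<lambda>x. x) P \<zeta> x = (\<Sum>j\<in>- {k0}. (\<zeta> x \<bullet> e (Inl j) x) *\<^sub>R e' (Inl j) x)"
proof -
  have "inv_into U (\<lambda>x. x) x = x" using assms inv_into_f_f[of "\<lambda>x. x" U x] by auto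
  then show ?thesis
    using assms P_eq[of x "\<zeta> x"] by (auto simp: push_field_def smooth_section_def)
qed

text \<open>\<open>P\<close> is given fibrewise. Its effect on smooth sections is smooth because it
  copies their coordinates from one smooth frame to another.\<close>

lemma push_section:
  assumes "open S" "S \<subseteq> U" and z: "smooth_section S (sphere_normal_space M.X) \<zeta>"
  shows "smooth_section S (sphere_normal_space N.X) (push_field U (\<lambda>x. x) P \<zeta>)"
proof -
  have "smooth_on S (\<lambda>x. \<Sum>j\<in>- {k0}. (\<zeta> x \<bullet> e (Inl j) x) *\<^sub>R e' (Inl j) x)"
    using z by (intro smooth_on_sum smooth_on_scaleR smooth_on_inner assms(1) M.e_smooth N.e_smooth)
      (auto simp: smooth_section_def)
  moreover have "smooth_on S (push_field U (\<lambda>x. x) P \<zeta>)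
      \<longleftrightarrow> smooth_on S (\<lambda>x. \<Sum>j\<in>- {k0}. (\<zeta> x \<bullet> e (Inl j) x) *\<^sub>R e' (Inl j) x)"
    using push_field_eq[OF assms(2) z] by (intro smooth_on_cong assms(1))
  ultimately show ?thesis
    using push_field_eq[OF assms(2) z] normal_combination(2) assms(2)
    by (auto simp: smooth_section_def)
qed

lemma normal_bundle_isomorphism: "normal_bundle_iso U M.X U N.X (\<lambda>x. x) P"
proof -
  have id: "smooth_on U (\<lambda>x. x)"
    by (rule smooth_on_ident[OF M.U])
  have "inv_into U (\<lambda>x. x) x = x" if "x \<in> U" for x
    using that inv_into_f_f[of "\<lambda>x. x" U x] by auto
  then have "smooth_on U (inv_into U (\<lambda>x. x))"
    using smooth_on_cong[OF M.U, of "inv_into U (\<lambda>x. x)" "\<lambda>x. x"] id by simp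
  then have "diffeomorphism_between U U (\<lambda>x. x)"
    using id by (simp add: diffeomorphism_between_def bij_betw_def)
  then show ?thesis
    unfolding normal_bundle_iso_def using P_linear P_bij push_section by simp
qed

text \<open>In the parallel frame \<open>e\<close>, the coordinates of a parallel field have zero
  derivative. \<open>P\<close> preserves the coordinates, and the frame \<open>e'\<close> is
  parallel as well.\<close>

lemma push_parallel:
  assumes "open S" "S \<subseteq> U" "parallel_normal_field S M.X \<zeta>"
  shows "parallel_normal_field S N.X (push_field U (\<lambda>x. x) P \<zeta>)"
proof -
  have z: "smooth_section S (sphere_normal_space M.X) \<zeta>"
    using assms(3) by (simp add: parallel_normal_field_def)
  then have zs: "smooth_on S \<zeta>" and zn: "\<And>x. x \<in> S \<Longrightarrow> \<zeta> x \<in> sphere_normal_space M.X x"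
    by (auto simp: smooth_section_def)
  define h where "h j = (\<lambda>x. \<zeta> x \<bullet> e (Inl j) x)" for j
  have "cov_deriv (sphere_normal_space N.X) i (push_field U (\<lambda>x. x) P \<zeta>) x = 0" if x: "x \<in> S" for x i
  proof -
    have xU: "x \<in> U" using x assms(2) by blast
    have zd: "\<zeta> differentiable at x" by (rule smooth_on_differentiable[OF zs x])
    have hd: "h j differentiable at x" for j
      unfolding h_def by (intro differentiable_bounded_bilinear[OF bounded_bilinear_inner] zd M.e_diff)
    have "pd i \<zeta> x \<bullet> e (Inl j) x = 0" if "j \<noteq> k0" for j
    proof -
      have V: "subspace (sphere_normal_space M.X x)" by (rule M.subspace_normal[OF xU])
      define p where "p = (\<Sum>j\<in>- {k0}. (pd i \<zeta> x \<bullet> e (Inl j) x) *\<^sub>R e (Inl j) x)"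
      have "orth_proj (sphere_normal_space M.X x) (pd i \<zeta> x) = p"
      proof (rule orth_projI[OF V])
        show "p \<in> sphere_normal_space M.X x" unfolding p_def by (rule normal_combination(1)[OF xU])
        fix w assume w: "w \<in> sphere_normal_space M.X x"
        have "pd i \<zeta> x \<bullet> w = pd i \<zeta> x \<bullet> (\<Sum>j\<in>- {k0}. (w \<bullet> e (Inl j) x) *\<^sub>R e (Inl j) x)"
          using M.normal_expansion[OF xU w] by simp
        also have "\<dots> = p \<bullet> w"
          by (simp add: p_def inner_sum_left inner_sum_right inner_commute[of w] mult.commute)
        finally have "pd i \<zeta> x \<bullet> w = p \<bullet> w" .
        then show "(pd i \<zeta> x - p) \<bullet> w = 0" by (simp add: inner_diff_left)
      qed
      then have "p = 0"
        using assms(3) x by (simp add: parallel_normal_field_def cov_deriv_def)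
      then have "p \<bullet> e (Inl j) x = 0" by simp
      then show ?thesis
        using that by (simp add: p_def inner_sum_left mult_delta_left mult_delta_right)
    qed
    moreover have "\<zeta> x \<bullet> pd i (e (Inl j)) x = 0" for j
      using M.pd_e_Inl_normal[OF xU zn[OF x]] by (simp add: inner_commute)
    ultimately have ph: "pd i (h j) x = 0" if "j \<noteq> k0" for j
      unfolding h_def using that by (simp add: pd_inner zd)
    have "pd i (push_field U (\<lambda>x. x) P \<zeta>) x = pd i (\<lambda>x. \<Sum>j\<in>- {k0}. h j x *\<^sub>R e' (Inl j) x) x"
      unfolding h_def using push_field_eq[OF assms(2) z] by (intro pd_cong[OF assms(1) x])
    moreover have "orth_proj (sphere_normal_space N.X x) (pd i (\<lambda>x. \<Sum>j\<in>- {k0}. h j x *\<^sub>R e' (Inl j) x) x)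
        = (\<Sum>j\<in>- {k0}. pd i (h j) x *\<^sub>R e' (Inl j) x)"
      using xU hd by (intro orth_proj_pd_parallel_combination N.subspace_normal N.e_Inl_normal
          N.pd_e_Inl_normal N.e_diff) auto
    ultimately show ?thesis
      using ph by (simp add: cov_deriv_def)
  qed
  then show ?thesis
    using push_section[OF assms(1,2) z] by (simp add: parallel_normal_field_def)
qed

text \<open>By linearity \<open>P x v - v\<close> is a multiple of the same \<open>q\<close> as the
  difference of the base points, and \<open>P x\<close> is isometric, so dividing by
  \<open>norm v\<close> gives the unit vectors of the great-circle lemma.\<close>

lemma normal_geodesics_meet:
  assumes "x \<in> U" and v: "v \<in> sphere_normal_space M.X x" "v \<noteq> 0"
  shows "geodesics_meet (M.X x) v (N.X x) (P x v)"
proof -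
  obtain q \<mu> where q: "e' b x = e b x - \<mu> b *\<^sub>R q" for b using reflected by blast
  define r where "r = norm v"
  have r: "r \<noteq> 0" using v by (simp add: r_def)
  define \<nu> where "\<nu> = (\<Sum>j\<in>- {k0}. (v \<bullet> e (Inl j) x) * \<mu> (Inl j))"
  have "P x v = (\<Sum>j\<in>- {k0}. (v \<bullet> e (Inl j) x) *\<^sub>R e (Inl j) x) - \<nu> *\<^sub>R q"
    unfolding P_eq[OF assms(1) v(1)] q \<nu>_def
    by (simp add: scaleR_diff_right sum_subtractf scaleR_sum_left)
  then have "P x v = v - \<nu> *\<^sub>R q"
    unfolding M.normal_expansion[OF assms(1) v(1), symmetric] .
  then have d: "(1 / r) *\<^sub>R P x v = (1 / r) *\<^sub>R v - (\<nu> / r) *\<^sub>R q"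
    by (simp add: scaleR_diff_right)
  have "P x v \<in> sphere_normal_space N.X x"
    using P_bij[OF assms(1)] v(1) by (auto simp: bij_betw_def)
  then have o: "M.X x \<bullet> ((1 / r) *\<^sub>R v) = 0" "N.X x \<bullet> ((1 / r) *\<^sub>R P x v) = 0"
    using v(1) by (simp_all add: sphere_normal_space_def inner_commute)
  have n: "norm ((1 / r) *\<^sub>R v) = 1" "norm ((1 / r) *\<^sub>R P x v) = 1"
    using r P_norm[OF assms(1) v(1)] by (simp_all add: r_def)
  have "geodesics_meet (M.X x) (r *\<^sub>R ((1 / r) *\<^sub>R v)) (N.X x) (r *\<^sub>R ((1 / r) *\<^sub>R P x v))"
    by (rule geodesics_meet_if_parallel_differences[OF M.norm_e N.norm_e n o q d r r])
  then show ?thesis using r by simp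
qed

theorem ribaucour: "ribaucour_transformation U M.X U N.X (\<lambda>x. x) P"
proof -
  have "eigenvector (shape_operator N.X x (P x \<zeta>)) u \<and>
      geodesics_meet (M.X x) (dmap M.X x u) (N.X x) (dmap N.X x u)"
    if x: "x \<in> U" and u: "principal_direction M.X x u" and z: "\<zeta> \<in> sphere_normal_space M.X x" for x u \<zeta>
  proof -
    obtain t i where t: "t \<noteq> 0" "u = t *\<^sub>R axis i 1"
      using M.principal_direction_axis[OF x u] .
    have "P x \<zeta> \<in> sphere_normal_space N.X x"
      using P_bij[OF x] z by (auto simp: bij_betw_def)
    then have "P x \<zeta> \<bullet> e' (Inr i) x = 0" for i using N.sphere_normal_space_iff[OF x] by blast
    then have "eigenvector (shape_operator N.X x (P x \<zeta>)) u"
      unfolding t(2) by (subst N.shape_operator_eq[OF x]) (simp_all add: eigenvector_diagm_axis t(1))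
    moreover obtain q \<mu> where q: "e' b x = e b x - \<mu> b *\<^sub>R q" for b using reflected by blast
    have "geodesics_meet (M.X x) ((t * A1 x $ k0 $ i) *\<^sub>R e (Inr i) x)
        (N.X x) ((t * A1' x $ k0 $ i) *\<^sub>R e' (Inr i) x)"
      by (rule geodesics_meet_if_parallel_differences[OF M.norm_e N.norm_e M.norm_e N.norm_e _ _ q q])
         (simp_all add: t(1) M.A1_nz[OF x] N.A1_nz[OF x])
    moreover have "dmap M.X x u = (t * A1 x $ k0 $ i) *\<^sub>R e (Inr i) x"
      "dmap N.X x u = (t * A1' x $ k0 $ i) *\<^sub>R e' (Inr i) x"
      unfolding t(2) M.dmap_e_Inl N.dmap_e_Inl
      by (simp_all add: axis_def mult_delta_left mult_delta_right scaleR_delta)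
    ultimately show ?thesis by simp
  qed
  \<comment> \<open>The meeting of tangential geodesics was shown above in the presence of some
    normal \<zeta>; the zero vector provides one.\<close>
  moreover have "0 \<in> sphere_normal_space M.X x" if "x \<in> U" for x
    using M.subspace_normal[OF that] by (rule subspace_0)
  ultimately show ?thesis
    unfolding ribaucour_transformation_def sphere_congruence_def
    using normal_bundle_isomorphism push_parallel normal_geodesics_meet by auto
qed

end

end

section \<open>Dressing by a reflection\<close>

text \<open>\<open>(u; i z)\<close> is the normalization of a solution \<open>y\<close> of \<open>\<partial>\<^sub>i y = - \<theta>\<^sup>I\<^sub>\<lambda> y\<close> with \<open>\<lambda> = - i s\<close> and
  \<open>y\<^sup>t y = 0\<close>; \<open>pd_u\<close> and \<open>pd_z\<close> are its equations.\<close>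

locale dressing =
  fixes A1 :: "real^'n::finite \<Rightarrow> real^'n^'m::finite" and F :: "real^'n \<Rightarrow> real^'n^'n"
    and s :: real and u :: "real^'n \<Rightarrow> real^'m" and z :: "real^'n \<Rightarrow> real^'n"
    and \<beta> :: "real^'n \<Rightarrow> 'n \<Rightarrow> real"
  assumes A1_smooth: "smooth_on UNIV A1" and F_smooth: "smooth_on UNIV F"
    and A1_orth: "transpose (A1 x) ** A1 x = mat 1" and F_diag: "F x $ i $ i = 0"
    and s: "s \<noteq> 0"
    and u_smooth: "smooth_on UNIV u" and z_smooth: "smooth_on UNIV z"
    and u_unit: "u x \<bullet> u x = 1" and z_unit: "z x \<bullet> z x = 1"
    and \<beta>_eq: "\<beta> x i = (\<Sum>j\<in>UNIV. A1 x $ j $ i * u x $ j)"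
    and pd_u: "pd i (\<lambda>x. u x $ j) x = s * z x $ i * (A1 x $ j $ i - \<beta> x i * u x $ j)"
    and pd_z: "pd i (\<lambda>x. z x $ k) x = F x $ i $ k * z x $ i - s * \<beta> x i * z x $ i * z x $ k
      + (if i = k then s * \<beta> x i - (\<Sum>k\<in>UNIV. F x $ i $ k * z x $ k) else 0)"
begin

text \<open>As \<beta> consists of the inner products of \<open>u\<close> with the columns of
  \<open>A1\<close>, this is the reflection \<open>(I - 2 u u^t) A1\<close>; in particular the
  columns stay orthonormal.\<close>

definition A1' :: "real^'n \<Rightarrow> real^'n^'m" where
  "A1' x = (\<chi> j i. A1 x $ j $ i - 2 * \<beta> x i * u x $ j)"

definition F' :: "real^'n \<Rightarrow> real^'n^'n" where
  "F' x = (\<chi> i j. if i = j then 0 else F x $ i $ j - 2 * s * \<beta> x i * z x $ j)"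

definition p :: "real \<Rightarrow> 'm + 'n \<Rightarrow> real^'n \<Rightarrow> real" where
  "p l b x = (case b of Inl j \<Rightarrow> l * u x $ j | Inr k \<Rightarrow> s * z x $ k)"

text \<open>\<open>dressed\<close> lists the columns of \<open>E (I - 2 p p\<^sup>t / (l\<^sup>2 + s\<^sup>2))\<close>, and \<open>q = E p\<close>, where \<open>E\<close> has the
  columns \<open>e\<close>.\<close>

definition q :: "real \<Rightarrow> ('m + 'n \<Rightarrow> real^'n \<Rightarrow> real^('m + 'n)) \<Rightarrow> real^'n \<Rightarrow> real^('m + 'n)" where
  "q l e x = (\<Sum>b\<in>UNIV. p l b x *\<^sub>R e b x)"

definition dressed :: "real \<Rightarrow> ('m + 'n \<Rightarrow> real^'n \<Rightarrow> real^('m + 'n)) \<Rightarrow> 'm + 'n \<Rightarrow> real^'n \<Rightarrow> real^('m + 'n)"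
  where "dressed l e b x = e b x - (2 / (l\<^sup>2 + s\<^sup>2) * p l b x) *\<^sub>R q l e x"

lemma u_entry_smooth: "smooth_on UNIV (\<lambda>x. u x $ j)"
  by (intro smooth_on_vec_nth u_smooth open_UNIV)

lemma z_entry_smooth: "smooth_on UNIV (\<lambda>x. z x $ j)"
  by (intro smooth_on_vec_nth z_smooth open_UNIV)

lemma A1_entry_smooth: "smooth_on UNIV (\<lambda>x. A1 x $ j $ i)"
  by (intro smooth_on_vec_nth A1_smooth open_UNIV)

lemma F_entry_smooth: "smooth_on UNIV (\<lambda>x. F x $ j $ i)"
  by (intro smooth_on_vec_nth F_smooth open_UNIV)

lemma \<beta>_smooth: "smooth_on UNIV (\<lambda>x. \<beta> x i)"
  unfolding \<beta>_eq by (intro smooth_intros open_UNIV u_entry_smooth A1_entry_smooth)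

lemma A1'_smooth: "smooth_on UNIV A1'"
  by (intro smooth_on_vec open_UNIV)
     (simp add: A1'_def, intro smooth_intros open_UNIV \<beta>_smooth u_entry_smooth A1_entry_smooth)

lemma F'_smooth: "smooth_on UNIV F'"
proof (intro smooth_on_vec open_UNIV)
  fix i j
  show "smooth_on UNIV (\<lambda>x. F' x $ i $ j)"
    by (cases "i = j") (simp_all add: F'_def, intro smooth_intros open_UNIV \<beta>_smooth z_entry_smooth F_entry_smooth)
qed

lemma p_smooth: "smooth_on UNIV (p l b)"
proof -
  have "p l b = (\<lambda>x. case b of Inl j \<Rightarrow> l * u x $ j | Inr k \<Rightarrow> s * z x $ k)"
    by (simp add: fun_eq_iff p_def)
  then show ?thesis
    by (cases b) (simp_all, (intro smooth_intros open_UNIV u_entry_smooth z_entry_smooth)+)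
qed

lemma A1_columns: "(\<Sum>j\<in>UNIV. A1 x $ j $ i * A1 x $ j $ k) = (if i = k then 1 else 0)"
  by (rule sum_columns_orthogonal[OF A1_orth])

lemma u_sum: "(\<Sum>j\<in>UNIV. u x $ j * u x $ j) = 1"
  using u_unit[of x] by (simp add: inner_vec_def)

lemma z_sum: "(\<Sum>j\<in>UNIV. z x $ j * z x $ j) = 1"
  using z_unit[of x] by (simp add: inner_vec_def)

lemma A1'_orth: "transpose (A1' x) ** A1' x = mat 1"
proof -
  have "(\<Sum>j\<in>UNIV. A1' x $ j $ i * A1' x $ j $ k) = (if i = k then 1 else 0)" for i k
  proof -
    have "(\<Sum>j\<in>UNIV. A1' x $ j $ i * A1' x $ j $ k)
        = (\<Sum>j\<in>UNIV. A1 x $ j $ i * A1 x $ j $ k) - 2 * \<beta> x k * (\<Sum>j\<in>UNIV. A1 x $ j $ i * u x $ j)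
          - 2 * \<beta> x i * (\<Sum>j\<in>UNIV. A1 x $ j $ k * u x $ j)
          + 4 * \<beta> x i * \<beta> x k * (\<Sum>j\<in>UNIV. u x $ j * u x $ j)"
      by (simp add: A1'_def algebra_simps sum.distrib sum_subtractf sum_distrib_left)
    then show ?thesis by (simp add: A1_columns \<beta>_eq[symmetric] u_sum)
  qed
  then show ?thesis
    by (simp add: vec_eq_iff matrix_matrix_mult_def transpose_def mat_def)
qed

section \<open>A frame at a real spectral value and its reflection\<close>

context
  fixes l :: real and e :: "'m + 'n \<Rightarrow> real^'n \<Rightarrow> real^('m + 'n)"
  assumes e: "moving_frame A1 F l e"
begin

lemma e_smooth: "smooth_on UNIV (e b)"
  using e by (simp add: moving_frame_def)

lemma e_diff [simp]: "e b differentiable at x"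
  by (rule smooth_on_differentiable[OF e_smooth UNIV_I])

lemma e_orthonormal: "e a x \<bullet> e b x = (if a = b then 1 else 0)"
  using e unfolding moving_frame_def by blast

lemma p_diff [simp]: "p l b differentiable at x"
  by (rule smooth_on_differentiable[OF p_smooth UNIV_I])

lemma pd_p_Inl: "pd i (p l (Inl j)) x = l * (s * z x $ i * (A1 x $ j $ i - \<beta> x i * u x $ j))"
proof -
  have "p l (Inl j) = (\<lambda>x. l * u x $ j)" by (simp add: fun_eq_iff p_def)
  then show ?thesis
    by (simp add: pd_mult smooth_on_differentiable[OF u_entry_smooth] pd_u)
qed

lemma pd_p_Inr: "pd i (p l (Inr k)) x = s * (F x $ i $ k * z x $ i - s * \<beta> x i * z x $ i * z x $ k
      + (if i = k then s * \<beta> x i - (\<Sum>k\<in>UNIV. F x $ i $ k * z x $ k) else 0))"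
proof -
  have "p l (Inr k) = (\<lambda>x. s * z x $ k)" by (simp add: fun_eq_iff p_def)
  then show ?thesis
    by (simp add: pd_mult smooth_on_differentiable[OF z_entry_smooth] pd_z)
qed

lemma q_smooth: "smooth_on UNIV (q l e)"
  unfolding q_def[abs_def] by (intro smooth_intros open_UNIV e_smooth p_smooth)

lemma dressed_smooth: "smooth_on UNIV (dressed l e b)"
  unfolding dressed_def[abs_def] by (intro smooth_intros open_UNIV e_smooth p_smooth q_smooth)

lemma p_norm: "(\<Sum>b\<in>UNIV. p l b x * p l b x) = l\<^sup>2 + s\<^sup>2"
proof -
  have "(\<Sum>b\<in>UNIV. p l b x * p l b x)
      = l\<^sup>2 * (\<Sum>j\<in>UNIV. u x $ j * u x $ j) + s\<^sup>2 * (\<Sum>j\<in>UNIV. z x $ j * z x $ j)"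
    by (simp add: sum_UNIV_Plus p_def sum_distrib_left power2_eq_square ac_simps)
  then show ?thesis by (simp add: u_sum z_sum)
qed

lemma pos: "l\<^sup>2 + s\<^sup>2 > 0"
  using s by (simp add: add_nonneg_pos)

lemma dressed_orthonormal: "dressed l e a x \<bullet> dressed l e b x = (if a = b then 1 else 0)"
proof -
  have eq: "e b x \<bullet> q l e x = p l b x" "q l e x \<bullet> e b x = p l b x" for b
    by (simp_all add: q_def inner_sum_right inner_sum_left e_orthonormal mult_delta_right)
  have qq: "q l e x \<bullet> q l e x = l\<^sup>2 + s\<^sup>2"
    unfolding p_norm[of x, symmetric] by (subst q_def) (simp add: inner_sum_left eq)
  \<comment> \<open>Through its single relation with \<open>l\<^sup>2 + s\<^sup>2\<close>, the
    constant \<open>c\<close> turns the computation into a polynomial identity.\<close>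
  define c where "c = 2 / (l\<^sup>2 + s\<^sup>2)"
  have c: "c * (l\<^sup>2 + s\<^sup>2) = 2"
    unfolding c_def by (rule iffD1[OF nonzero_eq_divide_eq, OF _ refl]) (use pos in auto)
  have "dressed l e a x \<bullet> dressed l e b x
      = (if a = b then 1 else 0) - 2 * c * p l a x * p l b x + c * p l a x * p l b x * (c * (l\<^sup>2 + s\<^sup>2))"
    unfolding dressed_def c_def[symmetric]
    by (simp add: inner_diff_left inner_diff_right eq qq e_orthonormal algebra_simps)
  then show ?thesis unfolding c by simp
qed

lemma pd_e_Inl: "pd i (e (Inl j)) x = (l * A1 x $ j $ i) *\<^sub>R e (Inr i) x"
  using e unfolding moving_frame_def by simp

lemma pd_e_Inr: "pd i (e (Inr k)) x = F x $ i $ k *\<^sub>R e (Inr i) x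
    - (if i = k then (\<Sum>j\<in>UNIV. (l * A1 x $ j $ i) *\<^sub>R e (Inl j) x)
         + (\<Sum>k\<in>UNIV. F x $ i $ k *\<^sub>R e (Inr k) x) else 0)"
  using e unfolding moving_frame_def by simp

lemma q_eq: "q l e x = l *\<^sub>R (\<Sum>j\<in>UNIV. u x $ j *\<^sub>R e (Inl j) x)
    + s *\<^sub>R (\<Sum>k\<in>UNIV. z x $ k *\<^sub>R e (Inr k) x)"
  by (simp add: q_def sum_UNIV_Plus p_def scaleR_sum_right)

text \<open>The terms with column \<open>i\<close> of \<open>A1\<close> and with row
  \<open>i\<close> of \<open>F\<close> that come from the frame cancel those from
  \<open>pd_u\<close> and \<open>pd_z\<close>. What survives along \<open>e (Inr i)\<close> is an
  \<open>l\<^sup>2\<close> share from the \<open>u\<close> part and an \<open>s\<^sup>2\<close>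
  share from the \<open>z\<close> part; the multiple of \<open>q\<close> is the effect of
  normalizing \<open>u\<close> and \<open>z\<close>.\<close>

lemma pd_q: "pd i (q l e) x = ((l\<^sup>2 + s\<^sup>2) * \<beta> x i) *\<^sub>R e (Inr i) x - (s * \<beta> x i * z x $ i) *\<^sub>R q l e x"
proof -
  let ?a = "\<Sum>j\<in>UNIV. A1 x $ j $ i *\<^sub>R e (Inl j) x"
  let ?f = "\<Sum>k\<in>UNIV. F x $ i $ k *\<^sub>R e (Inr k) x"
  let ?fz = "\<Sum>k\<in>UNIV. F x $ i $ k * z x $ k"
  let ?U = "\<Sum>j\<in>UNIV. u x $ j *\<^sub>R e (Inl j) x"
  let ?V = "\<Sum>k\<in>UNIV. z x $ k *\<^sub>R e (Inr k) x"
  have "pd i (q l e) x = (\<Sum>b\<in>UNIV. p l b x *\<^sub>R pd i (e b) x + pd i (p l b) x *\<^sub>R e b x)"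
    unfolding q_def[abs_def]
    by (simp add: pd_sum differentiable_bounded_bilinear[OF bounded_bilinear_scaleR] pd_scaleR)
  also have "\<dots> = (\<Sum>j\<in>UNIV. p l (Inl j) x *\<^sub>R pd i (e (Inl j)) x) + (\<Sum>j\<in>UNIV. pd i (p l (Inl j)) x *\<^sub>R e (Inl j) x)
     + (\<Sum>k\<in>UNIV. p l (Inr k) x *\<^sub>R pd i (e (Inr k)) x) + (\<Sum>k\<in>UNIV. pd i (p l (Inr k)) x *\<^sub>R e (Inr k) x)"
    by (simp add: sum_UNIV_Plus sum.distrib)
  also have "(\<Sum>j\<in>UNIV. p l (Inl j) x *\<^sub>R pd i (e (Inl j)) x) = (l\<^sup>2 * \<beta> x i) *\<^sub>R e (Inr i) x"
    by (simp add: p_def pd_e_Inl \<beta>_eq scaleR_sum_left[symmetric] sum_distrib_left power2_eq_square ac_simps)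
  also have "(\<Sum>j\<in>UNIV. pd i (p l (Inl j)) x *\<^sub>R e (Inl j) x)
      = (l * s * z x $ i) *\<^sub>R ?a - (l * s * z x $ i * \<beta> x i) *\<^sub>R ?U"
    by (simp add: pd_p_Inl scaleR_sum_right algebra_simps sum_subtractf)
  also have "(\<Sum>k\<in>UNIV. p l (Inr k) x *\<^sub>R pd i (e (Inr k)) x)
      = (s * ?fz) *\<^sub>R e (Inr i) x - (s * z x $ i) *\<^sub>R (l *\<^sub>R ?a + ?f)"
  proof -
    have "(\<Sum>k\<in>UNIV. p l (Inr k) x *\<^sub>R pd i (e (Inr k)) x)
      = (\<Sum>k\<in>UNIV. (s * (F x $ i $ k * z x $ k)) *\<^sub>R e (Inr i) x
          - (if i = k then (s * z x $ k) *\<^sub>R (l *\<^sub>R ?a + ?f) else 0))"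
      by (intro sum.cong refl) (simp add: p_def pd_e_Inr scaleR_diff_right scaleR_sum_right ac_simps)
    then show ?thesis by (simp add: sum_subtractf scaleR_sum_left[symmetric] sum_distrib_left)
  qed
  also have "(\<Sum>k\<in>UNIV. pd i (p l (Inr k)) x *\<^sub>R e (Inr k) x)
      = (s * z x $ i) *\<^sub>R ?f - (s\<^sup>2 * \<beta> x i * z x $ i) *\<^sub>R ?V + (s * (s * \<beta> x i - ?fz)) *\<^sub>R e (Inr i) x"
  proof -
    have "(\<Sum>k\<in>UNIV. pd i (p l (Inr k)) x *\<^sub>R e (Inr k) x)
      = (\<Sum>k\<in>UNIV. (s * z x $ i) *\<^sub>R (F x $ i $ k *\<^sub>R e (Inr k) x)
          - (s\<^sup>2 * \<beta> x i * z x $ i) *\<^sub>R (z x $ k *\<^sub>R e (Inr k) x)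
          + (if i = k then (s * (s * \<beta> x i - ?fz)) *\<^sub>R e (Inr k) x else 0))"
      by (intro sum.cong refl) (simp add: pd_p_Inr algebra_simps power2_eq_square)
    then show ?thesis by (simp add: sum_subtractf sum.distrib scaleR_sum_right)
  qed
  finally show ?thesis
    unfolding q_eq by (simp add: algebra_simps power2_eq_square)
qed

lemma pd_dressed: "pd i (dressed l e b) x = pd i (e b) x - (2 * \<beta> x i * p l b x) *\<^sub>R e (Inr i) x
    + (2 / (l\<^sup>2 + s\<^sup>2) * (s * \<beta> x i * z x $ i * p l b x - pd i (p l b) x)) *\<^sub>R q l e x"
proof -
  define c where "c = 2 / (l\<^sup>2 + s\<^sup>2)"
  have c: "c * (l\<^sup>2 + s\<^sup>2) = 2"
    unfolding c_def by (rule iffD1[OF nonzero_eq_divide_eq, OF _ refl]) (use pos in auto)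
  have qd: "q l e differentiable at x" by (rule smooth_on_differentiable[OF q_smooth UNIV_I])
  have cp: "(\<lambda>x. c * p l b x) differentiable at x" "pd i (\<lambda>x. c * p l b x) x = c * pd i (p l b) x"
    by (simp_all add: differentiable_bounded_bilinear[OF bounded_bilinear_mult] pd_mult)
  have "dressed l e b = (\<lambda>x. e b x - (c * p l b x) *\<^sub>R q l e x)"
    by (simp add: fun_eq_iff dressed_def c_def)
  then have "pd i (dressed l e b) x
      = pd i (e b) x - ((c * p l b x) *\<^sub>R pd i (q l e) x + (c * pd i (p l b) x) *\<^sub>R q l e x)"
    by (simp add: pd_diff pd_scaleR qd cp differentiable_bounded_bilinear[OF bounded_bilinear_scaleR])
  also have "(c * p l b x) *\<^sub>R pd i (q l e) x
      = (c * (l\<^sup>2 + s\<^sup>2) * (\<beta> x i * p l b x)) *\<^sub>R e (Inr i) x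
        - (c * (s * \<beta> x i * z x $ i * p l b x)) *\<^sub>R q l e x"
    unfolding pd_q scaleR_diff_right scaleR_scaleR by (simp add: ac_simps)
  finally show ?thesis unfolding c c_def[symmetric] by (simp add: algebra_simps)
qed

text \<open>By \<open>pd_dressed\<close> the equations for \<open>Inl\<close> and for unequal
  \<open>Inr\<close> indices are direct. Only the equation for \<open>k = i\<close> involves sums
  over the whole dressed frame, which are first written in terms of the old one.\<close>

lemma moving_frame_dressed: "moving_frame A1' F' l (dressed l e)"
proof -
  define c where "c = 2 / (l\<^sup>2 + s\<^sup>2)"
  have c: "c * (l\<^sup>2 + s\<^sup>2) = 2"
    unfolding c_def by (rule iffD1[OF nonzero_eq_divide_eq, OF _ refl]) (use pos in auto)
  have dr: "dressed l e (Inl j) x = e (Inl j) x - (c * (l * u x $ j)) *\<^sub>R q l e x"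
    "dressed l e (Inr k) x = e (Inr k) x - (c * (s * z x $ k)) *\<^sub>R q l e x" for j k x
    by (simp_all add: dressed_def c_def p_def)
  have "pd i (dressed l e (Inl j)) x = (l * A1' x $ j $ i) *\<^sub>R dressed l e (Inr i) x" for i j x
    unfolding pd_dressed dr A1'_def c_def[symmetric] pd_e_Inl pd_p_Inl
    by (simp add: p_def algebra_simps)
  moreover have "pd i (dressed l e (Inr k)) x = F' x $ i $ k *\<^sub>R dressed l e (Inr i) x" if "i \<noteq> k" for i k x
    unfolding pd_dressed dr F'_def c_def[symmetric] pd_e_Inr pd_p_Inr using that
    by (simp add: p_def algebra_simps)
  moreover have "pd i (dressed l e (Inr i)) x = F' x $ i $ i *\<^sub>R dressed l e (Inr i) x
      - ((\<Sum>j\<in>UNIV. (l * A1' x $ j $ i) *\<^sub>R dressed l e (Inl j) x)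
         + (\<Sum>k\<in>UNIV. F' x $ i $ k *\<^sub>R dressed l e (Inr k) x))" for i x
  proof -
    define b where "b = \<beta> x i"
    define zi where "zi = z x $ i"
    define Q where "Q = q l e x"
    define a where "a = (\<Sum>j\<in>UNIV. A1 x $ j $ i *\<^sub>R e (Inl j) x)"
    define f where "f = (\<Sum>k\<in>UNIV. F x $ i $ k *\<^sub>R e (Inr k) x)"
    define fz where "fz = (\<Sum>k\<in>UNIV. F x $ i $ k * z x $ k)"
    define V where "V = (\<Sum>j\<in>UNIV. u x $ j *\<^sub>R e (Inl j) x)"
    define W where "W = (\<Sum>k\<in>UNIV. z x $ k *\<^sub>R e (Inr k) x)"
    have Q: "Q = l *\<^sub>R V + s *\<^sub>R W" by (simp add: Q_def V_def W_def q_eq)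
    have 1: "(\<Sum>j\<in>UNIV. (l * A1' x $ j $ i) *\<^sub>R dressed l e (Inl j) x)
        = l *\<^sub>R a - (2 * l * b) *\<^sub>R V + (c * l\<^sup>2 * b) *\<^sub>R Q"
    proof -
      have "(\<Sum>j\<in>UNIV. (l * A1' x $ j $ i) *\<^sub>R dressed l e (Inl j) x)
        = l *\<^sub>R a - (2 * l * b) *\<^sub>R V - (c * l\<^sup>2 * (\<Sum>j\<in>UNIV. A1 x $ j $ i * u x $ j)) *\<^sub>R Q
          + (2 * c * l\<^sup>2 * b * (\<Sum>j\<in>UNIV. u x $ j * u x $ j)) *\<^sub>R Q"
        by (simp add: A1'_def dr Q_def[symmetric] b_def[symmetric] a_def V_def algebra_simps sum.distrib
            sum_subtractf scaleR_sum_left scaleR_sum_right sum_distrib_left power2_eq_square)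
      also have "\<dots> = l *\<^sub>R a - (2 * l * b) *\<^sub>R V + (c * l\<^sup>2 * b) *\<^sub>R Q"
        unfolding u_sum \<beta>_eq[symmetric] b_def[symmetric] by (simp add: vec_eq_iff algebra_simps)
      finally show ?thesis .
    qed
    have 2: "(\<Sum>k\<in>UNIV. F' x $ i $ k *\<^sub>R dressed l e (Inr k) x)
        = f - (2 * s * b) *\<^sub>R W - (c * s * (fz - 2 * s * b)) *\<^sub>R Q
          + (2 * s * b * zi) *\<^sub>R (e (Inr i) x - (c * (s * zi)) *\<^sub>R Q)"
    proof -
      \<comment> \<open>The formula \<open>F x $ i $ k - 2 * s * b * z x $ k\<close> fails at
        \<open>k = i\<close>, where the entry of \<open>F'\<close> is 0; the conditional term
        restores the difference.\<close>
      have "(\<Sum>k\<in>UNIV. F' x $ i $ k *\<^sub>R dressed l e (Inr k) x)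
        = (\<Sum>k\<in>UNIV. (F x $ i $ k - 2 * s * b * z x $ k) *\<^sub>R dressed l e (Inr k) x
            + (if i = k then (2 * s * b * z x $ k) *\<^sub>R dressed l e (Inr k) x else 0))"
        by (intro sum.cong refl) (simp add: F'_def b_def F_diag)
      also have "\<dots> = (\<Sum>k\<in>UNIV. (F x $ i $ k - 2 * s * b * z x $ k) *\<^sub>R dressed l e (Inr k) x)
          + (2 * s * b * zi) *\<^sub>R (e (Inr i) x - (c * (s * zi)) *\<^sub>R Q)"
        by (simp add: sum.distrib zi_def dr Q_def)
      also have "(\<Sum>k\<in>UNIV. (F x $ i $ k - 2 * s * b * z x $ k) *\<^sub>R dressed l e (Inr k) x)
        = f - (2 * s * b) *\<^sub>R W - (c * s * fz) *\<^sub>R Q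
          + (2 * c * s\<^sup>2 * b * (\<Sum>k\<in>UNIV. z x $ k * z x $ k)) *\<^sub>R Q"
        by (simp add: dr Q_def[symmetric] f_def W_def fz_def algebra_simps sum.distrib
            sum_subtractf scaleR_sum_left scaleR_sum_right sum_distrib_left power2_eq_square)
      finally show ?thesis by (simp add: z_sum algebra_simps power2_eq_square)
    qed
    have "(\<Sum>j\<in>UNIV. (l * A1 x $ j $ i) *\<^sub>R e (Inl j) x) = l *\<^sub>R a"
      by (simp add: a_def scaleR_sum_right)
    then have 3: "pd i (dressed l e (Inr i)) x = - (l *\<^sub>R a + f) - (2 * b * s * zi) *\<^sub>R e (Inr i) x
        + (c * (2 * s\<^sup>2 * b * zi\<^sup>2 - s\<^sup>2 * b + s * fz)) *\<^sub>R Q"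
      unfolding pd_dressed pd_e_Inr pd_p_Inr c_def[symmetric] fz_def[symmetric]
      by (simp add: p_def F_diag f_def[symmetric] b_def[symmetric] zi_def[symmetric]
          Q_def[symmetric] algebra_simps power2_eq_square)
    \<comment> \<open>\<open>V\<close> and \<open>W\<close> occur only in the combination that makes
      up \<open>Q\<close>; eliminating \<open>V\<close> makes the remaining terms comparable
      coefficientwise.\<close>
    have "(2 * l * b) *\<^sub>R V + (2 * s * b) *\<^sub>R W = (2 * b) *\<^sub>R Q"
      by (simp add: Q algebra_simps)
    also have "\<dots> = (c * (l\<^sup>2 + s\<^sup>2) * b) *\<^sub>R Q" by (simp add: c)
    finally have 4: "(2 * l * b) *\<^sub>R V = (c * (l\<^sup>2 + s\<^sup>2) * b) *\<^sub>R Q - (2 * s * b) *\<^sub>R W"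
      by (simp add: eq_diff_eq)
    have "F' x $ i $ i = 0" by (simp add: F'_def)
    then show ?thesis
      unfolding 1 2 3 4 by (simp add: vec_eq_iff algebra_simps power2_eq_square)
  qed
  ultimately show ?thesis
    unfolding moving_frame_def using dressed_smooth dressed_orthonormal by simp
qed

end

end

section \<open>Entries of the Lax connection\<close>

text \<open>The connection is affine in its spectral parameter, so the real entries at 0 and at 1
  determine it for every complex value.\<close>

definition lax_entry :: "(real^'n \<Rightarrow> real^'n^'m) \<Rightarrow> (real^'n \<Rightarrow> real^'n^'n) \<Rightarrow> real \<Rightarrow> 'n \<Rightarrow> real^'n
    \<Rightarrow> 'm + 'n \<Rightarrow> 'm + 'n \<Rightarrow> real" where
  "lax_entry A1 F r i x a b = (case a of
      Inl j \<Rightarrow> (case b of Inl j' \<Rightarrow> 0 | Inr k \<Rightarrow> if i = k then - (r * A1 x $ j $ i) else 0)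
    | Inr k \<Rightarrow> (case b of Inl j \<Rightarrow> if i = k then r * A1 x $ j $ i else 0
        | Inr k' \<Rightarrow> (if i = k then F x $ i $ k' else 0) - (if i = k' then F x $ i $ k else 0)))"

lemma laxI_nth:
  fixes A1 :: "real^'n::finite \<Rightarrow> real^'n^'m::finite"
  shows "laxI A1 F l i x $ a $ b = complex_of_real (lax_entry A1 F 0 i x a b)
    + l * complex_of_real (lax_entry A1 F 1 i x a b - lax_entry A1 F 0 i x a b)"
proof -
  have 1: "(A1 x ** C_mat i) $ j $ k = (if i = k then A1 x $ j $ i else 0)" for j k
    by (auto simp: matrix_matrix_mult_def C_mat_def mult_delta_right)
  have 2: "(C_mat i ** transpose (A1 x)) $ k $ j = (if i = k then A1 x $ j $ i else 0)" for j k
    by (auto simp: matrix_matrix_mult_def C_mat_def transpose_def mult_delta_left)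
  have 3: "(transpose (F x) ** C_mat i) $ k $ k' = (if i = k' then F x $ i $ k else 0)" for k k'
    by (auto simp: matrix_matrix_mult_def C_mat_def transpose_def mult_delta_right)
  have 4: "(C_mat i ** F x) $ k $ k' = (if i = k then F x $ i $ k' else 0)" for k k'
    by (auto simp: matrix_matrix_mult_def C_mat_def mult_delta_left)
  show ?thesis
    by (cases a; cases b) (auto simp: laxI_def Let_def block_def lax_entry_def map_matrix_def 1 2 3 4)
qed

lemma lax_entry_affine:
  "lax_entry A1 F r i x a b
    = lax_entry A1 F 0 i x a b + r * (lax_entry A1 F 1 i x a b - lax_entry A1 F 0 i x a b)"
  by (cases a; cases b) (simp_all add: lax_entry_def)

lemma smooth_lax_entry:
  fixes A1 :: "real^'n::finite \<Rightarrow> real^'n^'m::finite"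
  assumes "smooth_on UNIV A1" "smooth_on UNIV F"
  shows "smooth_on UNIV (\<lambda>x. lax_entry A1 F r i x a b)"
proof -
  have "smooth_on UNIV (\<lambda>x. A1 x $ j $ k)" "smooth_on UNIV (\<lambda>x. F x $ i $ k)" for i j k
    by (intro smooth_on_vec_nth assms open_UNIV)+
  then show ?thesis
    by (cases a; cases b; cases "i = projr a"; cases "i = projr b")
       (simp_all add: lax_entry_def smooth_intros)
qed

lemma moving_frame_pd:
  assumes "moving_frame A1 F r e"
  shows "pd i (e b) x = (\<Sum>a\<in>UNIV. lax_entry A1 F r i x a b *\<^sub>R e a x)"
proof (cases b)
  case (Inl j)
  then show ?thesis
    using assms by (simp add: moving_frame_def lax_entry_def sum_UNIV_Plus scaleR_delta)
next
  case (Inr k)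
  have "(\<Sum>a\<in>UNIV. lax_entry A1 F r i x a (Inr k) *\<^sub>R e a x) = F x $ i $ k *\<^sub>R e (Inr i) x
          - (if i = k then (\<Sum>j\<in>UNIV. (r * A1 x $ j $ i) *\<^sub>R e (Inl j) x)
               + (\<Sum>k\<in>UNIV. F x $ i $ k *\<^sub>R e (Inr k) x) else 0)"
    by (simp add: lax_entry_def sum_UNIV_Plus scaleR_delta scaleR_diff_left sum_subtractf sum_negf)
  then show ?thesis using assms Inr by (simp add: moving_frame_def)
qed

text \<open>The Maurer-Cartan equation: mixed partial derivatives of \<open>e b\<close> commute, and
  their \<open>e a\<close> component is the entry \<open>(a, b)\<close> of the curvature.\<close>

lemma moving_frame_flat:
  fixes A1 :: "real^'n::finite \<Rightarrow> real^'n^'m::finite"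
  assumes mf: "moving_frame A1 F r e" and sm: "smooth_on UNIV A1" "smooth_on UNIV F"
  defines "L \<equiv> lax_entry A1 F r"
  shows "pd i (\<lambda>y. L j y a b) x - pd j (\<lambda>y. L i y a b) x
    + ((\<Sum>c\<in>UNIV. L i x a c * L j x c b) - (\<Sum>c\<in>UNIV. L j x a c * L i x c b)) = 0"
proof -
  have es: "smooth_on UNIV (e b)" for b using mf by (simp add: moving_frame_def)
  have ed: "e b differentiable at x" for b x by (rule smooth_on_differentiable[OF es UNIV_I])
  have Ld: "(\<lambda>y. L i y a b) differentiable at x" for i a b x
    unfolding L_def by (rule smooth_on_differentiable[OF smooth_lax_entry[OF sm] UNIV_I])
  have on: "e c x \<bullet> e a x = (if c = a then 1 else 0)" for c a
    using mf unfolding moving_frame_def by blast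
  have pde: "pd i (e b) = (\<lambda>y. \<Sum>c\<in>UNIV. L i y c b *\<^sub>R e c y)" for i b
    using moving_frame_pd[OF mf] by (simp add: fun_eq_iff L_def)
  have second: "pd i (pd j (e b)) x \<bullet> e a x
      = pd i (\<lambda>y. L j y a b) x + (\<Sum>c\<in>UNIV. L i x a c * L j x c b)" for i j
  proof -
    have "pd i (pd j (e b)) x = (\<Sum>c\<in>UNIV. pd i (\<lambda>y. L j y c b *\<^sub>R e c y) x)"
      unfolding pde[of j] by (intro pd_sum differentiable_bounded_bilinear[OF bounded_bilinear_scaleR] Ld ed)
    also have "\<dots> = (\<Sum>c\<in>UNIV. L j x c b *\<^sub>R pd i (e c) x + pd i (\<lambda>y. L j y c b) x *\<^sub>R e c x)"
      by (intro sum.cong refl pd_scaleR Ld ed)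
    finally have "pd i (pd j (e b)) x \<bullet> e a x
        = (\<Sum>c\<in>UNIV. L j x c b * (pd i (e c) x \<bullet> e a x)) + (\<Sum>c\<in>UNIV. pd i (\<lambda>y. L j y c b) x * (e c x \<bullet> e a x))"
      by (simp add: inner_sum_left inner_add_left sum.distrib)
    moreover have "pd i (e c) x \<bullet> e a x = L i x a c" for c
      by (simp add: pde inner_sum_left on mult_delta_right)
    ultimately show ?thesis by (simp add: on mult_delta_left mult_delta_right mult.commute)
  qed
  have "pd i (pd j (e b)) x \<bullet> e a x = pd j (pd i (e b)) x \<bullet> e a x"
    by (simp add: pd_commute[OF open_UNIV es UNIV_I, of i j])
  then show ?thesis unfolding second by simp
qed

text \<open>The curvature of \<open>\<theta>\<^sup>I\<^sub>\<lambda>\<close> is a quadratic polynomial in \<open>\<lambda>\<close>, so it vanishes identically once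
  it vanishes for three values of \<open>\<lambda>\<close>.\<close>

lemma flat_connection_laxI:
  fixes A1 :: "real^'n::finite \<Rightarrow> real^'n^'m::finite"
  assumes sm: "smooth_on UNIV A1" "smooth_on UNIV F"
    and mf: "\<And>r. \<exists>e. moving_frame A1 F r e"
  shows "flat_connection (laxI A1 F l)"
proof -
  define P where "P = lax_entry A1 F 0"
  define Q where "Q i x a b = lax_entry A1 F 1 i x a b - lax_entry A1 F 0 i x a b" for i x a b
  have Ps: "smooth_on UNIV (\<lambda>x. P i x a b)" for i a b
    unfolding P_def by (rule smooth_lax_entry[OF sm])
  have Qs: "smooth_on UNIV (\<lambda>x. Q i x a b)" for i a b
    unfolding Q_def by (intro smooth_on_diff open_UNIV smooth_lax_entry[OF sm])
  have Pd: "(\<lambda>x. P i x a b) differentiable at x" and Qd: "(\<lambda>x. Q i x a b) differentiable at x" for i a b x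
    using Ps Qs smooth_on_differentiable by blast+
  define g0 where "g0 i j x a b = pd i (\<lambda>y. P j y a b) x - pd j (\<lambda>y. P i y a b) x
    + ((\<Sum>c\<in>UNIV. P i x a c * P j x c b) - (\<Sum>c\<in>UNIV. P j x a c * P i x c b))" for i j x a b
  define g1 where "g1 i j x a b = pd i (\<lambda>y. Q j y a b) x - pd j (\<lambda>y. Q i y a b) x
    + ((\<Sum>c\<in>UNIV. P i x a c * Q j x c b) + (\<Sum>c\<in>UNIV. Q i x a c * P j x c b)
      - (\<Sum>c\<in>UNIV. P j x a c * Q i x c b) - (\<Sum>c\<in>UNIV. Q j x a c * P i x c b))" for i j x a b
  define g2 where "g2 i j x a b
    = (\<Sum>c\<in>UNIV. Q i x a c * Q j x c b) - (\<Sum>c\<in>UNIV. Q j x a c * Q i x c b)" for i j x a b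
  have real: "g0 i j x a b + r * g1 i j x a b + r\<^sup>2 * g2 i j x a b = 0" for r i j x a b
  proof -
    have L: "lax_entry A1 F r i x a b = P i x a b + r * Q i x a b" for i x a b
      unfolding P_def Q_def by (rule lax_entry_affine)
    have "pd i (\<lambda>y. P j y a b + r * Q j y a b) x = pd i (\<lambda>y. P j y a b) x + r * pd i (\<lambda>y. Q j y a b) x" for i j
      by (simp add: pd_add pd_mult Pd Qd differentiable_bounded_bilinear[OF bounded_bilinear_mult])
    moreover obtain e where "moving_frame A1 F r e" using mf by blast
    ultimately show ?thesis
      using moving_frame_flat[of A1 F r e i j a b x] sm unfolding L g0_def g1_def g2_def
      by (simp add: algebra_simps sum.distrib sum_distrib_left power2_eq_square)
  qed
  \<comment> \<open>The value 0 isolates \<open>g0\<close>; the values 1 and -1 then give the sum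
    and difference of \<open>g2\<close> and \<open>g1\<close>.\<close>
  have g: "g0 i j x a b = 0" "g1 i j x a b = 0" "g2 i j x a b = 0" for i j x a b
    using real[of i j x a b 0] real[of i j x a b 1] real[of i j x a b "-1"] by simp_all
  have M: "laxI A1 F l i x $ a $ b = complex_of_real (P i x a b) + l * complex_of_real (Q i x a b)" for i x a b
    unfolding P_def Q_def by (rule laxI_nth)
  have cd: "(\<lambda>x. complex_of_real (f x)) differentiable at x" if "f differentiable at x" for f and x :: "real^'n"
    by (rule differentiable_bounded_linear[OF bounded_linear_of_real that])
  have smooth_entry: "smooth_on UNIV (\<lambda>x. laxI A1 F l i x $ a $ b)" for i a b
    unfolding M
    by (intro smooth_on_add smooth_on_mult smooth_on_const open_UNIV Ps Qs
        smooth_on_bounded_linear[OF open_UNIV bounded_linear_of_real])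
  have row_smooth: "smooth_on UNIV (\<lambda>x. laxI A1 F l i x $ a)" for i a
    by (rule smooth_on_vec[OF open_UNIV smooth_entry])
  have smooth: "smooth_on UNIV (laxI A1 F l i)" for i
    by (rule smooth_on_vec[OF open_UNIV row_smooth])
  have pdM: "pd i (laxI A1 F l j) x $ a $ b
      = complex_of_real (pd i (\<lambda>y. P j y a b) x) + l * complex_of_real (pd i (\<lambda>y. Q j y a b) x)" for i j x a b
  proof -
    have "pd i (laxI A1 F l j) x $ a $ b = pd i (\<lambda>x. laxI A1 F l j x $ a $ b) x"
      by (simp add: pd_vec_nth smooth_on_differentiable[OF smooth] smooth_on_differentiable[OF row_smooth])
    also have "\<dots> = pd i (\<lambda>y. complex_of_real (P j y a b)) x + l * pd i (\<lambda>y. complex_of_real (Q j y a b)) x"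
      unfolding M
      by (simp add: pd_add pd_mult cd Pd Qd differentiable_bounded_bilinear[OF bounded_bilinear_mult])
    finally show ?thesis by (simp add: pd_bounded_linear[OF bounded_linear_of_real] Pd Qd)
  qed
  have "(pd i (laxI A1 F l j) x - pd j (laxI A1 F l i) x
      + (laxI A1 F l i x ** laxI A1 F l j x - laxI A1 F l j x ** laxI A1 F l i x)) $ a $ b
    = complex_of_real (g0 i j x a b) + l * complex_of_real (g1 i j x a b)
      + l\<^sup>2 * complex_of_real (g2 i j x a b)" for i j x a b
    unfolding g0_def g1_def g2_def
    by (simp add: matrix_matrix_mult_def pdM M algebra_simps sum.distrib sum_distrib_left power2_eq_square)
  then show ?thesis
    unfolding flat_connection_def by (simp add: vec_eq_iff g)
qed

section \<open>Frames of the \<open>G\<^sub>m\<^sub>,\<^sub>n\<close>-system I\<close>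

definition real_col :: "(real^'n \<Rightarrow> complex \<Rightarrow> complex^'a^'a) \<Rightarrow> real \<Rightarrow> 'a \<Rightarrow> real^'n \<Rightarrow> real^'a" where
  "real_col E r b x = (\<chi> a. Re (E x (complex_of_real r) $ a $ b))"

lemma real_column_eq: "real_column E b = real_col E 1 b"
  by (simp add: fun_eq_iff real_column_def real_col_def)

lemma matrix_inv_invertible:
  fixes A :: "'a::semiring_1^'n^'n"
  assumes "invertible A"
  shows "A ** matrix_inv A = mat 1"
proof -
  obtain B where "A ** B = mat 1" "B ** A = mat 1" using assms by (auto simp: invertible_def)
  then show ?thesis using matrix_inv_eqI by metis
qed

lemma I_mn_nth:
  "(I_mn :: complex^('m::finite + 'n::finite)^('m + 'n)) $ a $ b
    = (if a = b then (if isl a then 1 else - 1) else 0)"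
  by (cases a; cases b) (auto simp: I_mn_def block_def mat_def)

lemma matrix_inv_I_mn: "matrix_inv (I_mn :: complex^('m::finite + 'n::finite)^('m + 'n)) = I_mn"
proof -
  have "(I_mn :: complex^('m::finite + 'n::finite)^('m + 'n)) ** I_mn = mat 1"
    by (simp add: vec_eq_iff matrix_matrix_mult_def I_mn_nth mat_def mult_delta_left)
  then show ?thesis by (intro matrix_inv_eqI)
qed

lemma I_mn_conjugate:
  fixes E :: "complex^('m::finite + 'n::finite)^('m + 'n)"
  shows "(I_mn ** E ** I_mn) $ a $ b = (if isl a = isl b then E $ a $ b else - E $ a $ b)"
  by (auto simp: matrix_matrix_mult_def I_mn_nth mult_delta_left mult_delta_right)

locale systemI_frame =
  fixes A1 :: "real^'n::finite \<Rightarrow> real^'n^'m::finite" and F :: "real^'n \<Rightarrow> real^'n^'n"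
    and EI :: "real^'n \<Rightarrow> complex \<Rightarrow> complex^('m + 'n)^('m + 'n)"
  assumes solution: "gsystemI_solution A1 F" and frame: "gsystemI_frame A1 F EI"
begin

lemma reality: "reality_condition EI"
  using frame by (simp add: gsystemI_frame_def)

lemma EI_smooth: "smooth_on UNIV (\<lambda>x. EI x l)"
  using frame by (simp add: gsystemI_frame_def trivialization_def)

lemma EI_row_smooth: "smooth_on UNIV (\<lambda>x. EI x l $ a)"
  by (intro smooth_on_vec_nth open_UNIV EI_smooth)

lemma EI_entry_smooth: "smooth_on UNIV (\<lambda>x. EI x l $ a $ b)"
  by (intro smooth_on_vec_nth open_UNIV EI_smooth)

lemma EI_entry_diff: "(\<lambda>x. EI x l $ a $ b) differentiable at x"
  by (rule smooth_on_differentiable[OF EI_entry_smooth UNIV_I])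

lemma EI_orth: "EI x l ** transpose (EI x l) = mat 1"
  using reality by (simp add: reality_condition_def)

lemma EI_columns: "(\<Sum>a\<in>UNIV. EI x l $ a $ b * EI x l $ a $ c) = (if b = c then 1 else 0)"
proof -
  have "transpose (EI x l) ** EI x l = mat 1" using EI_orth by (simp add: matrix_left_right_inverse)
  then show ?thesis by (rule sum_columns_orthogonal)
qed

lemma EI_rows: "(\<Sum>b\<in>UNIV. EI x l $ a $ b * EI x l $ c $ b) = (if a = c then 1 else 0)"
  using arg_cong[OF EI_orth[of x l], of "\<lambda>M. M $ a $ c"]
  by (simp add: matrix_matrix_mult_def transpose_def mat_def)

lemma EI_cnj: "cnj (EI x (cnj l) $ a $ b) = EI x l $ a $ b"
  using reality by (simp add: reality_condition_def map_matrix_def vec_eq_iff)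

lemma EI_minus: "EI x (- l) $ a $ b = (if isl a = isl b then EI x l $ a $ b else - EI x l $ a $ b)"
proof -
  have "EI x (- l) = I_mn ** EI x l ** I_mn"
    using reality by (simp add: reality_condition_def matrix_inv_I_mn)
  then show ?thesis by (simp only: I_mn_conjugate)
qed

lemma EI_real: "Im (EI x (complex_of_real r) $ a $ b) = 0"
  using arg_cong[OF EI_cnj[of x "complex_of_real r" a b], of Im] by simp

lemma pd_EI: "pd i (\<lambda>x. EI x l $ a $ b) x = (\<Sum>c\<in>UNIV. EI x l $ a $ c * laxI A1 F l i x $ c $ b)"
proof -
  have "pd i (\<lambda>x. EI x l $ a $ b) x = pd i (\<lambda>x. EI x l) x $ a $ b"
    by (simp add: pd_vec_nth smooth_on_differentiable[OF EI_smooth] smooth_on_differentiable[OF EI_row_smooth])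
  also have "pd i (\<lambda>x. EI x l) x = EI x l ** laxI A1 F l i x"
  proof -
    have "invertible (EI x l)" "matrix_inv (EI x l) ** pd i (\<lambda>y. EI y l) x = laxI A1 F l i x"
      using frame by (simp_all add: gsystemI_frame_def trivialization_def)
    then show ?thesis by (metis matrix_inv_invertible matrix_mul_assoc matrix_mul_lid)
  qed
  finally show ?thesis by (simp add: matrix_matrix_mult_def)
qed

lemma pd_EI_Inl: "pd i (\<lambda>x. EI x l $ a $ Inl j) x = l * complex_of_real (A1 x $ j $ i) * EI x l $ a $ Inr i"
  by (simp add: pd_EI laxI_nth lax_entry_def sum_UNIV_Plus mult_delta_right if_distrib[of complex_of_real]
      mult.commute cong: if_cong)

lemma pd_EI_Inr: "pd i (\<lambda>x. EI x l $ a $ Inr k) x = complex_of_real (F x $ i $ k) * EI x l $ a $ Inr i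
    - (if i = k then (\<Sum>j\<in>UNIV. l * complex_of_real (A1 x $ j $ i) * EI x l $ a $ Inl j)
        + (\<Sum>k\<in>UNIV. complex_of_real (F x $ i $ k) * EI x l $ a $ Inr k) else 0)"
  by (simp add: pd_EI laxI_nth lax_entry_def sum_UNIV_Plus mult_delta_right if_distrib[of complex_of_real]
      algebra_simps sum.distrib sum_subtractf sum_negf cong: if_cong)

text \<open>At a real spectral value the first reality condition makes every entry real, so taking
  real parts loses nothing and complex orthogonality becomes orthonormality of the columns.\<close>

lemma moving_frame_real_col: "moving_frame A1 F r (real_col EI r)"
proof -
  have smooth: "smooth_on UNIV (real_col EI r b)" for b
    by (rule smooth_on_vec[OF open_UNIV])
       (simp add: real_col_def smooth_on_bounded_linear[OF open_UNIV bounded_linear_Re EI_entry_smooth])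
  have comp: "pd i (real_col EI r b) x $ a = Re (pd i (\<lambda>x. EI x (complex_of_real r) $ a $ b) x)" for i a b x
  proof -
    have "pd i (real_col EI r b) x $ a = pd i (\<lambda>x. real_col EI r b x $ a) x"
      by (simp add: pd_vec_nth smooth_on_differentiable[OF smooth])
    then show ?thesis
      by (simp add: real_col_def pd_bounded_linear[OF bounded_linear_Re] EI_entry_diff)
  qed
  have "real_col EI r a x \<bullet> real_col EI r b x = (if a = b then 1 else 0)" for a b x
  proof -
    have "real_col EI r a x \<bullet> real_col EI r b x
        = Re (\<Sum>c\<in>UNIV. EI x (complex_of_real r) $ c $ a * EI x (complex_of_real r) $ c $ b)"
      by (simp add: real_col_def inner_vec_def EI_real)
    then show ?thesis unfolding EI_columns by simp
  qed
  moreover have "pd i (real_col EI r (Inl j)) x = (r * A1 x $ j $ i) *\<^sub>R real_col EI r (Inr i) x" for i j x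
    by (simp add: vec_eq_iff comp pd_EI_Inl) (simp add: real_col_def)
  moreover have "pd i (real_col EI r (Inr k)) x = F x $ i $ k *\<^sub>R real_col EI r (Inr i) x
          - (if i = k then (\<Sum>j\<in>UNIV. (r * A1 x $ j $ i) *\<^sub>R real_col EI r (Inl j) x)
               + (\<Sum>k\<in>UNIV. F x $ i $ k *\<^sub>R real_col EI r (Inr k) x) else 0)" for i k x
    by (simp add: vec_eq_iff comp pd_EI_Inr) (simp add: real_col_def)
  ultimately show ?thesis unfolding moving_frame_def using smooth by simp
qed

end

section \<open>The action of \<open>g\<^sub>s\<^sub>,\<^sub>\<pi>\<close>\<close>

locale systemI_dressing = systemI_frame A1 F EI
  for A1 :: "real^'n::finite \<Rightarrow> real^'n^'m::finite" and F :: "real^'n \<Rightarrow> real^'n^'n"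
    and EI :: "real^'n \<Rightarrow> complex \<Rightarrow> complex^('m + 'n)^('m + 'n)" +
  fixes s :: real and W :: "real^'m" and Z :: "real^'n"
  assumes s: "s \<noteq> 0" and W: "norm W = 1" and Z: "norm Z = 1"
begin

definition V :: "complex^('m + 'n)" where
  "V = join (\<chi> j. complex_of_real (W $ j)) (\<chi> i. \<i> * complex_of_real (Z $ i))"

text \<open>\<open>EI(x, - i s)\<^sup>-\<^sup>1 (W; i Z)\<close>, since \<open>EI\<close> is complex orthogonal\<close>

definition y :: "'m + 'n \<Rightarrow> real^'n \<Rightarrow> complex" where
  "y b x = (\<Sum>a\<in>UNIV. EI x (- \<i> * complex_of_real s) $ a $ b * V $ a)"

definition ut :: "real^'n \<Rightarrow> real^'m" where "ut x = (\<chi> j. Re (y (Inl j) x))"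
definition zt :: "real^'n \<Rightarrow> real^'n" where "zt x = (\<chi> k. Im (y (Inr k) x))"
text \<open>One factor normalizes both \<open>ut\<close> and \<open>zt\<close>, whose norms agree by
  \<open>ut_zt\<close>.\<close>

definition N :: "real^'n \<Rightarrow> real" where "N x = sqrt (ut x \<bullet> ut x)"
definition u :: "real^'n \<Rightarrow> real^'m" where "u x = ut x /\<^sub>R N x"
definition z :: "real^'n \<Rightarrow> real^'n" where "z x = zt x /\<^sub>R N x"
definition \<beta> :: "real^'n \<Rightarrow> 'n \<Rightarrow> real" where "\<beta> x i = (\<Sum>j\<in>UNIV. A1 x $ j $ i * u x $ j)"

text \<open>The conjugate of \<open>- \<i> s\<close> is its negative, so conjugating the matrix
  equals conjugating it by \<open>I_mn\<close>: diagonal blocks are real, the other two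
  imaginary.\<close>

lemma EI_imaginary:
  fixes x :: "real^'n"
  defines "E \<equiv> EI x (- \<i> * complex_of_real s)"
  shows "isl a = isl b \<Longrightarrow> Im (E $ a $ b) = 0" "isl a \<noteq> isl b \<Longrightarrow> Re (E $ a $ b) = 0"
proof -
  have "cnj (E $ a $ b) = EI x (- (- \<i> * complex_of_real s)) $ a $ b"
    using EI_cnj[of x "- (- \<i> * complex_of_real s)" a b] by (simp add: E_def)
  then have "cnj (E $ a $ b) = (if isl a = isl b then E $ a $ b else - E $ a $ b)"
    unfolding EI_minus E_def .
  then show "isl a = isl b \<Longrightarrow> Im (E $ a $ b) = 0" "isl a \<noteq> isl b \<Longrightarrow> Re (E $ a $ b) = 0"
    by (auto simp: complex_eq_iff)
qed

lemma y_Inl: "y (Inl j) x = complex_of_real (ut x $ j)"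
proof -
  have "Im (y (Inl j) x) = 0"
    by (simp add: y_def V_def join_def sum_UNIV_Plus EI_imaginary[simplified])
  then show ?thesis by (simp add: ut_def complex_eq_iff)
qed

lemma y_Inr: "y (Inr k) x = \<i> * complex_of_real (zt x $ k)"
proof -
  have "Re (y (Inr k) x) = 0"
    by (simp add: y_def V_def join_def sum_UNIV_Plus EI_imaginary[simplified])
  then show ?thesis by (simp add: zt_def complex_eq_iff)
qed

lemma pd_y: "pd i (y b) x
    = (\<Sum>a\<in>UNIV. pd i (\<lambda>x. EI x (- \<i> * complex_of_real s) $ a $ b) x * V $ a)"
  unfolding y_def[abs_def]
  by (simp add: pd_sum pd_mult EI_entry_diff differentiable_bounded_bilinear[OF bounded_bilinear_mult])

lemma y_smooth: "smooth_on UNIV (y b)"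
  unfolding y_def[abs_def] by (intro smooth_intros open_UNIV EI_entry_smooth)

lemma y_diff: "y b differentiable at x"
  by (rule smooth_on_differentiable[OF y_smooth UNIV_I])

text \<open>Since \<open>y\<close> is the transpose of \<open>EI\<close> applied to
  \<open>V\<close>, its derivative is the transposed connection applied to \<open>y\<close>; the
  connection is skew-symmetric.\<close>

lemma pd_y_Inl: "pd i (y (Inl j)) x = - \<i> * complex_of_real (s * A1 x $ j $ i) * y (Inr i) x"
  unfolding pd_y pd_EI_Inl by (simp add: y_def sum_distrib_left mult.assoc)

lemma pd_y_Inr: "pd i (y (Inr k)) x = complex_of_real (F x $ i $ k) * y (Inr i) x
    - (if i = k then (\<Sum>j\<in>UNIV. - \<i> * complex_of_real (s * A1 x $ j $ i) * y (Inl j) x)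
        + (\<Sum>k\<in>UNIV. complex_of_real (F x $ i $ k) * y (Inr k) x) else 0)"
proof (cases "i = k")
  case False
  then show ?thesis
    unfolding pd_y pd_EI_Inr by (simp add: y_def sum_distrib_left mult.assoc)
next
  case True
  let ?E = "EI x (- \<i> * complex_of_real s)"
  have 1: "(\<Sum>j\<in>UNIV. - \<i> * complex_of_real (s * A1 x $ j $ i) * y (Inl j) x)
     = (\<Sum>a\<in>UNIV. (\<Sum>j\<in>UNIV. - \<i> * complex_of_real s * complex_of_real (A1 x $ j $ i) * ?E $ a $ Inl j) * V $ a)"
    unfolding y_def sum_distrib_left sum_distrib_right
    by (subst sum.swap) (simp add: mult.assoc)
  have 2: "(\<Sum>k\<in>UNIV. complex_of_real (F x $ i $ k) * y (Inr k) x)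
     = (\<Sum>a\<in>UNIV. (\<Sum>k\<in>UNIV. complex_of_real (F x $ i $ k) * ?E $ a $ Inr k) * V $ a)"
    unfolding y_def sum_distrib_left sum_distrib_right
    by (subst sum.swap) (simp add: mult.assoc)
  have 3: "complex_of_real (F x $ i $ k) * y (Inr i) x
     = (\<Sum>a\<in>UNIV. complex_of_real (F x $ i $ k) * ?E $ a $ Inr i * V $ a)"
    unfolding y_def sum_distrib_left by (simp add: mult.assoc)
  show ?thesis
    unfolding pd_y pd_EI_Inr if_P[OF True] 1 2 3
    by (simp only: ring_distribs sum.distrib sum_subtractf)
qed

lemma ut_nth: "(\<lambda>x. ut x $ j) = (\<lambda>x. Re (y (Inl j) x))" and zt_nth: "(\<lambda>x. zt x $ k) = (\<lambda>x. Im (y (Inr k) x))"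
  by (simp_all add: ut_def zt_def fun_eq_iff)

lemma ut_entry_smooth: "smooth_on UNIV (\<lambda>x. ut x $ j)"
  unfolding ut_nth by (intro smooth_on_bounded_linear[OF open_UNIV bounded_linear_Re] y_smooth)

lemma zt_entry_smooth: "smooth_on UNIV (\<lambda>x. zt x $ k)"
  unfolding zt_nth by (intro smooth_on_bounded_linear[OF open_UNIV bounded_linear_Im] y_smooth)

lemma pd_ut: "pd i (\<lambda>x. ut x $ j) x = s * A1 x $ j $ i * zt x $ i"
  unfolding ut_nth pd_bounded_linear[OF bounded_linear_Re y_diff] pd_y_Inl y_Inr by simp

lemma pd_zt: "pd i (\<lambda>x. zt x $ k) x = F x $ i $ k * zt x $ i
    + (if i = k then s * (\<Sum>j\<in>UNIV. A1 x $ j $ i * ut x $ j) - (\<Sum>k\<in>UNIV. F x $ i $ k * zt x $ k) else 0)"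
  unfolding zt_nth pd_bounded_linear[OF bounded_linear_Im y_diff] pd_y_Inr
  unfolding y_Inr y_Inl by (simp add: sum_distrib_left mult.assoc sum_negf)

lemma i_mult_i: "\<i> * a * (\<i> * b) = - (a * b)"
  by (simp add: ac_simps)

text \<open>The complex bilinear form of \<open>(W; i Z)\<close> vanishes and is preserved by \<open>EI\<close>.\<close>

lemma y_null: "(\<Sum>b\<in>UNIV. y b x * y b x) = 0"
proof -
  let ?E = "EI x (- \<i> * complex_of_real s)"
  have "(\<Sum>b\<in>UNIV. y b x * y b x)
      = (\<Sum>b\<in>UNIV. \<Sum>a\<in>UNIV. \<Sum>c\<in>UNIV. (?E $ a $ b * ?E $ c $ b) * (V $ a * V $ c))"
    by (simp add: y_def sum_product ac_simps)
  also have "\<dots> = (\<Sum>a\<in>UNIV. \<Sum>c\<in>UNIV. \<Sum>b\<in>UNIV. (?E $ a $ b * ?E $ c $ b) * (V $ a * V $ c))"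
    by (subst sum.swap, rule sum.cong[OF refl], rule sum.swap)
  also have "\<dots> = (\<Sum>a\<in>UNIV. V $ a * V $ a)"
    by (simp add: sum_distrib_right[symmetric] EI_rows mult_delta_left)
  also have "\<dots> = complex_of_real (W \<bullet> W - Z \<bullet> Z)"
    by (simp add: V_def join_def sum_UNIV_Plus inner_vec_def sum_negf i_mult_i)
  finally show ?thesis using W Z by (simp add: dot_square_norm)
qed

lemma ut_zt: "ut x \<bullet> ut x = zt x \<bullet> zt x"
proof -
  have "complex_of_real (ut x \<bullet> ut x - zt x \<bullet> zt x) = 0"
    using y_null[of x] by (simp add: sum_UNIV_Plus y_Inl y_Inr inner_vec_def sum_negf i_mult_i)
  then show ?thesis by (simp only: of_real_eq_0_iff right_minus_eq)
qed

text \<open>Multiplying by \<open>EI\<close> recovers \<open>V\<close> from \<open>y\<close>, and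
  the upper part \<open>W\<close> of \<open>V\<close> is nonzero.\<close>

lemma y_nonzero: "\<exists>b. y b x \<noteq> 0"
proof (rule ccontr)
  let ?E = "EI x (- \<i> * complex_of_real s)"
  assume "\<nexists>b. y b x \<noteq> 0"
  then have "0 = (\<Sum>b\<in>UNIV. ?E $ a $ b * y b x)" for a by simp
  also have "(\<Sum>b\<in>UNIV. ?E $ a $ b * y b x) = V $ a" for a
  proof -
    have "(\<Sum>b\<in>UNIV. ?E $ a $ b * y b x) = (\<Sum>c\<in>UNIV. (\<Sum>b\<in>UNIV. ?E $ a $ b * ?E $ c $ b) * V $ c)"
      unfolding y_def sum_distrib_left sum_distrib_right by (subst sum.swap) (simp add: mult.assoc)
    then show ?thesis by (simp add: EI_rows mult_delta_left)
  qed
  finally have "V $ Inl j = 0" for j by simp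
  then have "W = 0" by (simp add: V_def join_def vec_eq_iff)
  then show False using W by simp
qed

lemma ut_pos: "ut x \<bullet> ut x > 0"
proof (rule ccontr)
  assume "\<not> ut x \<bullet> ut x > 0"
  then have "ut x = 0" "zt x = 0" using ut_zt[of x] by (simp_all add: inner_gt_zero_iff)
  then have "y b x = 0" for b by (cases b) (simp_all add: y_Inl y_Inr)
  then show False using y_nonzero[of x] by blast
qed

lemma N_pos: "N x > 0" using ut_pos[of x] by (simp add: N_def)

lemma N_square: "N x * N x = ut x \<bullet> ut x" using ut_pos[of x] by (simp add: N_def)

lemma ut_smooth: "smooth_on UNIV ut"
  by (rule smooth_on_vec[OF open_UNIV ut_entry_smooth])

lemma N_smooth: "smooth_on UNIV N"
  unfolding N_def[abs_def] by (intro smooth_on_sqrt smooth_on_inner open_UNIV ut_smooth ut_pos)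

lemma N_diff: "N differentiable at x" by (rule smooth_on_differentiable[OF N_smooth UNIV_I])

lemma u_nth: "u x $ j = ut x $ j / N x" and z_nth: "z x $ k = zt x $ k / N x"
  by (simp_all add: u_def z_def divide_inverse mult.commute)

text \<open>Obtained by differentiating \<open>N x * N x = ut x \<bullet> ut x\<close>. The
  \<open>F\<close> terms of \<open>zt\<close> never appear, because only \<open>ut\<close> is
  differentiated.\<close>

lemma pd_N: "pd i N x = s * N x * \<beta> x i * z x $ i"
proof -
  have N2: "(\<lambda>x. N x * N x) = (\<lambda>x. \<Sum>j\<in>UNIV. ut x $ j * ut x $ j)"
    by (simp add: fun_eq_iff N_square inner_vec_def)
  have "2 * N x * pd i N x = pd i (\<lambda>x. N x * N x) x"
    by (simp add: pd_mult N_diff)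
  also have "\<dots> = (\<Sum>j\<in>UNIV. 2 * (ut x $ j * pd i (\<lambda>x. ut x $ j) x))"
    unfolding N2 using smooth_on_differentiable[OF ut_entry_smooth]
    by (simp add: pd_sum pd_mult differentiable_bounded_bilinear[OF bounded_bilinear_mult])
  also have "\<dots> = 2 * (s * N x * (\<Sum>j\<in>UNIV. A1 x $ j $ i * u x $ j)) * zt x $ i"
    using N_pos[of x] by (simp add: pd_ut u_nth sum_distrib_left sum_distrib_right ac_simps)
  also have "\<dots> = 2 * N x * (s * N x * \<beta> x i * z x $ i)"
    using N_pos[of x] by (simp add: \<beta>_def z_nth)
  finally show ?thesis using N_pos[of x] by simp
qed

lemma pd_quotient_N:
  assumes "f differentiable at x"
  shows "pd i (\<lambda>x. f x / N x) x = pd i f x / N x - f x / N x * (s * \<beta> x i * z x $ i)"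
proof -
  have d: "(\<lambda>x. f x / N x) differentiable at x"
    by (intro differentiable_divide assms N_diff) (use N_pos[of x] in simp)
  have "pd i f x = pd i (\<lambda>x. f x / N x * N x) x"
  proof -
    have "N x \<noteq> 0" for x using N_pos[of x] by simp
    then show ?thesis by simp
  qed
  also have "\<dots> = f x / N x * pd i N x + pd i (\<lambda>x. f x / N x) x * N x"
    by (rule pd_mult[OF d N_diff])
  finally have "pd i (\<lambda>x. f x / N x) x * N x = pd i f x - f x / N x * pd i N x" by simp
  then show ?thesis using N_pos[of x] by (simp add: pd_N field_simps)
qed

text \<open>The terms quadratic in \<open>u\<close> and \<open>z\<close> in the equations of
  \<open>dressing\<close> arise from dividing the linear equations \<open>pd_ut\<close> and
  \<open>pd_zt\<close> by \<open>N\<close>.\<close>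

sublocale D: dressing A1 F s u z \<beta>
proof
  fix x :: "real^'n" and i k :: 'n and j :: 'm
  show "smooth_on UNIV A1" "smooth_on UNIV F" "transpose (A1 x) ** A1 x = mat 1" "F x $ i $ i = 0"
    using solution by (auto simp: gsystemI_solution_def)
  show "s \<noteq> 0" by (rule s)
  show "\<beta> x i = (\<Sum>j\<in>UNIV. A1 x $ j $ i * u x $ j)" by (simp add: \<beta>_def)
  have N0: "N x \<noteq> 0" for x using N_pos[of x] by simp
  show "smooth_on UNIV u"
    by (rule smooth_on_vec[OF open_UNIV])
       (simp add: u_nth, intro smooth_on_divide open_UNIV ut_entry_smooth N_smooth N0)
  show "smooth_on UNIV z"
    by (rule smooth_on_vec[OF open_UNIV])
       (simp add: z_nth, intro smooth_on_divide open_UNIV zt_entry_smooth N_smooth N0)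
  have "u x \<bullet> u x = (ut x \<bullet> ut x) / (N x * N x)" "z x \<bullet> z x = (ut x \<bullet> ut x) / (N x * N x)"
    unfolding ut_zt by (simp_all add: u_def z_def divide_inverse ac_simps ut_zt)
  then show "u x \<bullet> u x = 1" "z x \<bullet> z x = 1"
    unfolding N_square[symmetric] using N0[of x] by simp_all
  have ud: "(\<lambda>x. ut x $ j) differentiable at x" and zd: "(\<lambda>x. zt x $ k) differentiable at x"
    using smooth_on_differentiable[OF ut_entry_smooth] smooth_on_differentiable[OF zt_entry_smooth] by blast+
  show "pd i (\<lambda>x. u x $ j) x = s * z x $ i * (A1 x $ j $ i - \<beta> x i * u x $ j)"
    unfolding u_nth pd_quotient_N[OF ud] pd_ut by (simp add: z_nth algebra_simps)
  have "(\<Sum>j\<in>UNIV. A1 x $ j $ i * ut x $ j) / N x = \<beta> x i"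
    by (simp add: \<beta>_def u_nth sum_divide_distrib)
  then have "s * (\<Sum>j\<in>UNIV. A1 x $ j $ i * ut x $ j) / N x = s * \<beta> x i"
    by (metis times_divide_eq_right)
  moreover have "(\<Sum>k\<in>UNIV. F x $ i $ k * zt x $ k) / N x = (\<Sum>k\<in>UNIV. F x $ i $ k * z x $ k)"
    by (simp add: z_nth sum_divide_distrib)
  ultimately show "pd i (\<lambda>x. z x $ k) x = F x $ i $ k * z x $ i - s * \<beta> x i * z x $ i * z x $ k
      + (if i = k then s * \<beta> x i - (\<Sum>k\<in>UNIV. F x $ i $ k * z x $ k) else 0)"
    unfolding z_nth[of _ k] pd_quotient_N[OF zd] pd_zt
    by (auto simp: z_nth[of x i] add_divide_distrib diff_divide_distrib algebra_simps)
qed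

lemma moving_frame_dressed: "moving_frame D.A1' D.F' r (D.dressed r (real_col EI r))"
  by (rule D.moving_frame_dressed[OF moving_frame_real_col])

lemma dressed_solution: "gsystemI_solution D.A1' D.F'"
proof -
  have "flat_connection (laxI D.A1' D.F' l)" for l
    using moving_frame_dressed by (intro flat_connection_laxI D.A1'_smooth D.F'_smooth) blast
  then show ?thesis
    unfolding gsystemI_solution_def using D.A1'_smooth D.F'_smooth D.A1'_orth by (simp add: D.F'_def)
qed

text \<open>Only the first \<open>n\<close> columns of the lift \<open>A\<close>, namely \<open>A1\<close>, enter the new solution, because
  \<open>A W_hat = u\<close> does not depend on \<open>A\<close>.\<close>

lemma g_action_eq:
  assumes lift: "gsystem_lift emb A1 F EI A \<xi>"
    and act: "(B, G, EI') = g_action emb s W Z A F EI"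
  shows "B = D.A1'" "G = D.F'" "real_col EI' r = D.dressed r (real_col EI r)"
proof -
  let ?E = "gauge EI A" and ?l = "- \<i> * complex_of_real s"
  have orth: "orthogonal_matrix (A x)" and emb: "A x $ j $ emb i = A1 x $ j $ i" for x j i
    using lift by (auto simp: gsystem_lift_def)
  have "reality_condition ?E" using lift by (simp add: gsystem_lift_def gsystem_frame_def)
  then have "?E x l ** transpose (?E x l) = mat 1" for x l by (simp add: reality_condition_def)
  then have "matrix_inv (?E x l) = transpose (?E x l)" for x l
    by (intro matrix_inv_eqI) (simp_all add: matrix_left_right_inverse)
  then have mv: "moved_vector ?E s W Z x $ b = (\<Sum>a\<in>UNIV. ?E x ?l $ a $ b * V $ a)" for x b
    by (simp add: moved_vector_def V_def matrix_vector_mult_def transpose_def)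
  have gl: "?E x l $ a $ Inl j = (\<Sum>i\<in>UNIV. EI x l $ a $ Inl i * complex_of_real (A x $ i $ j))"
    and gr: "?E x l $ a $ Inr k = EI x l $ a $ Inr k" for x l a j k
    by (simp_all add: gauge_def matrix_matrix_mult_def block_def map_matrix_def sum_UNIV_Plus mat_def
        if_distrib[of complex_of_real] mult_delta_right cong: if_cong)
  have "moved_vector ?E s W Z x $ Inl j = (\<Sum>i\<in>UNIV. complex_of_real (A x $ i $ j) * y (Inl i) x)" for x j
    unfolding mv gl y_def sum_distrib_left sum_distrib_right by (subst sum.swap) (simp add: ac_simps)
  then have Wt: "W_tilde ?E s W Z x = transpose (A x) *v ut x" for x
    by (simp add: W_tilde_def vec_eq_iff y_Inl matrix_vector_mult_def transpose_def)
  have "moved_vector ?E s W Z x $ Inr k = y (Inr k) x" for x k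
    unfolding mv gr y_def ..
  then have Zt: "Z_tilde ?E s W Z x = zt x" for x
    by (simp add: Z_tilde_def vec_eq_iff zt_def)
  have "A x ** transpose (A x) = mat 1" for x using orth by (simp add: orthogonal_matrix_def)
  then have AAt: "A x *v (transpose (A x) *v v) = v" for x v
    by (simp only: matrix_vector_mul_assoc matrix_vector_mul_lid)
  \<comment> \<open>The transpose of \<open>A x\<close> is an isometry, so normalizing the gauged
    vector divides by the same \<open>N x\<close>.\<close>
  have "(transpose (A x) *v v) \<bullet> (transpose (A x) *v v) = v \<bullet> v" for x v
    using dot_lmul_matrix[of v "A x" "transpose (A x) *v v"] AAt[of x v] by simp
  then have "norm (W_tilde ?E s W Z x) = N x" for x
    by (simp only: Wt N_def norm_eq_sqrt_inner)
  then have Wh: "W_hat ?E s W Z x = transpose (A x) *v u x" for x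
    by (simp add: W_hat_def Wt u_def matrix_vector_mult_scaleR)
  have Zh: "Z_hat ?E s W Z x = z x" for x
    by (simp add: Z_hat_def Zt z_def N_def ut_zt norm_eq_sqrt_inner)
  have AW: "A x *v W_hat ?E s W Z x = u x" for x
    by (simp only: Wh AAt)
  have w\<beta>: "W_hat ?E s W Z x $ emb i = \<beta> x i" for x i
    by (simp add: Wh matrix_vector_mult_def transpose_def emb \<beta>_def)
  have "(A x ** (mat 1 - 2 *\<^sub>R outer (W_hat ?E s W Z x) (W_hat ?E s W Z x))) $ j $ emb i
      = A1 x $ j $ i - 2 * \<beta> x i * u x $ j" for x i j
  proof -
    have "(A x ** (mat 1 - 2 *\<^sub>R outer (W_hat ?E s W Z x) (W_hat ?E s W Z x))) $ j $ emb i
       = A x $ j $ emb i - 2 * (A x *v W_hat ?E s W Z x) $ j * W_hat ?E s W Z x $ emb i"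
      by (simp add: matrix_matrix_mult_def matrix_vector_mult_def mat_def outer_def algebra_simps
          sum_subtractf sum_distrib_left mult_delta_right)
    then show ?thesis by (simp add: AW w\<beta> emb)
  qed
  then show "B = D.A1'"
    using act by (simp add: g_action_def Let_def D.A1'_def fun_eq_iff vec_eq_iff)
  show "G = D.F'"
    using act by (simp add: g_action_def Let_def D.F'_def fun_eq_iff vec_eq_iff w\<beta> Zh)
  have pc: "join (\<chi> j. complex_of_real r * complex_of_real ((A x *v W_hat ?E s W Z x) $ j))
      (\<chi> i. complex_of_real (s * Z_hat ?E s W Z x $ i)) = (\<chi> b. complex_of_real (D.p r b x))" for x
    by (auto simp: join_def vec_eq_iff D.p_def AW Zh split: sum.split)
  have c: "2 / ((complex_of_real r)\<^sup>2 + (complex_of_real s)\<^sup>2) = complex_of_real (2 / (r\<^sup>2 + s\<^sup>2))" by simp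
  have "EI' x (complex_of_real r) $ a $ b = EI x (complex_of_real r) $ a $ b
      - complex_of_real (2 / (r\<^sup>2 + s\<^sup>2) * D.p r b x)
        * (\<Sum>c\<in>UNIV. complex_of_real (D.p r c x) * EI x (complex_of_real r) $ a $ c)" for x a b
  proof -
    have "EI' x (complex_of_real r) = EI x (complex_of_real r) ** (mat 1
        - cscale (complex_of_real (2 / (r\<^sup>2 + s\<^sup>2)))
            (outer (\<chi> b. complex_of_real (D.p r b x)) (\<chi> b. complex_of_real (D.p r b x))))"
      using act by (simp only: g_action_def Let_def prod.inject pc c)
    then show ?thesis
      by (simp add: matrix_matrix_mult_def mat_def outer_def map_matrix_def algebra_simps
          sum_subtractf sum_distrib_left sum_divide_distrib mult_delta_left mult_delta_right)
  qed
  then show "real_col EI' r = D.dressed r (real_col EI r)"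
    by (simp add: fun_eq_iff vec_eq_iff real_col_def D.dressed_def D.q_def)
qed

end

theorem theorem10p3:
  fixes emb :: "'n::finite \<Rightarrow> 'm::finite" and k0 :: 'm
    and A1 A1' :: "real^'n \<Rightarrow> real^'n^'m" and F F' :: "real^'n \<Rightarrow> real^'n^'n"
    and EI EI' :: "real^'n \<Rightarrow> complex \<Rightarrow> complex^('m + 'n)^('m + 'n)"
    and A :: "real^'n \<Rightarrow> real^'m^'m" and \<xi> :: "real^'n \<Rightarrow> real^'n^'m"
    and s :: real and W :: "real^'m" and Z :: "real^'n"
    and X X' :: "real^'n \<Rightarrow> real^('m + 'n)"
    and eN eN' :: "'m \<Rightarrow> real^'n \<Rightarrow> real^('m + 'n)"
    and eT eT' :: "'n \<Rightarrow> real^'n \<Rightarrow> real^('m + 'n)"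
    and U U' :: "(real^'n) set"
  assumes "inj emb"
    and "gsystemI_solution A1 F" and "gsystemI_frame A1 F EI"
    and "gsystem_lift emb A1 F EI A \<xi>"
    and "s \<noteq> 0" and "norm W = 1" and "norm Z = 1"
    and "(A1', F', EI') = g_action emb s W Z A F EI"
    and "X = real_column EI (Inl k0)" and "X' = real_column EI' (Inl k0)"
    and "eN = (\<lambda>j. real_column EI (Inl j))" and "eN' = (\<lambda>j. real_column EI' (Inl j))"
    and "eT = (\<lambda>i. real_column EI (Inr i))" and "eT' = (\<lambda>i. real_column EI' (Inr i))"
    and "open U" and "\<forall>x\<in>U. \<forall>i. A1 x $ k0 $ i \<noteq> 0"
    and "open U'" and "\<forall>x\<in>U'. \<forall>i. A1' x $ k0 $ i \<noteq> 0"
  shows "(sphere_immersion U X \<and> flat_submanifold U X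
          \<and> flat_normal_bundle U X \<and> nondegenerate_normal_bundle U X
          \<and> orthonormal_frame U (tangent_space X) UNIV eT
          \<and> parallel_normal_frame U X (- {k0}) eN
          \<and> line_of_curvature_coordinates U X eT (- {k0}) eN)
       \<and> (sphere_immersion U' X' \<and> flat_submanifold U' X'
          \<and> flat_normal_bundle U' X' \<and> nondegenerate_normal_bundle U' X'
          \<and> orthonormal_frame U' (tangent_space X') UNIV eT'
          \<and> parallel_normal_frame U' X' (- {k0}) eN'
          \<and> line_of_curvature_coordinates U' X' eT' (- {k0}) eN')
       \<and> (gsystemI_solution A1 F \<and> corresponds k0 U A1 F X eT eN)
       \<and> (gsystemI_solution A1' F' \<and> corresponds k0 U' A1' F' X' eT' eN')
       \<and> (\<forall>P. (\<forall>x\<in>U \<inter> U'. linear_between (sphere_normal_space X x) (P x)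
                  \<and> (\<forall>j\<in>- {k0}. P x (eN j x) = eN' j x))
             \<longrightarrow> ribaucour_transformation (U \<inter> U') X (U \<inter> U') X' (\<lambda>x. x) P)"
proof -
  interpret S: systemI_dressing A1 F EI s W Z
    using assms by unfold_locales
  note act = S.g_action_eq[OF assms(4,8)]
  define e where "e r = real_col EI r" for r
  define e' where "e' r = real_col EI' r" for r
  have mf: "moving_frame A1 F r (e r)" for r
    unfolding e_def by (rule S.moving_frame_real_col)
  have mf': "moving_frame A1' F' r (e' r)" for r
    unfolding e'_def act by (rule S.moving_frame_dressed)
  have sol': "gsystemI_solution A1' F'"
    unfolding act by (rule S.dressed_solution)
  interpret M: lax_frame_patch A1 F "e 1" "e 0" k0 U
    by unfold_locales (use assms mf in \<open>auto simp: gsystemI_solution_def\<close>)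
  interpret N: lax_frame_patch A1' F' "e' 1" "e' 0" k0 U'
    by unfold_locales (use assms sol' mf' in \<open>auto simp: gsystemI_solution_def\<close>)
  \<comment> \<open>Both immersions use the same parameter, so the covering map is the identity of
    the common patch. At spectral value 1 the direction of all differences is
    \<open>S.D.q 1 (e 1) x\<close>.\<close>
  interpret R: lax_frame_pair A1 A1' F F' "e 1" "e 0" "e' 1" "e' 0" k0 "U \<inter> U'"
  proof unfold_locales
    fix x
    have "e' 1 b x = e 1 b x - (2 / (1\<^sup>2 + s\<^sup>2) * S.D.p 1 b x) *\<^sub>R S.D.q 1 (e 1) x" for b
      unfolding e'_def act e_def by (rule S.D.dressed_def)
    from allI[OF this] show "\<exists>q \<mu>. \<forall>b. e' 1 b x = e 1 b x - \<mu> b *\<^sub>R q" by (intro exI)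
  qed (use assms in auto)
  have cols: "X = e 1 (Inl k0)" "X' = e' 1 (Inl k0)" "eN = (\<lambda>j. e 1 (Inl j))" "eN' = (\<lambda>j. e' 1 (Inl j))"
    "eT = (\<lambda>i. e 1 (Inr i))" "eT' = (\<lambda>i. e' 1 (Inr i))"
    using assms by (simp_all add: e_def e'_def real_column_eq)
  show ?thesis
    unfolding cols
    using M.immersion M.flat_tangent M.flat_normal M.nondegenerate M.orthonormal_tangent
      M.parallel_normal M.curvature_lines M.corresponding
      N.immersion N.flat_tangent N.flat_normal N.nondegenerate N.orthonormal_tangent
      N.parallel_normal N.curvature_lines N.corresponding
      assms(2) sol' R.ribaucour by simp
qed

end
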